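(* Let $D\ge 0$, $G\ge 0$, $H_*>0$. Let $\sigma\in C^1([0,1))$ satisfy $\sigma'<0$ on $[0,1)$, $\sigma'\notin L_1(0,1)$, $\sigma_0:=\sigma(0)>0$ and $\sigma'(z)\to-\infty$ as $z\to1$. Put $\varrho:=-1/\sigma'$ on $[0,1)$ and $\varrho(1):=0$, and if $G>0$ assume in addition that $\varrho$ is Lipschitz continuous on $[0,z]$ for every $z\in(0,1)$. Then there is a traveling wave profile $(H,\Gamma):\mathbb{R}\to\mathbb{R}^2$ with velocity $c=1$, meaning that $(h,\gamma)(t,x):=(H,\Gamma)(x-t)$ is a weak solution on $(0,\infty)$ (see context) to $$\partial_t h+\partial_x\Big(-\tfrac{G h^3}{3}\partial_x h+\tfrac{h^2}{2}\sigma'(\gamma)\partial_x\gamma\Big)=0,\qquad \partial_t\gamma+\partial_x\Big(-\tfrac{G h^2}{2}\gamma\,\partial_x h+[h\gamma\sigma'(\gamma)-D]\partial_x\gamma\Big)=0,$$ such that $\Gamma$ is non-increasing, $H(\xi)\to 2H_*$ and $\Gamma(\xi)\to1$ as $\xi\to-\infty$, $H(\xi)\to H_*$ and $\Gamma(\xi)\to 0$ as $\xi\to\infty$, and which has the following further properties: (i) If $G=0$ and $D=0$, then $\Gamma\in C(\mathbb{R})$, $(H,\Gamma)$ is continuously differentiable except at $\xi=0$, and $$H(\xi)=\begin{cases}2H_*,&\xi<0,\\ H_*,&\xi>0,\end{cases}\qquad \Gamma(\xi)=\begin{cases}\sigma^{-1}\big(\sigma_0+\tfrac{\xi}{2H_*}\big),&\xi\le0,\\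 0,&\xi\ge0.\end{cases}$$ (ii) If $G=0$ and $D>0$, then $H\in C(\mathbb{R})$, $\Gamma\in C^1(\mathbb{R})$, $$H_*<H(\xi)<2H_*,\quad 0<\Gamma(\xi)<1,\qquad \xi\in\mathbb{R},$$ and for all $\xi\in\mathbb{R}$ $$H(\xi)=\frac{D+\Gamma\sigma'(\Gamma)H_*-\sqrt{D^2+(\Gamma\sigma'(\Gamma)H_* )^2}}{\Gamma\sigma'(\Gamma)}(\xi),$$ $$\int_{\Gamma(0)}^{\Gamma(\xi)}\Big[z\sigma'(z)H_*-\sqrt{D^2+(z\sigma'(z)H_* )^2}\Big]\frac{dz}{z}=\xi .$$ (iii) If $G>0$ and $D=0$, then $(H,\Gamma)\in C(\mathbb{R},\mathbb{R}^2)$ is continuously differentiable except at $\xi=0$; moreover $H$ is decreasing on $[0,\infty)$ and equals $2H_*$ on $(-\infty,0]$, while $\Gamma\equiv0$ on $[0,\infty)$. (iv) If $G>0$ and $D>0$, then $(H,\Gamma)\in C^1(\mathbb{R},\mathbb{R}^2)$ and $H_*<H(\xi)<2H_*$, $0<\Gamma(\xi)<1$ for all $\xi\in\mathbb{R}$.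
   Context: Weak solution. Given a bounded open interval $I\subset\mathbb{R}$, a pair $(h,\gamma):I\times\mathbb{R}\to\mathbb{R}^2$ is a weak solution of the system on $I$ if: (i) $h\in L_\infty(I,L_{2,loc}(\mathbb{R}))\cap L_2(I,L_{\infty,loc}(\mathbb{R}))$ with $G h^{5/2}\in L_2(I,W^1_{2,loc}(\mathbb{R}))$, and $h\ge0$ a.e. in $I\times\mathbb{R}$; (ii) $\gamma\in L_\infty(I\times\mathbb{R})$ with $D\gamma\in L_2(I,W^1_{2,loc}(\mathbb{R}))$, and $\gamma\in[0,1)$ a.e. in $I\times\mathbb{R}$; (iii) $\sigma(\gamma)\in L_2(I,W^1_{2,loc}(\mathbb{R}))$; (iv) for all $\varphi\in C_0^\infty(I\times\mathbb{R})$, $$\int_I\int_{\mathbb{R}}\Big(h\,\partial_t\varphi+\tfrac{h^2}{2}\partial_x\sigma(\gamma)\,\partial_x\varphi-\tfrac{G}{12}\partial_x h^4\,\partial_x\varphi\Big)dx\,dt=0,$$ $$\int_I\int_{\mathbb{R}}\Big(\gamma\,\partial_t\varphi+h\gamma\,\partial_x\sigma(\gamma)\,\partial_x\varphi-D\,\partial_x\gamma\,\partial_x\varphi-\tfrac{G}{6}\gamma\,\partial_x h^3\,\partial_x\varphi\Big)dx\,dt=0.$$ For an unbounded open interval $I$, $(h,\gamma)$ is a weak solution on $I$ if it is a weak solution on every bounded open subinterval of $I$. (When $G=0$ or $D=0$ the terms multiplied by $G$, respectively $D$, are absent.) Under the assumptions on $\sigma$, the map $\sigma:[0,1)\to(-\infty,\sigma_0]$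 is a decreasing bijection, with inverse $\sigma^{-1}$. *)

theory Defs
  imports "HOL-Analysis.Analysis" "HOL-Probability.Essential_Supremum"
begin

section \<open>Test functions\<close>

definition partial_deriv :: "'a::euclidean_space \<Rightarrow> ('a \<Rightarrow> real) \<Rightarrow> 'a \<Rightarrow> real" where
  "partial_deriv b f x = deriv (\<lambda>s. f (x + s *\<^sub>R b)) 0"

primrec Ck :: "nat \<Rightarrow> ('a::euclidean_space \<Rightarrow> real) \<Rightarrow> bool" where
  "Ck 0 f \<longleftrightarrow> continuous_on UNIV f"
| "Ck (Suc k) f \<longleftrightarrow>
     (\<forall>b\<in>Basis. (\<forall>x. (\<lambda>s. f (x + s *\<^sub>R b)) differentiable (at 0)) \<and> Ck k (partial_deriv b f))"

text \<open>The space \<open>C\<^sub>0\<^sup>\<infinity>(U)\<close> for open \<open>U\<close>; its elements are extended by zero to the whole space.\<close>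

definition test_functions :: "'a::euclidean_space set \<Rightarrow> ('a \<Rightarrow> real) set" where
  "test_functions U =
     {\<phi>. (\<forall>k. Ck k \<phi>) \<and> compact (closure {x. \<phi> x \<noteq> 0}) \<and> closure {x. \<phi> x \<noteq> 0} \<subseteq> U}"

section \<open>Function spaces on \<open>I \<times> \<real>\<close>\<close>

text \<open>
  A function of time \<open>t \<in> I\<close> and space \<open>x \<in> \<real>\<close> is a function of the pair \<open>(t, x)\<close>. Elements of
  \<open>L\<^sub>p(I, X)\<close> are represented by jointly Lebesgue measurable functions \<open>u\<close> whose slices \<open>u(t, \<cdot>)\<close>
  lie in \<open>X\<close> for almost every \<open>t\<close>. For a local space \<open>X\<close> the condition on the norm is imposed on
  every interval \<open>[-R, R]\<close>. For \<open>X = L\<^sub>\<infinity>\<^sub>,\<^sub>l\<^sub>o\<^sub>c\<close>, which is not separable, joint measurability is weaker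
  than strong (Bochner) measurability. The latter would exclude travelling waves with a jump:
  if \<open>H\<close> is a step function, then \<open>t \<mapsto> H(\<cdot> - t)\<close> is not essentially separably valued.
\<close>

definition xt_measurable :: "real set \<Rightarrow> (real \<times> real \<Rightarrow> real) \<Rightarrow> bool" where
  "xt_measurable I u \<longleftrightarrow> u \<in> borel_measurable (lebesgue_on (I \<times> UNIV))"

definition weak_deriv :: "(real \<Rightarrow> real) \<Rightarrow> (real \<Rightarrow> real) \<Rightarrow> bool" where
  "weak_deriv f g \<longleftrightarrow>
     (\<forall>K. compact K \<longrightarrow> f absolutely_integrable_on K \<and> g absolutely_integrable_on K) \<and>
     (\<forall>\<psi>\<in>test_functions UNIV. (LINT x|lebesgue. f x * deriv \<psi> x) = - (LINT x|lebesgue. g x * \<psi> x))"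

text \<open>\<open>v = \<partial>\<^sub>x u\<close> on \<open>I \<times> \<real>\<close> in the weak sense; \<open>v\<close> is determined up to a null set.\<close>

definition weak_dx :: "real set \<Rightarrow> (real \<times> real \<Rightarrow> real) \<Rightarrow> (real \<times> real \<Rightarrow> real) \<Rightarrow> bool" where
  "weak_dx I u v \<longleftrightarrow> xt_measurable I v \<and>
     (AE t in lebesgue_on I. weak_deriv (\<lambda>x. u (t, x)) (\<lambda>x. v (t, x)))"

definition Linf_L2loc :: "real set \<Rightarrow> (real \<times> real \<Rightarrow> real) set" where
  "Linf_L2loc I = {u. xt_measurable I u \<and>
     (\<forall>R>0. \<exists>C::real. AE t in lebesgue_on I.
        (\<integral>\<^sup>+x. ennreal ((u (t, x))\<^sup>2) \<partial>lebesgue_on {-R..R}) \<le> ennreal C)}"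

definition L2_Linfloc :: "real set \<Rightarrow> (real \<times> real \<Rightarrow> real) set" where
  "L2_Linfloc I = {u. xt_measurable I u \<and>
     (\<forall>R>0. (\<integral>\<^sup>+t. (esssup (lebesgue_on {-R..R}) (\<lambda>x. ennreal \<bar>u (t, x)\<bar>))\<^sup>2 \<partial>lebesgue_on I) < \<infinity>)}"

definition L2_W12loc :: "real set \<Rightarrow> (real \<times> real \<Rightarrow> real) set" where
  "L2_W12loc I = {u. xt_measurable I u \<and>
     (\<exists>v. weak_dx I u v \<and>
       (\<forall>R>0. (\<integral>\<^sup>+t. (\<integral>\<^sup>+x. ennreal ((u (t, x))\<^sup>2 + (v (t, x))\<^sup>2) \<partial>lebesgue_on {-R..R})
                 \<partial>lebesgue_on I) < \<infinity>))}"

definition Linf :: "real set \<Rightarrow> (real \<times> real \<Rightarrow> real) set" where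
  "Linf I = {u. xt_measurable I u \<and> (\<exists>C. AE p in lebesgue_on (I \<times> UNIV). \<bar>u p\<bar> \<le> C)}"

section \<open>Weak solutions and travelling waves\<close>

text \<open>
  In the integral identities \<open>s\<close>, \<open>h4\<close>, \<open>h3\<close> and \<open>g\<close> are the weak \<open>x\<close>-derivatives of \<open>\<sigma>(\<gamma>)\<close>,
  \<open>h\<^sup>4\<close>, \<open>h\<^sup>3\<close> and \<open>\<gamma>\<close>. The last three need not exist when their coefficient \<open>G\<close> or \<open>D\<close> vanishes,
  and then do not contribute. The iterated integrals are taken as integrals over \<open>I \<times> \<real>\<close>, and
  \<open>has_bochner_integral\<close> makes the integrability of the integrands part of the claim (it follows
  from the other conditions).
\<close>

definition weak_solution_bounded ::
  "real \<Rightarrow> real \<Rightarrow> (real \<Rightarrow> real) \<Rightarrow> real set \<Rightarrow>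
   (real \<times> real \<Rightarrow> real) \<Rightarrow> (real \<times> real \<Rightarrow> real) \<Rightarrow> bool" where
  "weak_solution_bounded G D \<sigma> I h \<gamma> \<longleftrightarrow>
     h \<in> Linf_L2loc I \<inter> L2_Linfloc I \<and>
     (\<lambda>p. G * h p powr (5/2)) \<in> L2_W12loc I \<and>
     (AE p in lebesgue_on (I \<times> UNIV). 0 \<le> h p) \<and>
     \<gamma> \<in> Linf I \<and>
     (\<lambda>p. D * \<gamma> p) \<in> L2_W12loc I \<and>
     (AE p in lebesgue_on (I \<times> UNIV). \<gamma> p \<in> {0..<1}) \<and>
     (\<lambda>p. \<sigma> (\<gamma> p)) \<in> L2_W12loc I \<and>
     (\<exists>s h4 h3 g.
        weak_dx I (\<lambda>p. \<sigma> (\<gamma> p)) s \<and>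
        (G \<noteq> 0 \<longrightarrow> weak_dx I (\<lambda>p. h p ^ 4) h4 \<and> weak_dx I (\<lambda>p. h p ^ 3) h3) \<and>
        (D \<noteq> 0 \<longrightarrow> weak_dx I \<gamma> g) \<and>
        (\<forall>\<phi>\<in>test_functions (I \<times> UNIV).
           has_bochner_integral (lebesgue_on (I \<times> UNIV))
             (\<lambda>p. h p * partial_deriv (1, 0) \<phi> p
                + (h p)\<^sup>2 / 2 * s p * partial_deriv (0, 1) \<phi> p
                - G / 12 * h4 p * partial_deriv (0, 1) \<phi> p) 0 \<and>
           has_bochner_integral (lebesgue_on (I \<times> UNIV))
             (\<lambda>p. \<gamma> p * partial_deriv (1, 0) \<phi> p
                + h p * \<gamma> p * s p * partial_deriv (0, 1) \<phi> p
                - D * g p * partial_deriv (0, 1) \<phi> p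
                - G / 6 * \<gamma> p * h3 p * partial_deriv (0, 1) \<phi> p) 0))"

definition weak_solution ::
  "real \<Rightarrow> real \<Rightarrow> (real \<Rightarrow> real) \<Rightarrow> real set \<Rightarrow>
   (real \<times> real \<Rightarrow> real) \<Rightarrow> (real \<times> real \<Rightarrow> real) \<Rightarrow> bool" where
  "weak_solution G D \<sigma> I h \<gamma> \<longleftrightarrow>
     (if bounded I then weak_solution_bounded G D \<sigma> I h \<gamma>
      else \<forall>J. open J \<and> is_interval J \<and> bounded J \<and> J \<subseteq> I \<longrightarrow> weak_solution_bounded G D \<sigma> J h \<gamma>)"

definition traveling_wave_profile ::
  "real \<Rightarrow> real \<Rightarrow> (real \<Rightarrow> real) \<Rightarrow> real \<Rightarrow> (real \<Rightarrow> real) \<Rightarrow> (real \<Rightarrow> real) \<Rightarrow> bool" where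
  "traveling_wave_profile G D \<sigma> c H \<Gamma> \<longleftrightarrow>
     weak_solution G D \<sigma> {0<..} (\<lambda>(t, x). H (x - c * t)) (\<lambda>(t, x). \<Gamma> (x - c * t))"

end

(*
  With c = 1 the equations integrate once to
    H^2/2 W - G/3 H^3 H' = H - Hs,    H Gamma W - D Gamma' - G/2 Gamma H^2 H' = Gamma,
  where W = (sigma o Gamma)'. For D > 0 take tau = sigma(Gamma) - D ln Gamma as independent
  variable. With q = Gamma sigma'(Gamma) / (Gamma sigma'(Gamma) - D), a known function of tau with
  values in (0,1), the system decouples into a scalar equation for h(tau),
    G dh/dtau = -6 N(q,h) / (h^2 (3 Hs - h)),   N(q,y) = q y (y/2 - Hs) + (1-q) (y - Hs),
  and a quadrature dxi/dtau = kappa > 0. For G = 0 it reads N(q,h) = 0. For G > 0 the constants Hs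
  and 2 Hs are a sub- and a supersolution, so that a solution on the whole line is the limit of a
  monotone iteration. It tends to the zero of N(1,.) or N(0,.) as tau goes to -oo or oo. For D = 0
  the waves are explicit up to a quadrature: H = 2 Hs where Gamma > 0, and W = 0 where Gamma = 0.
*)

theory Submission
  imports Defs "HOL-Probability.Sinc_Integral"
begin

text \<open>Divide the second first integral by \<open>\<Gamma>\<close> and insert
  \<open>W = q \<tau>'\<close> and \<open>- D \<Gamma>' / \<Gamma> = (1 - q) \<tau>'\<close>: both
  laws become linear in the rates \<open>\<tau>'\<close> and \<open>G H'\<close>. Eliminating
  \<open>\<tau>'\<close> produces N and the factor \<open>3 Hs - h\<close>; back substitution gives
  \<open>kappa = h (h q + 4 (1 - q)) / (2 (3 Hs - h))\<close>, which is bounded away from zero for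
  \<open>Hs < h < 2 Hs\<close>. Hence the coordinate xi covers the whole line when tau does. The
  obstacle is that a connection between two end states has no initial value. In tau it is a
  nonautonomous scalar equation on all of the line, and the data missing at minus infinity are
  replaced by boundedness: the Duhamel integral is started at minus infinity. That tau runs over the
  whole line rests on \<open>- D ln z\<close> near 0 and on the non-integrability of
  \<open>\<sigma>'\<close> near 1. The ends of q come from \<open>z \<sigma>'(z)\<close>, which
  vanishes at 0 and tends to minus infinity at 1. Since \<open>N(1,y) = y (y/2 - Hs)\<close> and
  \<open>N(0,y) = y - Hs\<close>, these ends select the heights \<open>2 Hs\<close> and
  \<open>Hs\<close>.\<close>

section \<open>Weak derivatives of travelling profiles\<close>

text \<open>The exceptional point is the front, where the profiles without diffusion have a kink.\<close>

definition pw_primitive :: "(real \<Rightarrow> real) \<Rightarrow> (real \<Rightarrow> real) \<Rightarrow> bool" where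
  "pw_primitive U V \<longleftrightarrow> continuous_on UNIV U \<and> V \<in> borel_measurable borel \<and>
     (\<forall>x. x \<noteq> 0 \<longrightarrow> (U has_real_derivative V x) (at x)) \<and> (\<forall>R. \<exists>C. \<forall>x. \<bar>x\<bar> \<le> R \<longrightarrow> \<bar>V x\<bar> \<le> C)"

section \<open>Integrals over compact supports and derivatives of test functions\<close>

lemma continuous_on_compact_abs_bound:
  fixes f :: "'a::topological_space \<Rightarrow> real"
  assumes "continuous_on UNIV f" "compact K"
  shows "\<exists>C. \<forall>x\<in>K. \<bar>f x\<bar> \<le> C"
proof -
  have "bounded (f ` K)"
    using assms by (intro compact_imp_bounded compact_continuous_image) (auto elim: continuous_on_subset)
  then show ?thesis by (auto simp: bounded_iff)
qed

lemma integrable_lborel_bounded_support: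
  fixes f :: "'a::euclidean_space \<Rightarrow> real"
  assumes "f \<in> borel_measurable borel" "bounded S"
    and "\<And>x. x \<in> S \<Longrightarrow> \<bar>f x\<bar> \<le> C" and "\<And>x. x \<notin> S \<Longrightarrow> f x = 0"
  shows "integrable lborel f"
proof -
  obtain a where a: "S \<subseteq> cball 0 a"
    using assms(2) by (auto simp: bounded_iff subset_iff)
  show ?thesis
  proof (rule integrableI_bounded_set[where A="cball 0 a" and B="max C 0"])
    show "emeasure lborel (cball 0 a :: 'a set) < \<infinity>"
      using emeasure_bounded_finite[of "cball 0 a :: 'a set"] by (simp add: less_top)
    show "AE x in lborel. x \<in> cball 0 a \<longrightarrow> norm (f x) \<le> max C 0"
    proof (intro AE_I2 impI)
      fix x show "norm (f x) \<le> max C 0"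
        using assms(3)[of x] assms(4)[of x] by (cases "x \<in> S") auto
    qed
    show "AE x in lborel. x \<notin> cball 0 a \<longrightarrow> f x = 0"
      using assms(4) a by (intro AE_I2) (auto simp: subset_iff)
  qed (use assms(1) in auto)
qed

text \<open>The fundamental theorem of calculus on an interval that contains the support in its
  interior. Kinks in the finite set \<open>X\<close> do no harm because \<open>f\<close> is
  continuous across them.\<close>

lemma has_bochner_integral_deriv_compact_support:
  fixes f f' :: "real \<Rightarrow> real"
  assumes "continuous_on UNIV f" "f' \<in> borel_measurable borel" "finite X"
    and der: "\<And>x. x \<notin> X \<Longrightarrow> (f has_real_derivative f' x) (at x)"
    and bd: "\<And>x. \<bar>x\<bar> \<le> R \<Longrightarrow> \<bar>f' x\<bar> \<le> C"
    and zero: "\<And>x. R < \<bar>x\<bar> \<Longrightarrow> f x = 0" "\<And>x. R < \<bar>x\<bar> \<Longrightarrow> f' x = 0"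
  shows "has_bochner_integral lborel f' 0"
proof -
  have int: "integrable lborel f'"
  proof (rule integrable_lborel_bounded_support[where S="{-R..R}" and C=C])
    show "bounded {-R..R}" by (rule bounded_closed_interval)
  qed (use assms in \<open>auto simp: abs_le_iff\<close>)
  \<comment> \<open>The vanishing of \<open>f\<close> is known only strictly beyond
    \<open>R\<close>, and \<open>R\<close> may be negative; this \<open>b\<close> lies strictly
    beyond \<open>R\<close> in either case.\<close>
  define b where "b = \<bar>R\<bar> + 1"
  have "(f' has_integral (f b - f (-b))) {-b..b}"
    using assms(1,3)
    by (intro fundamental_theorem_of_calculus_interior_strong[where S=X])
      (auto simp: b_def has_real_derivative_iff_has_vector_derivative[symmetric] intro!: der
            elim: continuous_on_subset)
  then have "(f' has_integral 0) {-b..b}"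
    using zero(1)[of b] zero(1)[of "-b"] by (auto simp: b_def)
  then have "(f' has_integral 0) UNIV"
    by (rule has_integral_on_superset) (auto simp: b_def intro!: zero(2))
  then have "integral\<^sup>L lborel f' = 0"
    using has_integral_integral_lborel[OF int] by (rule has_integral_unique[rotated])
  with int show ?thesis by (simp add: has_bochner_integral_iff)
qed

lemma partial_deriv_eq_0:
  assumes "x \<notin> closure {x. f x \<noteq> 0}"
  shows "partial_deriv b f x = 0"
proof -
  have "open (- closure {x. f x \<noteq> 0})" by auto
  then have "eventually (\<lambda>y. y \<in> - closure {x. f x \<noteq> 0}) (nhds x)"
    using assms by (intro eventually_nhds_in_open) auto
  moreover have "((\<lambda>s. x + s *\<^sub>R b) \<longlongrightarrow> x + 0 *\<^sub>R b) (nhds 0)"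
    by (intro tendsto_intros filterlim_ident)
  then have "filterlim (\<lambda>s. x + s *\<^sub>R b) (nhds x) (nhds 0)" by simp
  ultimately have ev: "eventually (\<lambda>s. x + s *\<^sub>R b \<in> - closure {x. f x \<noteq> 0}) (nhds 0)"
    by (rule eventually_compose_filterlim)
  have "eventually (\<lambda>s. f (x + s *\<^sub>R b) = 0) (nhds 0)"
    by (rule eventually_mono[OF ev]) (use closure_subset[of "{x. f x \<noteq> 0}"] in auto)
  then have "deriv (\<lambda>s. f (x + s *\<^sub>R b)) 0 = deriv (\<lambda>s. 0) (0::real)"
    by (intro deriv_cong_ev) auto
  then show ?thesis by (simp add: partial_deriv_def)
qed

lemma test_functions_partial:
  assumes "\<phi> \<in> test_functions U" "b \<in> Basis"
  shows "continuous_on UNIV (partial_deriv b \<phi>)"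
    and "((\<lambda>s. \<phi> (x + s *\<^sub>R b)) has_real_derivative partial_deriv b \<phi> x) (at 0)"
proof -
  have C: "Ck 1 \<phi>" using assms(1) by (auto simp: test_functions_def)
  then show "continuous_on UNIV (partial_deriv b \<phi>)" using assms(2) by simp
  have "(\<lambda>s. \<phi> (x + s *\<^sub>R b)) differentiable (at 0)" using C assms(2) by simp
  then show "((\<lambda>s. \<phi> (x + s *\<^sub>R b)) has_real_derivative partial_deriv b \<phi> x) (at 0)"
    unfolding partial_deriv_def
    by (metis DERIV_imp_deriv real_differentiable_def)
qed

lemma test_functions_partial':
  assumes "\<phi> \<in> test_functions U" "b \<in> Basis"
  shows "((\<lambda>s. \<phi> (x + s *\<^sub>R b)) has_real_derivative partial_deriv b \<phi> (x + r *\<^sub>R b)) (at r)"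
proof -
  have "((\<lambda>s. \<phi> ((x + r *\<^sub>R b) + s *\<^sub>R b)) has_real_derivative partial_deriv b \<phi> (x + r *\<^sub>R b)) (at 0)"
    using assms by (rule test_functions_partial(2))
  then have "((\<lambda>s. \<phi> (x + (s + r) *\<^sub>R b)) has_real_derivative partial_deriv b \<phi> (x + r *\<^sub>R b)) (at 0)"
    by (simp add: scaleR_add_left add_ac)
  then show ?thesis
    using DERIV_shift[of "\<lambda>s. \<phi> (x + s *\<^sub>R b)" _ 0 r] by simp
qed

lemma test_functions_support:
  assumes "\<phi> \<in> test_functions U"
  obtains S where "compact S" "S \<subseteq> U" "\<And>x. x \<notin> S \<Longrightarrow> \<phi> x = 0"
    "\<And>x b. x \<notin> S \<Longrightarrow> partial_deriv b \<phi> x = 0"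
proof (rule that[of "closure {x. \<phi> x \<noteq> 0}"])
  show "compact (closure {x. \<phi> x \<noteq> 0})" "closure {x. \<phi> x \<noteq> 0} \<subseteq> U"
    using assms by (auto simp: test_functions_def)
  show "\<phi> x = 0" if "x \<notin> closure {x. \<phi> x \<noteq> 0}" for x
    using that closure_subset[of "{x. \<phi> x \<noteq> 0}"] by auto
qed (rule partial_deriv_eq_0)

text \<open>Integration by parts amounts to the vanishing integral of the derivative of
  \<open>U (x - t) * \<psi> x\<close>. The kink of \<open>U\<close> at the origin has moved to
  \<open>x = t\<close>, the only exceptional point.\<close>

lemma weak_deriv_translate:
  assumes "pw_primitive U V"
  shows "weak_deriv (\<lambda>x. U (x - t)) (\<lambda>x. V (x - t))"
proof -
  have U: "continuous_on UNIV U" and V[measurable]: "V \<in> borel_measurable borel"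
    and der: "\<And>x. x \<noteq> 0 \<Longrightarrow> (U has_real_derivative V x) (at x)"
    and bd: "\<And>R. \<exists>C. \<forall>x. \<bar>x\<bar> \<le> R \<longrightarrow> \<bar>V x\<bar> \<le> C"
    using assms by (auto simp: pw_primitive_def)
  have U'[measurable]: "U \<in> borel_measurable borel"
    using U by (rule borel_measurable_continuous_onI)
  have Ut: "continuous_on UNIV (\<lambda>x. U (x - t))"
    by (intro continuous_on_compose2[OF U] continuous_intros) auto
  have ai: "f absolutely_integrable_on K"
    if K: "compact K" and [measurable]: "f \<in> borel_measurable borel" 
      and "\<And>x. x \<in> K \<Longrightarrow> \<bar>f x\<bar> \<le> C" for f :: "real \<Rightarrow> real" and K C
  proof -
    have [measurable]: "K \<in> sets borel" using K by (simp add: borel_compact)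
    have "integrable lborel (\<lambda>x. indicator K x *\<^sub>R f x)"
      by (rule integrable_lborel_bounded_support[where S=K and C=C])
        (use that K compact_imp_bounded in auto)
    then show ?thesis
      unfolding set_integrable_def by (subst integrable_completion) auto
  qed
  have bdV: "\<exists>C. \<forall>x\<in>K. \<bar>V (x - t)\<bar> \<le> C" if K: "compact K" for K
  proof -
    obtain R where R: "\<And>x. x \<in> K \<Longrightarrow> \<bar>x\<bar> \<le> R"
      using compact_imp_bounded[OF K] by (auto simp: bounded_iff)
    obtain C where C: "\<And>x. \<bar>x\<bar> \<le> R + \<bar>t\<bar> \<Longrightarrow> \<bar>V x\<bar> \<le> C" using bd by blast
    have "\<bar>V (x - t)\<bar> \<le> C" if "x \<in> K" for x using R[OF that] by (intro C) linarith
    then show ?thesis by blast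
  qed
  have bdU: "\<exists>C. \<forall>x\<in>K. \<bar>U (x - t)\<bar> \<le> C" if K: "compact K" for K
    using Ut K by (rule continuous_on_compact_abs_bound)
  have "(LINT x|lebesgue. U (x - t) * deriv \<psi> x) = - (LINT x|lebesgue. V (x - t) * \<psi> x)"
    if psi: "\<psi> \<in> test_functions UNIV" for \<psi> :: "real \<Rightarrow> real"
  proof -
    obtain S where S: "compact S" "\<And>x. x \<notin> S \<Longrightarrow> \<psi> x = 0"
      "\<And>x b. x \<notin> S \<Longrightarrow> partial_deriv b \<psi> x = 0"
      using test_functions_support[OF psi] by metis
    obtain R where R: "\<And>x. x \<in> S \<Longrightarrow> \<bar>x\<bar> \<le> R"
      using compact_imp_bounded[OF S(1)] by (auto simp: bounded_iff)
    define \<psi>' where "\<psi>' = partial_deriv 1 \<psi>"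
    have d\<psi>: "(\<psi> has_real_derivative \<psi>' x) (at x)" for x
      using test_functions_partial'[OF psi, of 1 0 x] by (simp add: \<psi>'_def)
    then have deriv_eq: "deriv \<psi> x = \<psi>' x" for x by (rule DERIV_imp_deriv)
    have c\<psi>': "continuous_on UNIV \<psi>'" 
      using test_functions_partial(1)[OF psi, of 1] by (simp add: \<psi>'_def)
    have c\<psi>: "continuous_on UNIV \<psi>" by (intro continuous_at_imp_continuous_on ballI DERIV_isCont[OF d\<psi>])
    have [measurable]: "\<psi> \<in> borel_measurable borel" "\<psi>' \<in> borel_measurable borel"
      using c\<psi> c\<psi>' by (auto intro: borel_measurable_continuous_onI)
    obtain C1 where C1: "\<And>x. x \<in> {-R..R} \<Longrightarrow> \<bar>U (x - t)\<bar> \<le> C1" using bdU[OF compact_Icc] by blast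
    obtain C2 where C2: "\<And>x. x \<in> {-R..R} \<Longrightarrow> \<bar>V (x - t)\<bar> \<le> C2" using bdV[OF compact_Icc] by blast
    obtain C3 where C3: "\<And>x. x \<in> {-R..R} \<Longrightarrow> \<bar>\<psi> x\<bar> \<le> C3" using continuous_on_compact_abs_bound[OF c\<psi> compact_Icc] by blast
    obtain C4 where C4: "\<And>x. x \<in> {-R..R} \<Longrightarrow> \<bar>\<psi>' x\<bar> \<le> C4" using continuous_on_compact_abs_bound[OF c\<psi>' compact_Icc] by blast
    have z: "\<psi> x = 0" "\<psi>' x = 0" if "R < \<bar>x\<bar>" for x
      using that S(2)[of x] S(3)[of x] R[of x] by (auto simp: \<psi>'_def)
    have b1: "\<bar>U (x - t) * \<psi>' x\<bar> \<le> C1 * C4" if "x \<in> {-R..R}" for x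
      unfolding abs_mult using C1[OF that] C4[OF that] by (intro mult_mono) auto
    have b2: "\<bar>V (x - t) * \<psi> x\<bar> \<le> C2 * C3" if "x \<in> {-R..R}" for x
      unfolding abs_mult using C2[OF that] C3[OF that] by (intro mult_mono) auto
    have i1: "integrable lborel (\<lambda>x. U (x - t) * \<psi>' x)"
      by (rule integrable_lborel_bounded_support[where S="{-R..R}" and C="C1 * C4"])
        (use b1 z in auto)
    have i2: "integrable lborel (\<lambda>x. V (x - t) * \<psi> x)"
      by (rule integrable_lborel_bounded_support[where S="{-R..R}" and C="C2 * C3"])
        (use b2 z in auto)
    have "has_bochner_integral lborel (\<lambda>x. V (x - t) * \<psi> x + U (x - t) * \<psi>' x) 0"
    proof (rule has_bochner_integral_deriv_compact_support[where f="\<lambda>x. U (x - t) * \<psi> x" and X="{t}" and R=R and C="C2 * C3 + C1 * C4"])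
      fix x assume "x \<notin> {t}"
      then have "((\<lambda>x. U (x - t)) has_real_derivative V (x - t) * 1) (at x)"
        by (intro DERIV_chain2[OF der]) (auto intro!: derivative_eq_intros)
      then show "((\<lambda>x. U (x - t) * \<psi> x) has_real_derivative V (x - t) * \<psi> x + U (x - t) * \<psi>' x) (at x)"
        using d\<psi> by (auto intro!: derivative_eq_intros)
    next
      fix x assume "\<bar>x\<bar> \<le> R"
      then have "x \<in> {-R..R}" by auto
      from b1[OF this] b2[OF this]
      show "\<bar>V (x - t) * \<psi> x + U (x - t) * \<psi>' x\<bar> \<le> C2 * C3 + C1 * C4" by linarith
    qed (use z in \<open>auto intro!: continuous_intros Ut c\<psi>\<close>)
    then have "(LINT x|lborel. V (x - t) * \<psi> x) + (LINT x|lborel. U (x - t) * \<psi>' x) = 0"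
      using i1 i2 by (simp add: has_bochner_integral_iff)
    moreover have "(LINT x|lebesgue. U (x - t) * \<psi>' x) = (LINT x|lborel. U (x - t) * \<psi>' x)"
      by (rule integral_completion) auto
    moreover have "(LINT x|lebesgue. V (x - t) * \<psi> x) = (LINT x|lborel. V (x - t) * \<psi> x)"
      by (rule integral_completion) auto
    ultimately show ?thesis by (simp add: deriv_eq)
  qed
  moreover have "(\<lambda>x. U (x - t)) absolutely_integrable_on K \<and> (\<lambda>x. V (x - t)) absolutely_integrable_on K"
    if "compact K" for K
  proof -
    from bdU[OF that] bdV[OF that] obtain C1 C2 where "\<forall>x\<in>K. \<bar>U (x - t)\<bar> \<le> C1" "\<forall>x\<in>K. \<bar>V (x - t)\<bar> \<le> C2"
      by blast
    then show ?thesis using that by (auto intro!: ai)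
  qed
  ultimately show ?thesis by (auto simp: weak_deriv_def)
qed

lemma xt_measurable_translate:
  assumes "open J" and [measurable]: "u \<in> borel_measurable borel"
  shows "xt_measurable J (\<lambda>(t, x). u (x - t))"
proof -
  have "(\<lambda>(t, x). u (x - t)) \<in> borel_measurable (borel :: (real \<times> real) measure)"
    unfolding borel_prod[symmetric] by measurable
  then have "(\<lambda>(t, x). u (x - t)) \<in> borel_measurable (lebesgue :: (real \<times> real) measure)"
    by (rule borel_measurable_subalgebra[rotated 2]) (auto )
  then show ?thesis
    unfolding xt_measurable_def by (rule measurable_restrict_space1)
qed

lemma weak_dx_translate:
  assumes "open J" "pw_primitive U V"
  shows "weak_dx J (\<lambda>(t, x). U (x - t)) (\<lambda>(t, x). V (x - t))"
  using assms weak_deriv_translate[OF assms(2)] xt_measurable_translate[of J V]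
  by (auto simp: weak_dx_def pw_primitive_def)

text \<open>For \<open>t\<close> in the bounded set \<open>J\<close> and \<open>x\<close> in
  \<open>{-R..R}\<close> the argument \<open>x - t\<close> stays in a fixed compact interval, on
  which \<open>U\<close> and \<open>V\<close> are bounded; a bounded integrand on a set of finite
  measure suffices.\<close>

lemma L2_W12loc_translate:
  assumes "open J" "bounded J" and UV: "pw_primitive U V"
  shows "(\<lambda>(t, x). U (x - t)) \<in> L2_W12loc J"
proof -
  have U: "continuous_on UNIV U" and bd: "\<And>R. \<exists>C. \<forall>x. \<bar>x\<bar> \<le> R \<longrightarrow> \<bar>V x\<bar> \<le> C"
    using UV by (auto simp: pw_primitive_def)
  obtain b where b: "\<And>t. t \<in> J \<Longrightarrow> \<bar>t\<bar> \<le> b" using assms(2) by (auto simp: bounded_iff)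
  have fin: "emeasure lebesgue J < \<infinity>"
    using fmeasurableD2[OF lmeasurable_open[OF assms(2,1)]] by (simp add: less_top)
  have Jm: "J \<in> sets lebesgue" using assms(1) by simp
  have "(\<integral>\<^sup>+t. (\<integral>\<^sup>+x. ennreal ((U (x - t))\<^sup>2 + (V (x - t))\<^sup>2) \<partial>lebesgue_on {-R..R}) \<partial>lebesgue_on J) < \<infinity>" for R
  proof -
    obtain C where C: "\<And>x. \<bar>x\<bar> \<le> R + b \<Longrightarrow> \<bar>V x\<bar> \<le> C" using bd by blast
    obtain B where B: "\<And>x. x \<in> {-(R+b)..R+b} \<Longrightarrow> \<bar>U x\<bar> \<le> B"
      using continuous_on_compact_abs_bound[OF U compact_Icc] by blast
    have le: "(U (x - t))\<^sup>2 + (V (x - t))\<^sup>2 \<le> B\<^sup>2 + C\<^sup>2" if "t \<in> J" "x \<in> {-R..R}" for t x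
    proof -
      have "\<bar>x - t\<bar> \<le> R + b" "x - t \<in> {-(R+b)..R+b}" using that b[of t] by auto
      then have "\<bar>U (x - t)\<bar> \<le> \<bar>B\<bar>" "\<bar>V (x - t)\<bar> \<le> \<bar>C\<bar>"
        using B[of "x - t"] C[of "x - t"] by auto
      then show ?thesis by (intro add_mono) (auto simp: abs_le_square_iff[symmetric])
    qed
    have "(\<integral>\<^sup>+t. (\<integral>\<^sup>+x. ennreal ((U (x - t))\<^sup>2 + (V (x - t))\<^sup>2) \<partial>lebesgue_on {-R..R}) \<partial>lebesgue_on J)
      \<le> (\<integral>\<^sup>+t. (\<integral>\<^sup>+x. ennreal (B\<^sup>2 + C\<^sup>2) \<partial>lebesgue_on {-R..R}) \<partial>lebesgue_on J)"
      using le by (intro nn_integral_mono) (auto simp: space_restrict_space simp del: ennreal_plus intro!: ennreal_leI)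
    also have "\<dots> = ennreal (B\<^sup>2 + C\<^sup>2) * emeasure lebesgue {-R..R} * emeasure lebesgue J"
      using Jm by (simp add: space_restrict_space emeasure_restrict_space del: emeasure_completion)
    also have "\<dots> < \<infinity>" using fin fmeasurableD2[OF lmeasurable_compact[OF compact_Icc, of "-R" R]]
      by (auto simp: ennreal_mult_less_top less_top simp del: emeasure_completion)
    finally show ?thesis .
  qed
  moreover have "xt_measurable J (\<lambda>(t, x). U (x - t))"
    using assms U by (intro xt_measurable_translate borel_measurable_continuous_onI)
  ultimately show ?thesis
    using weak_dx_translate[OF assms(1) UV]
    by (auto simp: L2_W12loc_def intro!: exI[of _ "\<lambda>(t, x). V (x - t)"])
qed

text \<open>\<open>Ck\<close> speaks of partial derivatives only. Joint differentiability, needed to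
  differentiate along the oblique lines \<open>x - t = y\<close>, follows from the continuity of one
  partial derivative.\<close>

lemma test_functions_has_derivative:
  fixes \<phi> :: "real \<times> real \<Rightarrow> real"
  assumes "\<phi> \<in> test_functions U"
  shows "(\<phi> has_derivative (\<lambda>(s, r). s * partial_deriv (1, 0) \<phi> (x, y) + r * partial_deriv (0, 1) \<phi> (x, y)))
    (at (x, y))"
proof -
  have 1: "(1, 0) \<in> (Basis :: (real \<times> real) set)" "(0, 1) \<in> (Basis :: (real \<times> real) set)"
    by (auto simp: Basis_prod_def)
  have "((\<lambda>(x, y). \<phi> (x, y)) has_derivative 
      (\<lambda>(s, r). s * partial_deriv (1, 0) \<phi> (x, y) + blinfun_apply (blinfun_mult_left (partial_deriv (0, 1) \<phi> (x, y))) r))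
    (at (x, y) within UNIV \<times> UNIV)"
  proof (rule has_derivative_partialsI)
    have "((\<lambda>s. \<phi> ((0, y) + s *\<^sub>R (1, 0))) has_real_derivative partial_deriv (1, 0) \<phi> ((0, y) + x *\<^sub>R (1, 0))) (at x)"
      by (rule test_functions_partial'[OF assms 1(1)])
    then show "((\<lambda>x. \<phi> (x, y)) has_derivative (\<lambda>s. s * partial_deriv (1, 0) \<phi> (x, y))) (at x within UNIV)"
      by (simp add: has_field_derivative_def mult_commute_abs)
  next
    fix x y :: real
    have "((\<lambda>s. \<phi> ((x, 0) + s *\<^sub>R (0, 1))) has_real_derivative partial_deriv (0, 1) \<phi> ((x, 0) + y *\<^sub>R (0, 1))) (at y)"
      by (rule test_functions_partial'[OF assms 1(2)])
    then show "((\<lambda>y. \<phi> (x, y)) has_derivative blinfun_apply (blinfun_mult_left (partial_deriv (0, 1) \<phi> (x, y)))) (at y within UNIV)"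
      by (simp add: has_field_derivative_def blinfun_mult_left.rep_eq mult_commute_abs)
  next
    have "continuous_on UNIV (\<lambda>p. blinfun_mult_left (partial_deriv (0, 1) \<phi> p))"
      using test_functions_partial(1)[OF assms 1(2)]
      by (intro bounded_linear.continuous_on[OF bounded_linear_blinfun_mult_left])
    then show "continuous (at (x, y) within UNIV \<times> UNIV) (\<lambda>(x, y). blinfun_mult_left (partial_deriv (0, 1) \<phi> (x, y)))"
      by (simp add: continuous_on_eq_continuous_at case_prod_unfold)
  qed auto
  then show ?thesis
    by (simp add: blinfun_mult_left.rep_eq case_prod_unfold mult.commute)
qed

text \<open>In the coordinates \<open>(t, y)\<close> with \<open>y = x - t\<close> the sum of the
  two partial derivatives is the \<open>t\<close>-derivative of \<open>\<phi> (t, t + y)\<close>,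
  while \<open>A y\<close> is constant in \<open>t\<close>. Each line contributes zero, so
  \<open>A\<close> may be any bounded measurable function, in particular one with a jump.\<close>

lemma has_bochner_integral_test_function_derivs:
  fixes \<phi> :: "real \<times> real \<Rightarrow> real"
  assumes \<phi>: "\<phi> \<in> test_functions U"
    and [measurable]: "A \<in> borel_measurable borel" and A: "\<And>x. \<bar>A x\<bar> \<le> C"
  shows "has_bochner_integral lborel
    (\<lambda>p. A (snd p - fst p) * (partial_deriv (1, 0) \<phi> p + partial_deriv (0, 1) \<phi> p)) 0" (is ?transport)
    and "has_bochner_integral lborel (partial_deriv (0, 1) \<phi>) 0" (is ?dx)
proof -
  have basis: "(1, 0) \<in> (Basis :: (real \<times> real) set)" "(0, 1) \<in> (Basis :: (real \<times> real) set)"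
    by (auto simp: Basis_prod_def)
  define \<phi>\<^sub>x where "\<phi>\<^sub>x = partial_deriv (0, 1) \<phi>"
  define \<psi> where "\<psi> = (\<lambda>p. partial_deriv (1, 0) \<phi> p + \<phi>\<^sub>x p)"
  have c\<phi>x: "continuous_on UNIV \<phi>\<^sub>x"
    unfolding \<phi>\<^sub>x_def by (rule test_functions_partial(1)[OF \<phi> basis(2)])
  then have c\<psi>: "continuous_on UNIV \<psi>"
    unfolding \<psi>_def by (intro continuous_intros test_functions_partial(1)[OF \<phi> basis(1)])
  have [measurable]: "\<phi>\<^sub>x \<in> borel_measurable borel" "\<psi> \<in> borel_measurable borel"
    using c\<phi>x c\<psi> by (auto intro: borel_measurable_continuous_onI)
  obtain S where S: "compact S" "\<And>x. x \<notin> S \<Longrightarrow> \<phi> x = 0" "\<And>x b. x \<notin> S \<Longrightarrow> partial_deriv b \<phi> x = 0"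
    using test_functions_support[OF \<phi>] by metis
  obtain R where R': "\<And>p. p \<in> S \<Longrightarrow> norm p \<le> R"
    using compact_imp_bounded[OF S(1)] by (auto simp: bounded_iff)
  have R: "\<bar>t\<bar> \<le> R" "\<bar>x\<bar> \<le> R" if "(t, x) \<in> S" for t x
    using order_trans[OF norm_fst_le R'[OF that]] order_trans[OF norm_snd_le R'[OF that]] by auto
  obtain M where M: "\<And>p. p \<in> S \<Longrightarrow> \<bar>\<psi> p\<bar> \<le> M"
    using continuous_on_compact_abs_bound[OF c\<psi> S(1)] by blast
  obtain M' where M': "\<And>p. p \<in> S \<Longrightarrow> \<bar>\<phi>\<^sub>x p\<bar> \<le> M'"
    using continuous_on_compact_abs_bound[OF c\<phi>x S(1)] by blast
  have z: "\<psi> p = 0" "\<phi>\<^sub>x p = 0" if "p \<notin> S" for p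
    using that S(3) by (auto simp: \<psi>_def \<phi>\<^sub>x_def)
  have Mz: "\<bar>\<psi> p\<bar> \<le> max 0 M" "\<bar>\<phi>\<^sub>x p\<bar> \<le> max 0 M'" for p
    using M[of p] M'[of p] z[of p] by (cases "p \<in> S"; auto)+
  have C: "0 \<le> C" using A[of 0] by linarith
  have bd: "\<bar>A x * \<psi> p\<bar> \<le> C * max 0 M" for x p
    unfolding abs_mult using A Mz C by (intro mult_mono) auto

  have chain: "((\<lambda>t. \<phi> (t, t + y)) has_real_derivative \<psi> (t, t + y)) (at t)" for t y
  proof -
    have "((\<lambda>t. (t, t + y)) has_derivative (\<lambda>s. (s, s))) (at t)"
      by (auto intro!: derivative_eq_intros)
    from has_derivative_compose[OF this test_functions_has_derivative[OF \<phi>, of t "t + y"]]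
    show ?thesis
      by (simp add: has_field_derivative_def \<psi>_def \<phi>\<^sub>x_def mult_commute_abs flip: distrib_left)
  qed
  have dx: "((\<lambda>x. \<phi> (t, x)) has_real_derivative \<phi>\<^sub>x (t, x)) (at x)" for t x
    using test_functions_partial'[OF \<phi> basis(2), of "(t, 0)" x] by (simp add: \<phi>\<^sub>x_def)

  have int_line: "has_bochner_integral lborel (\<lambda>t. \<psi> (t, t + y)) 0" for y
  proof (rule has_bochner_integral_deriv_compact_support[where f="\<lambda>t. \<phi> (t, t + y)" and X="{}" and R=R and C="max 0 M"])
    show "continuous_on UNIV (\<lambda>t. \<phi> (t, t + y))"
      by (intro continuous_at_imp_continuous_on ballI DERIV_isCont[OF chain])
    show "(\<lambda>t. \<psi> (t, t + y)) \<in> borel_measurable borel"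
      by (intro borel_measurable_continuous_onI continuous_on_compose2[OF c\<psi>] continuous_intros) auto
    show "\<phi> (x, x + y) = 0" "\<psi> (x, x + y) = 0" if "R < \<bar>x\<bar>" for x
      using that R(1)[of x "x + y"] S(2) z by fastforce+
  qed (use chain Mz in auto)
  have int_dx: "has_bochner_integral lborel (\<lambda>x. \<phi>\<^sub>x (t, x)) 0" for t
  proof (rule has_bochner_integral_deriv_compact_support[where f="\<lambda>x. \<phi> (t, x)" and X="{}" and R=R and C="max 0 M'"])
    show "continuous_on UNIV (\<lambda>x. \<phi> (t, x))"
      by (intro continuous_at_imp_continuous_on ballI DERIV_isCont[OF dx])
    show "(\<lambda>x. \<phi>\<^sub>x (t, x)) \<in> borel_measurable borel"
      by (intro borel_measurable_continuous_onI continuous_on_compose2[OF c\<phi>x] continuous_intros) auto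
    show "\<phi> (t, x) = 0" "\<phi>\<^sub>x (t, x) = 0" if "R < \<bar>x\<bar>" for x
      using that R(2)[of t x] S(2) z by fastforce+
  qed (use dx Mz in auto)

  define F where "F = (\<lambda>(t, x). A (x - t) * \<psi> (t, x))"
  \<comment> \<open>\<open>F'\<close> is \<open>F\<close> in the sheared coordinates. The shear is
    carried out as a translation by \<open>t\<close> in the inner integral, after which Fubini puts
    the \<open>t\<close>-integral inside.\<close>
  define F' where "F' = (\<lambda>(t, y). A y * \<psi> (t, t + y))"
  have Fm: "F \<in> borel_measurable borel" "F' \<in> borel_measurable borel"
    unfolding F_def F'_def borel_prod[symmetric] by measurable
  have iF: "integrable lborel F"
  proof (rule integrable_lborel_bounded_support[where S=S and C="C * max 0 M"])
    show "bounded S" using S(1) by (rule compact_imp_bounded)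
  qed (fact Fm, use bd z in \<open>auto simp: F_def split_beta\<close>)
  \<comment> \<open>The shear takes the support into this box since
    \<open>\<bar>y\<bar> \<le> \<bar>t\<bar> + \<bar>t + y\<bar>\<close>.\<close>
  have iF': "integrable lborel F'"
  proof (rule integrable_lborel_bounded_support[where S="{-R..R} \<times> {-2*R..2*R}" and C="C * max 0 M"])
    show "bounded ({-R..R} \<times> {-2*R..2*R})" by (intro bounded_Times bounded_closed_interval)
    show "F' p = 0" if "p \<notin> {-R..R} \<times> {-2*R..2*R}" for p
    proof -
      obtain t y where p: "p = (t, y)" by force
      have "(t, t + y) \<notin> S" using that R[of t "t + y"] unfolding p by auto
      then show ?thesis using z by (simp add: F'_def p)
    qed
  qed (fact Fm, use bd z in \<open>auto simp: F'_def split_beta\<close>)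
  have "integral\<^sup>L lborel F = (\<integral>t. \<integral>x. F (t, x) \<partial>lborel \<partial>lborel)"
    using iF by (simp add: lborel_prod[symmetric] lborel_pair.integral_fst')
  also have "\<dots> = (\<integral>t. \<integral>y. F' (t, y) \<partial>lborel \<partial>lborel)"
  proof (rule Bochner_Integration.integral_cong[OF refl])
    fix t show "(\<integral>x. F (t, x) \<partial>lborel) = (\<integral>y. F' (t, y) \<partial>lborel)"
      by (subst lborel_integral_real_affine[of 1 _ t]) (auto simp: F_def F'_def)
  qed
  also have "\<dots> = (\<integral>y. \<integral>t. F' (t, y) \<partial>lborel \<partial>lborel)"
    using iF' by (intro lborel_pair.Fubini_integral[symmetric]) (simp add: lborel_prod)
  also have "\<dots> = 0"
    using int_line by (simp add: F'_def has_bochner_integral_iff)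
  finally have "has_bochner_integral lborel F 0" using iF by (simp add: has_bochner_integral_iff)
  moreover have "F = (\<lambda>p. A (snd p - fst p) * (partial_deriv (1, 0) \<phi> p + partial_deriv (0, 1) \<phi> p))"
    by (auto simp: F_def \<psi>_def \<phi>\<^sub>x_def)
  ultimately show ?transport by simp

  have i: "integrable lborel \<phi>\<^sub>x"
  proof (rule integrable_lborel_bounded_support[where S=S and C="max 0 M'"])
    show "bounded S" using S(1) by (rule compact_imp_bounded)
  qed (use Mz z in auto)
  have "integral\<^sup>L lborel \<phi>\<^sub>x = (\<integral>t. \<integral>x. \<phi>\<^sub>x (t, x) \<partial>lborel \<partial>lborel)"
    using i by (simp add: lborel_prod[symmetric] lborel_pair.integral_fst')
  also have "\<dots> = 0" using int_dx by (simp add: has_bochner_integral_iff)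
  finally show ?dx using i by (simp add: has_bochner_integral_iff \<phi>\<^sub>x_def)
qed

text \<open>A wave of speed 1 with density \<open>A\<close> has flux \<open>A - c\<close> for a
  constant \<open>c\<close>. The part with \<open>A\<close> is transport along the wave, and the
  constant only meets the integral of an \<open>x\<close>-derivative. Mass conservation uses the
  height at plus infinity for \<open>c\<close>, surfactant conservation uses
  \<open>c = 0\<close>.\<close>

lemma weak_identity_translate:
  fixes \<phi> :: "real \<times> real \<Rightarrow> real"
  assumes J: "open J" and \<phi>: "\<phi> \<in> test_functions (J \<times> UNIV)"
    and A[measurable]: "A \<in> borel_measurable borel" and bd: "\<And>x. \<bar>A x\<bar> \<le> C"
    and f: "\<And>t x. f (t, x) = A (x - t) * partial_deriv (1, 0) \<phi> (t, x)
      + (A (x - t) - c) * partial_deriv (0, 1) \<phi> (t, x)"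
  shows "has_bochner_integral (lebesgue_on (J \<times> UNIV)) f 0"
proof -
  note * = has_bochner_integral_test_function_derivs[OF \<phi> A bd]
  have "f p = A (snd p - fst p) * (partial_deriv (1, 0) \<phi> p + partial_deriv (0, 1) \<phi> p)
      - c * partial_deriv (0, 1) \<phi> p" for p
    using f[of "fst p" "snd p"] by (simp add: algebra_simps)
  then have f': "f = (\<lambda>p. A (snd p - fst p) * (partial_deriv (1, 0) \<phi> p + partial_deriv (0, 1) \<phi> p)
      - c * partial_deriv (0, 1) \<phi> p)" ..
  have "has_bochner_integral lborel f (0 - c * 0)"
    unfolding f' by (intro has_bochner_integral_diff has_bochner_integral_mult_right *)
  then have 1: "has_bochner_integral lborel f 0" by simp
  then have fm: "f \<in> borel_measurable lborel"
    by (auto simp: has_bochner_integral_iff)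
  have "has_bochner_integral lebesgue f 0"
    using 1 fm by (auto simp: has_bochner_integral_iff integrable_completion integral_completion)
  moreover have "(\<lambda>p. indicator (J \<times> UNIV) p *\<^sub>R f p) = f"
  proof
    fix p
    show "indicator (J \<times> UNIV) p *\<^sub>R f p = f p"
    proof (cases "p \<in> J \<times> UNIV")
      case False
      obtain S where "S \<subseteq> J \<times> UNIV" "\<And>x b. x \<notin> S \<Longrightarrow> partial_deriv b \<phi> x = 0"
        using test_functions_support[OF \<phi>] by metis
      then have "partial_deriv b \<phi> p = 0" for b using False by blast
      then show ?thesis using f[of "fst p" "snd p"] by simp
    qed simp
  qed
  moreover have "J \<times> UNIV \<inter> space lebesgue \<in> sets (lebesgue :: (real \<times> real) measure)"
  proof -
    have "J \<times> UNIV \<in> sets (lborel :: (real \<times> real) measure)"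
      using borel_open[OF open_Times[OF J open_UNIV]] by simp
    from sets_completionI_sets[OF this] show ?thesis by simp
  qed
  ultimately show ?thesis by (simp only: has_bochner_integral_restrict_space)
qed

section \<open>From the first integrals to a weak solution\<close>

lemma pw_primitive_const: "pw_primitive (\<lambda>x. c) (\<lambda>x. 0)"
  unfolding pw_primitive_def by (intro conjI allI exI[of _ "0::real"]) simp_all

text \<open>Smoothness of \<open>F\<close> is asked only on the range of \<open>U\<close>; thus
  fractional powers are allowed as long as the height is positive.\<close>

lemma pw_primitive_compose:
  assumes UV: "pw_primitive U V"
    and F: "\<And>x. (F has_real_derivative F' (U x)) (at (U x))" and F': "continuous_on (range U) F'"
  shows "pw_primitive (\<lambda>x. F (U x)) (\<lambda>x. F' (U x) * V x)"
proof -
  have U: "continuous_on UNIV U" and [measurable]: "V \<in> borel_measurable borel"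
    and der: "\<And>x. x \<noteq> 0 \<Longrightarrow> (U has_real_derivative V x) (at x)"
    and bd: "\<And>R. \<exists>C. \<forall>x. \<bar>x\<bar> \<le> R \<longrightarrow> \<bar>V x\<bar> \<le> C"
    using UV by (auto simp: pw_primitive_def)
  have "continuous_on (range U) F"
    using F by (intro DERIV_continuous_on[where D=F']) (blast intro: has_field_derivative_at_within)
  then have cF: "continuous_on UNIV (\<lambda>x. F (U x))"
    using U by (rule continuous_on_compose2) auto
  have cF': "continuous_on UNIV (\<lambda>x. F' (U x))"
    using F' U by (rule continuous_on_compose2) auto
  then have [measurable]: "(\<lambda>x. F' (U x)) \<in> borel_measurable borel"
    by (rule borel_measurable_continuous_onI)
  have "\<exists>C. \<forall>x. \<bar>x\<bar> \<le> R \<longrightarrow> \<bar>F' (U x) * V x\<bar> \<le> C" for R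
  proof -
    obtain C where C: "\<And>x. \<bar>x\<bar> \<le> R \<Longrightarrow> \<bar>V x\<bar> \<le> C" using bd by blast
    obtain B where B: "\<And>x. x \<in> {-R..R} \<Longrightarrow> \<bar>F' (U x)\<bar> \<le> B"
      using continuous_on_compact_abs_bound[OF cF' compact_Icc] by blast
    have "\<bar>F' (U x) * V x\<bar> \<le> B * C" if "\<bar>x\<bar> \<le> R" for x
    proof -
      have "x \<in> {-R..R}" using that by auto
      then have "\<bar>F' (U x)\<bar> \<le> B" by (rule B)
      then show ?thesis unfolding abs_mult using C[OF that] by (intro mult_mono) auto
    qed
    then show ?thesis by blast
  qed
  moreover have "((\<lambda>x. F (U x)) has_real_derivative F' (U x) * V x) (at x)" if "x \<noteq> 0" for x
    by (rule DERIV_chain2[OF F der[OF that]])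
  ultimately show ?thesis using cF by (auto simp: pw_primitive_def)
qed

text \<open>\<open>mass\<close> and \<open>surf\<close> are the conservation laws integrated once in
  the moving coordinate. For \<open>G = 0\<close> the height need only be measurable and for
  \<open>D = 0\<close> so does the concentration, since the corresponding derivative is then
  multiplied by zero; this admits the jump of the height in the case without gravity and
  diffusion.\<close>

lemma traveling_wave_profileI:
  assumes Hm[measurable]: "H \<in> borel_measurable borel" and \<Gamma>m[measurable]: "\<Gamma> \<in> borel_measurable borel"
    and H: "\<And>x. 0 < H x" "\<And>x. H x \<le> B" and \<Gamma>: "\<And>x. 0 \<le> \<Gamma> x" "\<And>x. \<Gamma> x < 1"
    and S: "pw_primitive (\<lambda>x. \<sigma> (\<Gamma> x)) W"
    and H': "G \<noteq> 0 \<Longrightarrow> pw_primitive H H'" and \<Gamma>': "D \<noteq> 0 \<Longrightarrow> pw_primitive \<Gamma> \<Gamma>'"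
    and mass: "\<And>x. (H x)\<^sup>2 / 2 * W x - G / 3 * H x ^ 3 * H' x = H x - c"
    and surf: "\<And>x. H x * \<Gamma> x * W x - D * \<Gamma>' x - G / 2 * \<Gamma> x * (H x)\<^sup>2 * H' x = \<Gamma> x"
  shows "traveling_wave_profile G D \<sigma> 1 H \<Gamma>"
proof -
  let ?h = "\<lambda>(t, x). H (x - t)" and ?\<gamma> = "\<lambda>(t, x). \<Gamma> (x - t)"
  have sol: "weak_solution_bounded G D \<sigma> J ?h ?\<gamma>" if J: "open J" "bounded J" for J
  proof -
    have xtH: "xt_measurable J ?h" and xt\<Gamma>: "xt_measurable J ?\<gamma>"
      using J by (auto intro!: xt_measurable_translate)
    have 1: "?h \<in> Linf_L2loc J"
    proof -
      have "(\<integral>\<^sup>+x. ennreal ((H (x - t))\<^sup>2) \<partial>lebesgue_on {-R..R}) \<le> ennreal (B\<^sup>2 * (2 * R))" if "R > 0" for R t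
      proof -
        have "(\<integral>\<^sup>+x. ennreal ((H (x - t))\<^sup>2) \<partial>lebesgue_on {-R..R}) \<le> (\<integral>\<^sup>+x. ennreal (B\<^sup>2) \<partial>lebesgue_on {-R..R})"
          using H by (intro nn_integral_mono ennreal_leI power_mono) (auto simp: less_imp_le)
        also have "\<dots> = ennreal (B\<^sup>2 * (2 * R))"
          using that by (simp add: space_restrict_space emeasure_restrict_space ennreal_mult)
        finally show ?thesis .
      qed
      then show ?thesis using xtH by (auto simp: Linf_L2loc_def)
    qed
    have 2: "?h \<in> L2_Linfloc J"
    proof -
      have "(\<integral>\<^sup>+t. (esssup (lebesgue_on {-R..R}) (\<lambda>x. ennreal \<bar>H (x - t)\<bar>))\<^sup>2 \<partial>lebesgue_on J) < \<infinity>" for R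
      proof -
        have "esssup (lebesgue_on {-R..R}) (\<lambda>x. ennreal \<bar>H (x - t)\<bar>) \<le> ennreal B" for t
        proof (rule esssup_I)
          have "(\<lambda>x. ennreal \<bar>H (x - t)\<bar>) \<in> borel_measurable lebesgue"
            by (rule measurable_completion) measurable
          then show "(\<lambda>x. ennreal \<bar>H (x - t)\<bar>) \<in> borel_measurable (lebesgue_on {-R..R})"
            by (rule measurable_restrict_space1)
          show "AE x in lebesgue_on {-R..R}. ennreal \<bar>H (x - t)\<bar> \<le> ennreal B"
            using H by (intro AE_I2 ennreal_leI) (auto simp: abs_of_pos)
        qed
        then have "(\<integral>\<^sup>+t. (esssup (lebesgue_on {-R..R}) (\<lambda>x. ennreal \<bar>H (x - t)\<bar>))\<^sup>2 \<partial>lebesgue_on J)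
            \<le> (\<integral>\<^sup>+t. (ennreal B)\<^sup>2 \<partial>lebesgue_on J)"
          by (intro nn_integral_mono power_mono) auto
        also have "\<dots> = (ennreal B)\<^sup>2 * emeasure lebesgue J"
          using J by (simp add: space_restrict_space emeasure_restrict_space del: emeasure_completion)
        also have "\<dots> < \<infinity>" using fmeasurableD2[OF lmeasurable_open[OF J(2,1)]]
          by (auto simp: ennreal_mult_less_top less_top power2_eq_square simp del: emeasure_completion)
        finally show ?thesis .
      qed
      then show ?thesis using xtH by (auto simp: L2_Linfloc_def)
    qed
    have 3: "(\<lambda>p. G * ?h p powr (5/2)) \<in> L2_W12loc J"
    proof -
      \<comment> \<open>For \<open>G = 0\<close> the function is constantly zero even if
        \<open>H\<close> jumps, so its regularity must not be derived from that of
        \<open>H\<close>.\<close>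
      have "\<exists>V. pw_primitive (\<lambda>x. G * H x powr (5/2)) V"
      proof (cases "G = 0")
        case True then show ?thesis using pw_primitive_const[of 0] by auto
      next
        case False
        have "pw_primitive (\<lambda>x. G * H x powr (5/2)) (\<lambda>x. (G * (5/2 * H x powr (3/2))) * H' x)"
          using H(1)
          by (intro pw_primitive_compose[OF H'[OF False], where F="\<lambda>y. G * y powr (5/2)" and F'="\<lambda>y. G * (5/2 * y powr (3/2))"])
            (auto intro!: derivative_eq_intros continuous_intros simp: less_imp_neq[symmetric])
        then show ?thesis by blast
      qed
      then obtain V where "pw_primitive (\<lambda>x. G * H x powr (5/2)) V" ..
      from L2_W12loc_translate[OF J this] show ?thesis by (simp add: case_prod_unfold)
    qed
    have 4: "?\<gamma> \<in> Linf J"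
      using xt\<Gamma> \<Gamma> by (auto simp: Linf_def abs_of_nonneg less_imp_le intro!: exI[of _ 1])
    have 5: "(\<lambda>p. D * ?\<gamma> p) \<in> L2_W12loc J"
    proof -
      have "\<exists>V. pw_primitive (\<lambda>x. D * \<Gamma> x) V"
      proof (cases "D = 0")
        case True then show ?thesis using pw_primitive_const[of 0] by auto
      next
        case False
        have "pw_primitive (\<lambda>x. D * \<Gamma> x) (\<lambda>x. D * \<Gamma>' x)"
          by (intro pw_primitive_compose[OF \<Gamma>'[OF False], where F="\<lambda>y. D * y" and F'="\<lambda>y. D"])
            (auto intro!: derivative_eq_intros continuous_intros)
        then show ?thesis by blast
      qed
      then obtain V where "pw_primitive (\<lambda>x. D * \<Gamma> x) V" ..
      from L2_W12loc_translate[OF J this] show ?thesis by (simp add: case_prod_unfold)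
    qed
    have 6: "(\<lambda>p. \<sigma> (?\<gamma> p)) \<in> L2_W12loc J"
      using L2_W12loc_translate[OF J S] by (simp add: case_prod_unfold)
    \<comment> \<open>The factors 4 and 3 of the chain rule turn the coefficients
      \<open>G / 12\<close> and \<open>G / 6\<close> of the weak formulation into the
      \<open>G / 3\<close> and \<open>G / 2\<close> of \<open>mass\<close> and
      \<open>surf\<close>.\<close>
    let ?s = "\<lambda>(t, x). W (x - t)" and ?g = "\<lambda>(t, x). \<Gamma>' (x - t)"
      and ?h4 = "\<lambda>(t, x). 4 * H (x - t) ^ 3 * H' (x - t)" and ?h3 = "\<lambda>(t, x). 3 * (H (x - t))\<^sup>2 * H' (x - t)"
    have 7: "weak_dx J (\<lambda>p. \<sigma> (?\<gamma> p)) ?s"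
      using weak_dx_translate[OF J(1) S] by (simp add: case_prod_unfold)
    have 8: "weak_dx J (\<lambda>p. ?h p ^ 4) ?h4" "weak_dx J (\<lambda>p. ?h p ^ 3) ?h3" if "G \<noteq> 0"
    proof -
      have "pw_primitive (\<lambda>x. H x ^ 4) (\<lambda>x. (4 * H x ^ 3) * H' x)"
        by (intro pw_primitive_compose[OF H'[OF that], where F="\<lambda>y. y ^ 4" and F'="\<lambda>y. 4 * y ^ 3"])
            (auto intro!: derivative_eq_intros continuous_intros)
      from weak_dx_translate[OF J(1) this] show "weak_dx J (\<lambda>p. ?h p ^ 4) ?h4"
        by (simp add: case_prod_unfold)
      have "pw_primitive (\<lambda>x. H x ^ 3) (\<lambda>x. (3 * (H x)\<^sup>2) * H' x)"
        by (intro pw_primitive_compose[OF H'[OF that], where F="\<lambda>y. y ^ 3" and F'="\<lambda>y. 3 * y\<^sup>2"])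
            (auto intro!: derivative_eq_intros continuous_intros)
      from weak_dx_translate[OF J(1) this] show "weak_dx J (\<lambda>p. ?h p ^ 3) ?h3"
        by (simp add: case_prod_unfold)
    qed
    have 9: "weak_dx J ?\<gamma> ?g" if "D \<noteq> 0"
      using weak_dx_translate[OF J(1) \<Gamma>'[OF that]] .
    have 10: "has_bochner_integral (lebesgue_on (J \<times> UNIV))
             (\<lambda>p. ?h p * partial_deriv (1, 0) \<phi> p
                + (?h p)\<^sup>2 / 2 * ?s p * partial_deriv (0, 1) \<phi> p
                - G / 12 * ?h4 p * partial_deriv (0, 1) \<phi> p) 0"
      if "\<phi> \<in> test_functions (J \<times> UNIV)" for \<phi>
    proof (rule weak_identity_translate[OF J(1) that Hm])
      show "\<bar>H x\<bar> \<le> B" for x using H by (simp add: abs_of_pos)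
      fix t x
      show "?h (t, x) * partial_deriv (1, 0) \<phi> (t, x)
                + (?h (t, x))\<^sup>2 / 2 * ?s (t, x) * partial_deriv (0, 1) \<phi> (t, x)
                - G / 12 * ?h4 (t, x) * partial_deriv (0, 1) \<phi> (t, x)
        = H (x - t) * partial_deriv (1, 0) \<phi> (t, x) + (H (x - t) - c) * partial_deriv (0, 1) \<phi> (t, x)"
        unfolding mass[symmetric] by (simp add: algebra_simps)
    qed
    have 11: "has_bochner_integral (lebesgue_on (J \<times> UNIV))
             (\<lambda>p. ?\<gamma> p * partial_deriv (1, 0) \<phi> p
                + ?h p * ?\<gamma> p * ?s p * partial_deriv (0, 1) \<phi> p
                - D * ?g p * partial_deriv (0, 1) \<phi> p
                - G / 6 * ?\<gamma> p * ?h3 p * partial_deriv (0, 1) \<phi> p) 0"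
      if "\<phi> \<in> test_functions (J \<times> UNIV)" for \<phi>
    proof (rule weak_identity_translate[OF J(1) that \<Gamma>m, where c=0])
      show "\<bar>\<Gamma> x\<bar> \<le> 1" for x using \<Gamma> by (simp add: abs_of_nonneg less_imp_le)
      fix t x
      have "?\<gamma> (t, x) * partial_deriv (1, 0) \<phi> (t, x)
                + ?h (t, x) * ?\<gamma> (t, x) * ?s (t, x) * partial_deriv (0, 1) \<phi> (t, x)
                - D * ?g (t, x) * partial_deriv (0, 1) \<phi> (t, x)
                - G / 6 * ?\<gamma> (t, x) * ?h3 (t, x) * partial_deriv (0, 1) \<phi> (t, x)
        = \<Gamma> (x - t) * partial_deriv (1, 0) \<phi> (t, x) + 
          (H (x - t) * \<Gamma> (x - t) * W (x - t) - D * \<Gamma>' (x - t) 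
           - G / 2 * \<Gamma> (x - t) * (H (x - t))\<^sup>2 * H' (x - t)) * partial_deriv (0, 1) \<phi> (t, x)"
        by (simp add: algebra_simps)
      then show "?\<gamma> (t, x) * partial_deriv (1, 0) \<phi> (t, x)
                + ?h (t, x) * ?\<gamma> (t, x) * ?s (t, x) * partial_deriv (0, 1) \<phi> (t, x)
                - D * ?g (t, x) * partial_deriv (0, 1) \<phi> (t, x)
                - G / 6 * ?\<gamma> (t, x) * ?h3 (t, x) * partial_deriv (0, 1) \<phi> (t, x)
        = \<Gamma> (x - t) * partial_deriv (1, 0) \<phi> (t, x) + (\<Gamma> (x - t) - 0) * partial_deriv (0, 1) \<phi> (t, x)"
        by (simp only: surf diff_zero)
    qed
    have 12: "AE p in lebesgue_on (J \<times> UNIV). 0 \<le> ?h p"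
      using H by (intro AE_I2) (auto simp: less_imp_le)
    have 13: "AE p in lebesgue_on (J \<times> UNIV). ?\<gamma> p \<in> {0..<1}"
      using \<Gamma> by (intro AE_I2) auto
    show ?thesis
      unfolding weak_solution_bounded_def
      by (intro conjI IntI 1 2 3 4 5 6 12 13 exI[of _ ?s] exI[of _ ?h4] exI[of _ ?h3] exI[of _ ?g]
          ballI impI 7 8 9 10 11)
  qed
  then show ?thesis
    by (auto simp: traveling_wave_profile_def weak_solution_def)
qed

section \<open>A bounded solution of a scalar equation on the line\<close>

lemma ode_between_constant_barriers:
  fixes P :: "real \<times> real \<Rightarrow> real" and lo hi k :: real
  assumes "lo \<le> hi" and k: "k > 0"
    and P: "continuous_on (UNIV \<times> {lo..hi}) P"
    and mono: "\<And>t y z. lo \<le> y \<Longrightarrow> y \<le> z \<Longrightarrow> z \<le> hi \<Longrightarrow> k * y - P (t, y) \<le> k * z - P (t, z)"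
    and P_lo: "\<And>t. P (t, lo) \<le> 0" and P_hi: "\<And>t. 0 \<le> P (t, hi)"
  obtains h where "\<And>t. lo \<le> h t" "\<And>t. h t \<le> hi"
    "\<And>t. (h has_real_derivative - P (t, h t)) (at t)"
proof -
  \<comment> \<open>Since \<open>h' + k h = k h - P\<close> has a right-hand side nondecreasing in \<open>h\<close>, its Duhamel operator
    \<open>T\<close> is monotone; \<open>h\<close> is the limit of the iterates of \<open>T\<close> that start at \<open>hi\<close>.\<close>
  define cl where "cl = (\<lambda>y. max lo (min hi y))"
  have cl: "cl y \<in> {lo..hi}" for y using \<open>lo \<le> hi\<close> by (auto simp: cl_def)
  define Q where "Q = (\<lambda>(t, y). cl y - P (t, cl y) / k)"
  have cQ: "continuous_on UNIV Q"
  proof -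
    have "continuous_on UNIV (\<lambda>p::real \<times> real. P (fst p, cl (snd p)))"
      by (rule continuous_on_compose2[OF P]) (use cl in \<open>auto simp: cl_def intro!: continuous_intros\<close>)
    moreover have "continuous_on UNIV (\<lambda>p::real \<times> real. cl (snd p))"
      by (auto simp: cl_def intro!: continuous_intros)
    ultimately have "continuous_on UNIV (\<lambda>p. cl (snd p) - P (fst p, cl (snd p)) / k)"
      using k by (intro continuous_intros) auto
    then show ?thesis by (simp add: Q_def split_beta)
  qed
  then have Qm[measurable]: "Q \<in> borel_measurable (borel \<Otimes>\<^sub>M borel)"
    by (simp add: borel_prod borel_measurable_continuous_onI)
  have Q_mono: "Q (t, y) \<le> Q (t, z)" if "y \<le> z" for t y z
  proof -
    have "cl y \<le> cl z" using that by (auto simp: cl_def)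
    then have "k * cl y - P (t, cl y) \<le> k * cl z - P (t, cl z)" using cl[of y] cl[of z] by (intro mono) auto
    then have "(k * cl y - P (t, cl y)) / k \<le> (k * cl z - P (t, cl z)) / k"
      using k by (intro divide_right_mono) auto
    then show ?thesis using k by (simp add: Q_def diff_divide_distrib)
  qed
  have Q_hi: "Q (t, y) \<le> hi" for t y
  proof -
    have "Q (t, y) \<le> Q (t, max y hi)" by (rule Q_mono) auto
    also have "\<dots> \<le> hi" using P_hi[of t] k \<open>lo \<le> hi\<close> by (auto simp: Q_def cl_def max_def min_def)
    finally show ?thesis .
  qed
  have Q_lo: "lo \<le> Q (t, y)" for t y
  proof -
    have "cl (min y lo) = lo" using \<open>lo \<le> hi\<close> by (auto simp: cl_def)
    then have "lo \<le> Q (t, min y lo)" using P_lo[of t] k by (simp add: Q_def divide_nonpos_pos)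
    also have "\<dots> \<le> Q (t, y)" by (rule Q_mono) auto
    finally show ?thesis .
  qed

  \<comment> \<open>\<open>w\<close> is the exponential probability density. Substituting
    \<open>r = k * (t - s)\<close> in the Duhamel integral from minus infinity turns it into an
    average of \<open>Q\<close> with weight \<open>w\<close>, so \<open>T\<close> inherits the
    bounds of \<open>Q\<close>.\<close>
  define w where "w = (\<lambda>r::real. exp (- r) * indicator {0..} r)"
  have w: "has_bochner_integral lborel w 1"
    using has_bochner_integral_I0i_power_exp_m'[of 0] by (simp add: w_def)
  have w0: "0 \<le> w r" for r by (simp add: w_def)
  have wm[measurable]: "w \<in> borel_measurable borel" by (simp add: w_def)
  define b where "b = max \<bar>lo\<bar> \<bar>hi\<bar>"
  have wQ_le: "norm (w r * Q p) \<le> w r * b" for r p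
    unfolding norm_mult using w0[of r] Q_lo[of "fst p" "snd p"] Q_hi[of "fst p" "snd p"]
    by (intro mult_mono) (auto simp: b_def)
  have wb: "integrable lborel (\<lambda>r. w r * b)" using w by (auto simp: has_bochner_integral_iff)
  define T where "T = (\<lambda>h t. \<integral>r. w r * Q (t - r / k, h (t - r / k)) \<partial>lborel)"
  have int: "integrable lborel (\<lambda>r. w r * Q (t - r / k, h (t - r / k)))"
    if [measurable]: "h \<in> borel_measurable borel" for h t
    by (rule Bochner_Integration.integrable_bound[OF wb]) (use wQ_le w0 in \<open>auto simp: b_def\<close>)
  have T_const: "(\<integral>r. w r * c \<partial>lborel) = c" for c using w by (simp add: has_bochner_integral_iff)
  have T_lo: "lo \<le> T h t" and T_hi: "T h t \<le> hi" if h: "h \<in> borel_measurable borel" for h t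
  proof -
    have iw: "integrable lborel (\<lambda>r. w r * c)" for c using w by (auto simp: has_bochner_integral_iff)
    have "(\<integral>r. w r * lo \<partial>lborel) \<le> T h t"
      unfolding T_def using w0 Q_lo by (intro integral_mono int[OF h] iw mult_left_mono)
    then show "lo \<le> T h t" by (simp only: T_const)
    have "T h t \<le> (\<integral>r. w r * hi \<partial>lborel)"
      unfolding T_def using w0 Q_hi by (intro integral_mono int[OF h] iw mult_left_mono)
    then show "T h t \<le> hi" by (simp only: T_const)
  qed
  have T_meas: "T h \<in> borel_measurable borel" if [measurable]: "h \<in> borel_measurable borel" for h
    unfolding T_def by measurable
  have T_mono: "T g t \<le> T h t" 
    if "g \<in> borel_measurable borel" "h \<in> borel_measurable borel" "\<And>t. g t \<le> h t" for g h t
    unfolding T_def using that w0 by (intro integral_mono int mult_left_mono Q_mono) auto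

  define H where "H = (\<lambda>n. (T ^^ n) (\<lambda>_. hi))"
  have H_Suc: "H (Suc n) = T (H n)" for n by (simp add: H_def)
  have Hm: "H n \<in> borel_measurable borel" for n
    by (induction n) (auto simp: H_Suc T_meas, auto simp: H_def)
  have H_le: "H n t \<le> hi" for n t
    using T_hi[OF Hm] \<open>lo \<le> hi\<close> by (cases n) (auto simp: H_Suc, auto simp: H_def)
  have H_ge: "lo \<le> H n t" for n t
    using T_lo[OF Hm] \<open>lo \<le> hi\<close> by (cases n) (auto simp: H_Suc, auto simp: H_def)
  have H_dec: "H (Suc n) t \<le> H n t" for n t
  proof (induction n arbitrary: t)
    case 0 show ?case using H_le[of 1 t] by (simp add: H_def)
  next
    case (Suc n) then show ?case by (subst (1 2) H_Suc) (intro T_mono Hm)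
  qed
  have "\<exists>l. (\<lambda>n. H n t) \<longlonglongrightarrow> l" for t
    using decseq_convergent[of "\<lambda>n. H n t" lo] H_dec H_ge by (metis decseq_SucI)
  then obtain h where h: "\<And>t. (\<lambda>n. H n t) \<longlonglongrightarrow> h t" by metis
  have hm[measurable]: "h \<in> borel_measurable borel"
    by (rule borel_measurable_LIMSEQ_metric[OF Hm h])
  have h_lo: "lo \<le> h t" and h_hi: "h t \<le> hi" for t
    using LIMSEQ_le_const[OF h[of t]] LIMSEQ_le_const2[OF h[of t]] H_ge[of _ t] H_le[of _ t] by auto
  \<comment> \<open>Pointwise convergence of the iterates passes through \<open>Q\<close> by
    continuity and through the integral by dominated convergence, because \<open>Q\<close> is
    bounded.\<close>
  have fix_h: "h t = T h t" for t
  proof (rule LIMSEQ_unique)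
    show "(\<lambda>n. H (Suc n) t) \<longlonglongrightarrow> h t" using h[of t] by (rule LIMSEQ_Suc)
    show "(\<lambda>n. H (Suc n) t) \<longlonglongrightarrow> T h t"
      unfolding H_Suc T_def
    proof (rule integral_dominated_convergence[where w="\<lambda>r. w r * b"])
      show "AE r in lborel. (\<lambda>n. w r * Q (t - r / k, H n (t - r / k))) \<longlonglongrightarrow> w r * Q (t - r / k, h (t - r / k))"
      proof (intro AE_I2 tendsto_mult tendsto_const)
        fix r
        have "isCont Q (t - r / k, h (t - r / k))" using cQ by (simp add: continuous_on_eq_continuous_at)
        moreover have "(\<lambda>n. (t - r / k, H n (t - r / k))) \<longlonglongrightarrow> (t - r / k, h (t - r / k))"
          by (intro tendsto_Pair tendsto_const h)
        ultimately show "(\<lambda>n. Q (t - r / k, H n (t - r / k))) \<longlonglongrightarrow> Q (t - r / k, h (t - r / k))"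
          by (rule isCont_tendsto_compose)
      qed
      show "integrable lborel (\<lambda>r. w r * b)" by (rule wb)
    qed (use int[OF Hm] int[OF hm] wQ_le in auto)
  qed

  \<comment> \<open>The substitution is now undone, which gives
    \<open>h t = exp (- k * t) * \<Phi> t\<close> with \<open>\<Phi>\<close> the integral of
    \<open>E\<close> up to \<open>t\<close>. So far \<open>h\<close> is merely measurable, and
    regularity is gained in two rounds: integrability of \<open>E\<close> makes
    \<open>\<Phi>\<close> and \<open>h\<close> continuous, hence \<open>E\<close> continuous, hence
    \<open>\<Phi>\<close> differentiable.\<close>
  define E where "E = (\<lambda>s. k * exp (k * s) * Q (s, h s))"
  have [measurable]: "E \<in> borel_measurable borel" unfolding E_def by measurable
  define \<Phi> where "\<Phi> = (\<lambda>t. \<integral>s. indicator {..t} s * E s \<partial>lborel)"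
  have sub: "w ((t - s) * k) * Q (s, h s) = exp (- k * t) / k * (indicator {..t} s * E s)" for s t
  proof -
    have "(0 \<le> (t - s) * k) = (s \<le> t)" using k by (simp add: zero_le_mult_iff)
    moreover have "exp (- ((t - s) * k)) = exp (- k * t) * exp (k * s)"
      by (simp add: exp_add[symmetric] algebra_simps)
    ultimately show ?thesis using k by (simp add: w_def E_def indicator_def)
  qed
  have iE: "integrable lborel (\<lambda>s. indicator {..t} s * E s)" and hE: "h t = exp (- k * t) * \<Phi> t" for t
  proof -
    have "integrable lborel (\<lambda>s. w (t * k + - k * s) * Q (t - (t * k + - k * s) / k, h (t - (t * k + - k * s) / k)))"
      using lborel_integrable_real_affine[OF int[OF hm, of t], of "-k" "t * k"] k by simp
    then have "integrable lborel (\<lambda>s. w ((t - s) * k) * Q (s, h s))"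
      using k by (simp add: field_simps)
    then have "integrable lborel (\<lambda>s. exp (- k * t) / k * (indicator {..t} s * E s))"
      by (simp only: sub)
    then show "integrable lborel (\<lambda>s. indicator {..t} s * E s)"
      using k integrable_mult_left_iff[of lborel "exp (- k * t) / k" "\<lambda>s. indicator {..t} s * E s"] by simp
    have "h t = \<bar>-k\<bar> *\<^sub>R (\<integral>s. w (t * k + - k * s) * Q (t - (t * k + - k * s) / k, h (t - (t * k + - k * s) / k)) \<partial>lborel)"
      unfolding fix_h[of t] T_def using k by (intro lborel_integral_real_affine) auto
    also have "\<dots> = k * (\<integral>s. w ((t - s) * k) * Q (s, h s) \<partial>lborel)"
      using k by (simp add: field_simps)
    also have "\<dots> = k * (exp (- k * t) / k * \<Phi> t)"
      unfolding sub \<Phi>_def by simp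
    finally show "h t = exp (- k * t) * \<Phi> t" using k by simp
  qed
  have \<Phi>_diff: "\<Phi> t = \<Phi> u + (LBINT s:{u..t}. E s)" and E_int: "set_integrable lborel {u..t} E" if "u \<le> t" for u t
  proof -
    have iEt: "set_integrable lborel {..t} E" "set_integrable lborel {..u} E"
      using iE[of t] iE[of u] by (simp_all add: set_integrable_def)
    have *: "set_integrable lborel {u..t} E"
      by (rule set_integrable_subset[OF iEt(1)]) auto
    then show "set_integrable lborel {u..t} E" .
    have **: "set_integrable lborel {u<..t} E"
      by (rule set_integrable_subset[OF iEt(1)]) auto
    have "\<Phi> t = (LBINT s:{..u} \<union> {u<..t}. E s)"
      using that unfolding \<Phi>_def set_lebesgue_integral_def 
      by (intro Bochner_Integration.integral_cong) (auto simp: indicator_def)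
    also have "\<dots> = (LBINT s:{..u}. E s) + (LBINT s:{u<..t}. E s)"
      by (rule set_integral_Un[OF _ iEt(2) **]) auto
    also have "(LBINT s:{u<..t}. E s) = (LBINT s:{u..t}. E s)"
      unfolding set_lebesgue_integral_def using AE_lborel_singleton[of u]
      by (intro integral_cong_AE) (auto simp: indicator_def)
    finally show "\<Phi> t = \<Phi> u + (LBINT s:{u..t}. E s)" by (simp add: \<Phi>_def set_lebesgue_integral_def)
  qed
  have \<Phi>_HK: "\<Phi> t = \<Phi> u + integral {u..t} E" "E integrable_on {u..t}" if "u \<le> t" for u t
    using \<Phi>_diff[OF that] set_borel_integral_eq_integral[OF E_int[OF that]] by auto
  have c\<Phi>: "isCont \<Phi> t" for t
  proof -
    have "continuous_on {t-1..t+1} (\<lambda>x. \<Phi> (t-1) + integral {t-1..x} E)"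
      by (intro continuous_intros indefinite_integral_continuous_1 \<Phi>_HK) auto
    then have "continuous_on {t-1..t+1} \<Phi>"
      by (rule continuous_on_eq) (use \<Phi>_HK in auto)
    then show ?thesis by (rule continuous_on_interior) auto
  qed
  have "isCont h t" for t
    unfolding hE[abs_def] by (intro continuous_intros c\<Phi>)
  then have ch: "continuous_on UNIV h" by (simp add: continuous_on_eq_continuous_at)
  have cE: "continuous_on UNIV E"
    unfolding E_def by (intro continuous_intros continuous_on_compose2[OF cQ] ch) auto
  have d\<Phi>: "(\<Phi> has_real_derivative E t) (at t)" for t
  proof -
    have "((\<lambda>x. integral {t-1..x} E) has_real_derivative E t) (at t within {t-1..t+1})"
      by (rule integral_has_real_derivative) (use cE in \<open>auto elim: continuous_on_subset\<close>)
    then have "((\<lambda>x. \<Phi> (t-1) + integral {t-1..x} E) has_real_derivative 0 + E t) (at t within {t-1..t+1})"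
      by (intro DERIV_add DERIV_const)
    then have "((\<lambda>x. \<Phi> (t-1) + integral {t-1..x} E) has_real_derivative E t) (at t)"
      using at_within_Icc_at[of "t-1" t "t+1"] by simp
    moreover have "eventually (\<lambda>x. x \<in> {t-1<..}) (nhds t)" by (intro eventually_nhds_in_open) auto
    then have "eventually (\<lambda>x. \<Phi> (t-1) + integral {t-1..x} E = \<Phi> x) (nhds t)"
      by (rule eventually_mono) (auto intro!: \<Phi>_HK(1)[symmetric])
    ultimately show ?thesis by (simp cong: DERIV_cong_ev)
  qed
  have "(h has_real_derivative - P (t, h t)) (at t)" for t
  proof -
    have "((\<lambda>t. exp (- k * t) * \<Phi> t) has_real_derivative (- k * exp (- k * t)) * \<Phi> t + exp (- k * t) * E t) (at t)"
      by (auto intro!: derivative_eq_intros d\<Phi>)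
    moreover have "(- k * exp (- k * t)) * \<Phi> t + exp (- k * t) * E t = - P (t, h t)"
    proof -
      have "exp (- k * t) * E t = k * Q (t, h t)"
        unfolding E_def by (simp add: exp_minus field_simps)
      also have "cl (h t) = h t" using h_lo[of t] h_hi[of t] by (auto simp: cl_def)
      then have "k * Q (t, h t) = k * h t - P (t, h t)" using k by (simp add: Q_def field_simps)
      finally show ?thesis using hE[of t] by simp
    qed
    ultimately show ?thesis unfolding hE[symmetric] by simp
  qed
  with h_lo h_hi show ?thesis by (rule that)
qed

text \<open>Suppose \<open>f t \<le> b\<close>. Backwards in time \<open>f\<close> cannot climb
  above \<open>b\<close>, as it has positive slope wherever it is at most \<open>b\<close>; so it
  keeps falling at rate \<open>m\<close> or more and violates the lower bound
  \<open>lo\<close>.\<close>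

lemma eventually_gt_barrier_at_bot:
  fixes f f' :: "real \<Rightarrow> real"
  assumes der: "\<And>t. (f has_real_derivative f' t) (at t)" and lo: "\<And>t. lo \<le> f t" and m: "m > 0"
    and slope: "\<And>t. t \<le> T \<Longrightarrow> f t \<le> b \<Longrightarrow> m \<le> f' t"
    and "t \<le> T"
  shows "b < f t"
proof (rule ccontr)
  assume "\<not> b < f t"
  then have ft: "f t \<le> b" by simp
  \<comment> \<open>The minimum over \<open>{s..t}\<close> has a value at most \<open>b\<close>,
    hence positive slope there, hence smaller values to its left unless it sits at
    \<open>s\<close>.\<close>
  have below: "f s \<le> b" if "s < t" for s
  proof -
    have "continuous_on {s..t} f"
      by (intro continuous_at_imp_continuous_on ballI DERIV_isCont[OF der])
    then obtain u where u: "u \<in> {s..t}" "\<And>v. v \<in> {s..t} \<Longrightarrow> f u \<le> f v"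
      using continuous_attains_inf[of "{s..t}" f] less_imp_le[OF \<open>s < t\<close>] by auto
    have "f u \<le> b" using u(2)[of t] ft that by auto
    moreover have "u = s"
    proof (rule ccontr)
      assume "u \<noteq> s"
      then have us: "s < u" using u(1) by auto
      have "0 < f' u" using slope[of u] \<open>f u \<le> b\<close> u(1) \<open>t \<le> T\<close> m by auto
      from DERIV_pos_inc_left[OF der this] obtain d where d: "0 < d" "\<And>e. 0 < e \<Longrightarrow> e < d \<Longrightarrow> f (u - e) < f u"
        by blast
      define e where "e = min (d / 2) (u - s)"
      have "0 < e" "e < d" "u - e \<in> {s..t}" using d(1) us u(1) by (auto simp: e_def min_def)
      then show False using d(2)[of e] u(2)[of "u - e"] by auto
    qed
    ultimately show ?thesis by simp
  qed
  \<comment> \<open>Falling at rate \<open>m\<close> over this length brings \<open>f\<close> down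
    to \<open>lo - 1\<close> or less.\<close>
  define s where "s = t - (f t - lo + 1) / m"
  have st: "s < t" using lo[of t] m by (simp add: s_def)
  obtain z where z: "s < z" "z < t" "f t - f s = (t - s) * f' z"
    using MVT2[OF st, of f f'] der by blast
  have "m \<le> f' z" using slope[of z] below[OF z(2)] z(2) \<open>t \<le> T\<close> by auto
  then have "(t - s) * m \<le> f t - f s" unfolding z(3) using st by (intro mult_left_mono) auto
  then have "f t - lo + 1 \<le> f t - f s" using m by (simp add: s_def)
  then show False using lo[of s] by simp
qed

text \<open>Staying above \<open>b\<close> forever would push \<open>f\<close> below
  \<open>lo\<close>. Once below \<open>b\<close>, \<open>f\<close> cannot return: a maximum with
  value at least \<open>b\<close> would have negative slope and so larger values just before
  it.\<close>

lemma eventually_lt_barrier_at_top: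
  fixes f f' :: "real \<Rightarrow> real"
  assumes der: "\<And>t. (f has_real_derivative f' t) (at t)" and lo: "\<And>t. lo \<le> f t" and m: "m > 0"
    and slope: "\<And>t. T \<le> t \<Longrightarrow> b \<le> f t \<Longrightarrow> f' t \<le> - m"
  shows "eventually (\<lambda>t. f t < b) at_top"
proof -
  have "\<exists>s\<ge>T. f s < b"
  proof (rule ccontr)
    assume "\<not> (\<exists>s\<ge>T. f s < b)"
    then have above: "\<And>s. s \<ge> T \<Longrightarrow> b \<le> f s" by force
    define t where "t = T + (f T - lo + 1) / m"
    have Tt: "T < t" using lo[of T] m by (simp add: t_def)
    obtain z where z: "T < z" "z < t" "f t - f T = (t - T) * f' z"
      using MVT2[OF Tt, of f f'] der by blast
    have "f' z \<le> - m" using slope[of z] above[of z] z(1) by auto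
    then have "f t - f T \<le> (t - T) * (- m)" unfolding z(3) using Tt by (intro mult_left_mono) auto
    then have "f t - f T \<le> - (f T - lo + 1)" using m by (simp add: t_def)
    then show False using lo[of t] by simp
  qed
  then obtain s where s: "T \<le> s" "f s < b" by blast
  have "f t < b" if "s < t" for t
  proof -
    have "continuous_on {s..t} f"
      by (intro continuous_at_imp_continuous_on ballI DERIV_isCont[OF der])
    then obtain u where u: "u \<in> {s..t}" "\<And>v. v \<in> {s..t} \<Longrightarrow> f v \<le> f u"
      using continuous_attains_sup[of "{s..t}" f] less_imp_le[OF \<open>s < t\<close>] by auto
    have "f u < b"
    proof (rule ccontr)
      assume "\<not> f u < b"
      then have fu: "b \<le> f u" by simp
      then have us: "s < u" using u(1) s by (cases "u = s") auto
      have "f' u < 0" using slope[of u] fu u(1) s m by auto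
      from DERIV_neg_dec_left[OF der this] obtain d where d: "0 < d" "\<And>e. 0 < e \<Longrightarrow> e < d \<Longrightarrow> f u < f (u - e)"
        by blast
      define e where "e = min (d / 2) (u - s)"
      have "0 < e" "e < d" "u - e \<in> {s..t}" using d(1) us u(1) by (auto simp: e_def min_def)
      then show False using d(2)[of e] u(2)[of "u - e"] by auto
    qed
    then show ?thesis using u(2)[of t] that by auto
  qed
  then show ?thesis unfolding eventually_at_top_dense by blast
qed

section \<open>Inverses of strictly monotone functions\<close>

lemma unbounded_connected_real_UNIV:
  fixes T :: "real set"
  assumes "connected T" "\<And>y. \<exists>x\<in>T. x < y" "\<And>y. \<exists>x\<in>T. y < x"
  shows "T = UNIV"
proof -
  have "y \<in> T" for y
  proof -
    obtain a b where "a \<in> T" "a < y" "b \<in> T" "y < b" using assms by meson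
    then show ?thesis using connectedD_interval[OF assms(1), of a b y] by auto
  qed
  then show ?thesis by auto
qed

text \<open>Both signs of \<open>f'\<close> occur in the applications; the conditional in the last
  conclusion records the monotonicity for either sign.\<close>

lemma inverse_C1_diffeomorphism:
  fixes f f' :: "real \<Rightarrow> real"
  assumes S: "open S" "is_interval S" and T: "f ` S = T"
    and der: "\<And>x. x \<in> S \<Longrightarrow> (f has_real_derivative f' x) (at x)"
    and nz: "(\<forall>x\<in>S. f' x > 0) \<or> (\<forall>x\<in>S. f' x < 0)"
  obtains g where "\<And>t. t \<in> T \<Longrightarrow> g t \<in> S" "\<And>t. t \<in> T \<Longrightarrow> f (g t) = t" "\<And>x. x \<in> S \<Longrightarrow> g (f x) = x"
    "\<And>t. t \<in> T \<Longrightarrow> (g has_real_derivative inverse (f' (g t))) (at t)"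
    "\<And>x y. x \<in> S \<Longrightarrow> y \<in> S \<Longrightarrow> x < y \<Longrightarrow> if \<forall>x\<in>S. f' x > 0 then f x < f y else f y < f x"
proof -
  have mono: "if \<forall>x\<in>S. f' x > 0 then f x < f y else f y < f x" if xy: "x \<in> S" "y \<in> S" "x < y" for x y
  proof -
    have Sxy: "z \<in> S" if "x \<le> z" "z \<le> y" for z
      using S(2) xy that unfolding is_interval_1 by blast
    show ?thesis
    proof (cases "\<forall>x\<in>S. f' x > 0")
      case True
      have "f x < f y"
        by (rule DERIV_pos_imp_increasing[OF xy(3)]) (use True Sxy der in blast)
      then show ?thesis using True by simp
    next
      case False
      then have neg: "\<forall>x\<in>S. f' x < 0" using nz by blast
      have "f y < f x"
        by (rule DERIV_neg_imp_decreasing[OF xy(3)]) (use neg Sxy der in blast)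
      then show ?thesis using False by simp
    qed
  qed
  have inj: "inj_on f S"
  proof (rule linorder_inj_onI)
    fix x y assume "x < y" "x \<in> S" "y \<in> S"
    then show "f x \<noteq> f y" using mono[of x y] by (auto split: if_splits)
  qed auto
  define g where "g = the_inv_into S f"
  have gS: "g t \<in> S" "f (g t) = t" if "t \<in> T" for t
    using that inj T by (auto simp: g_def the_inv_into_into f_the_inv_into_f)
  have gf: "g (f x) = x" if "x \<in> S" for x
    using that inj by (simp add: g_def the_inv_into_f_f)
  have "(g has_real_derivative inverse (f' (g t))) (at t)" if "t \<in> T" for t
  proof -
    have "(g has_real_derivative inverse (f' (g t))) (at (f (g t)))"
      unfolding has_field_derivative_def
    proof (rule has_derivative_inverse_strong[where f=f and x="g t" and f'="(*) (f' (g t))"])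
      show "(f has_derivative (*) (f' (g t))) (at (g t))"
        using der gS[OF that] by (simp add: has_field_derivative_def)
      show "open S" by (rule S(1))
      show "continuous_on S f"
        by (intro continuous_at_imp_continuous_on ballI DERIV_isCont[OF der])
    qed (use gS[OF that] gf nz in \<open>auto simp: fun_eq_iff\<close>)
    then show ?thesis using gS(2)[OF that] by simp
  qed
  then show ?thesis using gS gf mono by (intro that[of g]) auto
qed

text \<open>This is the N left after eliminating the rate of tau; \<open>q\<close> and
  \<open>1 - q\<close> are the shares of surface tension and of diffusion in that rate. On
  \<open>{a..2*a}\<close> the first summand is nonpositive and the second nonnegative, with zeros at
  \<open>2 * a\<close> and \<open>a\<close> respectively when their weights are positive. This sign
  pattern supplies the barriers.\<close>

definition flux_balance :: "real \<Rightarrow> real \<Rightarrow> real \<Rightarrow> real" where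
  "flux_balance a q y = q * y * (y / 2 - a) + (1 - q) * (y - a)"

lemma C1_upper_Lipschitz:
  fixes f f' :: "real \<Rightarrow> real"
  assumes der: "\<And>y. y \<in> {a..b} \<Longrightarrow> (f has_real_derivative f' y) (at y)" and cont: "continuous_on {a..b} f'"
  obtains L where "L > 0" "\<And>y z. a \<le> y \<Longrightarrow> y \<le> z \<Longrightarrow> z \<le> b \<Longrightarrow> f z - f y \<le> L * (z - y)"
proof -
  have "bounded (f' ` {a..b})"
    using cont by (intro compact_imp_bounded compact_continuous_image) auto
  then obtain L where L: "L > 0" "\<And>y. y \<in> {a..b} \<Longrightarrow> \<bar>f' y\<bar> \<le> L"
    by (auto simp: bounded_pos)
  have "f z - f y \<le> L * (z - y)" if yz: "a \<le> y" "y \<le> z" "z \<le> b" for y z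
  proof (cases "y = z")
    case False
    then have "y < z" using yz by simp
    then obtain x where x: "y < x" "x < z" "f z - f y = (z - y) * f' x"
      using MVT2[of y z f f'] der yz by auto
    have "f' x \<le> L" using L(2)[of x] x yz by auto
    then have "(z - y) * f' x \<le> (z - y) * L" using yz by (intro mult_left_mono) auto
    then show ?thesis using x(3) by (simp add: mult.commute)
  qed auto
  with L(1) show ?thesis by (rule that)
qed

section \<open>The height as a function of tau\<close>

context
  fixes a :: real and q :: "real \<Rightarrow> real"
  assumes a: "a > 0" and cq: "continuous_on UNIV q" and q01: "\<And>t. 0 < q t" "\<And>t. q t < 1"
    and q_bot: "(q \<longlongrightarrow> 1) at_bot" and q_top: "(q \<longlongrightarrow> 0) at_top"
begin

text \<open>The right-hand side is a convex combination of two fixed functions of the height with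
  weights \<open>q t\<close> and \<open>1 - q t\<close>, so a single constant \<open>k\<close>
  serves for all \<open>t\<close>. Near either end one weight dominates and the slope stays away
  from zero until \<open>h\<close> is close to the zero of the corresponding summand, which gives
  the limits.\<close>

lemma height_profile_gravity:
  assumes G: "G > 0"
  obtains h where "\<And>t. a < h t" "\<And>t. h t < 2 * a"
    "\<And>t. (h has_real_derivative - 6 * flux_balance a (q t) (h t) / (G * (h t)\<^sup>2 * (3 * a - h t))) (at t)"
    "(h \<longlongrightarrow> 2 * a) at_bot" "(h \<longlongrightarrow> a) at_top"
proof -
  \<comment> \<open>\<open>p0\<close> and \<open>p1\<close> are the cases \<open>q = 0\<close> and
    \<open>q = 1\<close> of the balance over the common denominator, with one factor
    \<open>y\<close> cancelled in \<open>p1\<close>.\<close>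
  define p0 where "p0 = (\<lambda>y. (y - a) / (y\<^sup>2 * (3 * a - y)))"
  define p1 where "p1 = (\<lambda>y. (y / 2 - a) / (y * (3 * a - y)))"
  have nz: "y \<noteq> 0" "3 * a - y \<noteq> 0" "y\<^sup>2 * (3 * a - y) \<noteq> 0" "y * (3 * a - y) \<noteq> 0" if "y \<in> {a..2*a}" for y
    using that a by auto
  have d0: "(p0 has_real_derivative
      (1 * (y\<^sup>2 * (3 * a - y)) - (y - a) * (2 * y * (3 * a - y) - y\<^sup>2)) / (y\<^sup>2 * (3 * a - y) * (y\<^sup>2 * (3 * a - y)))) (at y)"
    if "y \<in> {a..2*a}" for y
    unfolding p0_def using nz[OF that] by (auto intro!: derivative_eq_intros simp: power2_eq_square)
  have d1: "(p1 has_real_derivative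
      (1 / 2 * (y * (3 * a - y)) - (y / 2 - a) * (3 * a - y - y)) / (y * (3 * a - y) * (y * (3 * a - y)))) (at y)"
    if "y \<in> {a..2*a}" for y
    unfolding p1_def using nz[OF that] by (auto intro!: derivative_eq_intros simp: power2_eq_square)
  obtain L0 where L0: "L0 > 0" "\<And>y z. a \<le> y \<Longrightarrow> y \<le> z \<Longrightarrow> z \<le> 2*a \<Longrightarrow> p0 z - p0 y \<le> L0 * (z - y)"
    by (rule C1_upper_Lipschitz[OF d0]) (use nz in \<open>auto intro!: continuous_intros\<close>)
  obtain L1 where L1: "L1 > 0" "\<And>y z. a \<le> y \<Longrightarrow> y \<le> z \<Longrightarrow> z \<le> 2*a \<Longrightarrow> p1 z - p1 y \<le> L1 * (z - y)"
    by (rule C1_upper_Lipschitz[OF d1]) (use nz in \<open>auto intro!: continuous_intros\<close>)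
  define P where "P = (\<lambda>(t, y). 6 * flux_balance a (q t) y / (G * y\<^sup>2 * (3 * a - y)))"
  have P_eq: "P (t, y) = 6 / G * (q t * p1 y + (1 - q t) * p0 y)" if "y \<in> {a..2*a}" for t y
    using nz[OF that] G
    by (simp add: P_def p0_def p1_def flux_balance_def divide_simps) (simp add: algebra_simps power2_eq_square)
  define k where "k = 6 / G * (L0 + L1)"
  have k: "k > 0" using L0 L1 G by (simp add: k_def)
  obtain h where h: "\<And>t. a \<le> h t" "\<And>t. h t \<le> 2 * a"
    and dh: "\<And>t. (h has_real_derivative - P (t, h t)) (at t)"
  proof (rule ode_between_constant_barriers[of a "2 * a" k P])
    show "a \<le> 2 * a" using a by simp
    show "continuous_on (UNIV \<times> {a..2 * a}) P"
      unfolding P_def split_beta flux_balance_def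
      using nz G by (intro continuous_intros continuous_on_compose2[OF cq]) auto
    show "k * y - P (t, y) \<le> k * z - P (t, z)" if "a \<le> y" "y \<le> z" "z \<le> 2 * a" for t y z
    proof -
      have "q t * (p1 z - p1 y) \<le> 1 * (L1 * (z - y))"
        using L1(2)[OF that] q01[of t] L1(1) that
        by (intro order_trans[OF mult_left_mono mult_right_mono]) auto
      moreover have "(1 - q t) * (p0 z - p0 y) \<le> 1 * (L0 * (z - y))"
        using L0(2)[OF that] q01[of t] L0(1) that
        by (intro order_trans[OF mult_left_mono mult_right_mono]) auto
      ultimately have "q t * (p1 z - p1 y) + (1 - q t) * (p0 z - p0 y) \<le> (L0 + L1) * (z - y)"
        by (simp add: algebra_simps)
      then have "6 / G * (q t * (p1 z - p1 y) + (1 - q t) * (p0 z - p0 y)) \<le> 6 / G * ((L0 + L1) * (z - y))"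
        using G by (intro mult_left_mono) auto
      moreover have "6 / G * (q t * (p1 z - p1 y) + (1 - q t) * (p0 z - p0 y)) = P (t, z) - P (t, y)"
        using that by (simp add: P_eq algebra_simps)
      moreover have "6 / G * ((L0 + L1) * (z - y)) = k * (z - y)" by (simp add: k_def)
      ultimately have "P (t, z) - P (t, y) \<le> k * (z - y)" by (simp only:)
      then show ?thesis by (simp add: algebra_simps)
    qed
    show "P (t, a) \<le> 0" "0 \<le> P (t, 2 * a)" for t
      using q01[of t] a G by (auto simp: P_def flux_balance_def divide_nonpos_pos mult_le_0_iff)
  qed (use k in auto)
  \<comment> \<open>Touching a barrier is an extremum of \<open>h\<close> and forces zero slope, but
    \<open>0 < q t < 1\<close> makes \<open>P\<close> nonzero on both barriers.\<close>
  have strict: "a < h t" "h t < 2 * a" for t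
  proof -
    have "P (t, a) < 0" "0 < P (t, 2 * a)"
      using q01[of t] a G by (auto simp: P_def flux_balance_def mult_less_0_iff divide_less_0_iff)
    moreover have "P (t, a) = 0" if "h t = a"
      using DERIV_local_min[OF dh[of t], of 1] h(1) that by simp
    moreover have "P (t, 2 * a) = 0" if "h t = 2 * a"
      using DERIV_local_max[OF dh[of t], of 1] h(2) that by simp
    ultimately show "a < h t" "h t < 2 * a" using h[of t] by (metis less_le less_irrefl)+
  qed
  have den: "0 < G * y\<^sup>2 * (3 * a - y)" "G * y\<^sup>2 * (3 * a - y) \<le> G * (2 * a)\<^sup>2 * (2 * a)"
    if "y \<in> {a..2*a}" for y
  proof -
    show "0 < G * y\<^sup>2 * (3 * a - y)" using that a G by (intro mult_pos_pos) auto
    have "y\<^sup>2 \<le> (2 * a)\<^sup>2" using that a by (intro power_mono) auto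
    moreover have "3 * a - y \<le> 2 * a" "0 \<le> 3 * a - y" using that a by auto
    ultimately show "G * y\<^sup>2 * (3 * a - y) \<le> G * (2 * a)\<^sup>2 * (2 * a)"
      using G by (intro mult_mono[OF mult_left_mono]) auto
  qed
  \<comment> \<open>\<open>M\<close> bounds the denominator on \<open>{a..2*a}\<close>, so that
    lower bounds on the balance become lower bounds on the slope.\<close>
  define M where "M = G * (2 * a)\<^sup>2 * (2 * a)"
  have M: "M > 0" using a G by (simp add: M_def)
  have bot: "eventually (\<lambda>t. b < h t) at_bot" if "b < 2 * a" for b
  proof -
    define b' where "b' = max a b"
    have b': "a \<le> b'" "b' < 2 * a" "b \<le> b'" using that a by (auto simp: b'_def)
    \<comment> \<open>While \<open>h t \<le> b'\<close>, the negative of the balance is at least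
      \<open>q t * a * (2 * a - b') / 2 - (1 - q t) * a\<close>; \<open>\<mu>\<close> is half of the
      limit of this bound as \<open>q\<close> tends to 1.\<close>
    define \<mu> where "\<mu> = a * (2 * a - b') / 4"
    have \<mu>: "\<mu> > 0" using b' a by (simp add: \<mu>_def)
    have "((\<lambda>t. q t * a * (2 * a - b') / 2 - (1 - q t) * a) \<longlongrightarrow> 1 * a * (2 * a - b') / 2 - (1 - 1) * a) at_bot"
      by (intro tendsto_intros q_bot) auto
    then have "eventually (\<lambda>t. \<mu> < q t * a * (2 * a - b') / 2 - (1 - q t) * a) at_bot"
      by (rule order_tendstoD) (use \<mu> in \<open>simp add: \<mu>_def\<close>)
    then obtain T where T: "\<And>t. t \<le> T \<Longrightarrow> \<mu> < q t * a * (2 * a - b') / 2 - (1 - q t) * a"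
      by (auto simp: eventually_at_bot_linorder)
    have "b' < h t" if "t \<le> T" for t
    proof (rule eventually_gt_barrier_at_bot[OF dh h(1) _ _ that])
      show "6 * \<mu> / M > 0" using \<mu> M by simp
      show "6 * \<mu> / M \<le> - P (t, h t)" if t: "t \<le> T" "h t \<le> b'" for t
      proof -
        have y: "h t \<in> {a..2*a}" using h by auto
        have "q t * (a * ((2 * a - b') / 2)) \<le> q t * (h t * (a - h t / 2))"
          using q01[of t] h[of t] t b' a by (intro mult_left_mono mult_mono) auto
        moreover have "(1 - q t) * (h t - a) \<le> (1 - q t) * a"
          using q01[of t] h[of t] by (intro mult_left_mono) auto
        ultimately have "\<mu> \<le> - flux_balance a (q t) (h t)"
          using T[OF t(1)] by (simp add: flux_balance_def algebra_simps)
        then have "6 * \<mu> / M \<le> 6 * (- flux_balance a (q t) (h t)) / (G * (h t)\<^sup>2 * (3 * a - h t))"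
          using den[OF y] \<mu> by (intro frac_le) (auto simp: M_def)
        then show ?thesis by (simp add: P_def)
      qed
    qed
    then show ?thesis using b'(3) by (force simp: eventually_at_bot_linorder)
  qed
  have top: "eventually (\<lambda>t. h t < b) at_top" if "a < b" for b
  proof -
    define b' where "b' = min (2 * a) b"
    have b': "a < b'" "b' \<le> b" using that a by (auto simp: b'_def)
    \<comment> \<open>While \<open>b' \<le> h t\<close>, the balance is at least
      \<open>(1 - q t) * (b' - a) - q t * a\<^sup>2\<close>, where \<open>a\<^sup>2\<close> bounds
      \<open>h t * (a - h t / 2)\<close>; \<open>\<mu>\<close> is half of the limit of this bound as
      \<open>q\<close> tends to 0.\<close>
    define \<mu> where "\<mu> = (b' - a) / 2"
    have \<mu>: "\<mu> > 0" using b' a by (simp add: \<mu>_def)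
    have "((\<lambda>t. (1 - q t) * (b' - a) - q t * a\<^sup>2) \<longlongrightarrow> (1 - 0) * (b' - a) - 0 * a\<^sup>2) at_top"
      by (intro tendsto_intros q_top)
    then have "eventually (\<lambda>t. \<mu> < (1 - q t) * (b' - a) - q t * a\<^sup>2) at_top"
      by (rule order_tendstoD) (use \<mu> in \<open>simp add: \<mu>_def\<close>)
    then obtain T where T: "\<And>t. T \<le> t \<Longrightarrow> \<mu> < (1 - q t) * (b' - a) - q t * a\<^sup>2"
      by (auto simp: eventually_at_top_linorder)
    have "eventually (\<lambda>t. h t < b') at_top"
    proof (rule eventually_lt_barrier_at_top[OF dh h(1)])
      show "6 * \<mu> / M > 0" using \<mu> M by simp
      show "- P (t, h t) \<le> - (6 * \<mu> / M)" if t: "T \<le> t" "b' \<le> h t" for t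
      proof -
        have y: "h t \<in> {a..2*a}" using h by auto
        have "q t * (h t * (a - h t / 2)) \<le> q t * (2 * a * (a / 2))"
          using q01[of t] h[of t] a by (intro mult_left_mono mult_mono) auto
        moreover have "(1 - q t) * (b' - a) \<le> (1 - q t) * (h t - a)"
          using q01[of t] t by (intro mult_left_mono) auto
        ultimately have "\<mu> \<le> flux_balance a (q t) (h t)"
          using T[OF t(1)] by (simp add: flux_balance_def algebra_simps power2_eq_square)
        then have "6 * \<mu> / M \<le> 6 * flux_balance a (q t) (h t) / (G * (h t)\<^sup>2 * (3 * a - h t))"
          using den[OF y] \<mu> by (intro frac_le) (auto simp: M_def)
        then show ?thesis by (simp add: P_def)
      qed
    qed
    then show ?thesis by (rule eventually_mono) (use b'(2) in simp)
  qed
  have "(h \<longlongrightarrow> 2 * a) at_bot"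
    by (rule order_tendstoI) (use bot strict in \<open>auto intro!: always_eventually intro: less_trans[OF strict(2)]\<close>)
  moreover have "(h \<longlongrightarrow> a) at_top"
    by (rule order_tendstoI) (use top strict in \<open>auto intro!: always_eventually intro: less_trans[OF _ strict(1)]\<close>)
  ultimately show ?thesis using strict dh by (intro that[of h]) (auto simp: P_def)
qed

text \<open>Without gravity the balance is quadratic in the height, and \<open>h\<close> is its root
  above \<open>a\<close>. The closed formula degenerates to 0/0 as \<open>q\<close> tends to 0, so
  the limits are read off the balance itself.\<close>

lemma height_profile_no_gravity:
  defines "h \<equiv> (\<lambda>t. a + (sqrt ((1 - q t)\<^sup>2 + (a * q t)\<^sup>2) - (1 - q t)) / q t)"
  shows "continuous_on UNIV h" "a < h t" "h t < 2 * a" "flux_balance a (q t) (h t) = 0"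
    "(h \<longlongrightarrow> 2 * a) at_bot" "(h \<longlongrightarrow> a) at_top"
proof -
  show "continuous_on UNIV h"
    unfolding h_def using q01 by (intro continuous_intros cq) (auto simp: less_imp_neq[symmetric])
  define r where "r = (\<lambda>t. sqrt ((1 - q t)\<^sup>2 + (a * q t)\<^sup>2))"
  have r2: "(r t)\<^sup>2 = (1 - q t)\<^sup>2 + (a * q t)\<^sup>2" for t by (simp add: r_def)
  have h: "h t = a + (r t - (1 - q t)) / q t" for t by (simp add: h_def r_def)
  have lo: "a < h t" for t
  proof -
    have "1 - q t < r t" unfolding r_def using q01[of t] a by (intro real_less_rsqrt) simp
    then show ?thesis using q01[of t] by (simp add: h)
  qed
  have hi: "h t < 2 * a" for t
  proof -
    have "(1 - q t)\<^sup>2 + (a * q t)\<^sup>2 < (1 - q t + a * q t)\<^sup>2"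
      using q01[of t] a by (simp add: power2_sum)
    then have "r t < 1 - q t + a * q t" 
      unfolding r_def using q01[of t] a by (intro real_less_lsqrt) auto
    then show ?thesis using q01[of t] by (simp add: h field_simps)
  qed
  have bal: "flux_balance a (q t) (h t) = 0" for t
  proof -
    \<comment> \<open>With \<open>u = q t * (h t - a)\<close> the balance completes to a square:
      \<open>2 * q\<close> times it equals
      \<open>(u + (1 - q))\<^sup>2 - ((1 - q)\<^sup>2 + (a * q)\<^sup>2)\<close>.\<close>
    define u where "u = r t - (1 - q t)"
    have qh: "q t * h t = u + a * q t" using q01(1)[of t] by (simp add: h u_def field_simps)
    have "q t * flux_balance a (q t) (h t)
        = (q t * h t) * (q t * h t) / 2 - a * q t * (q t * h t) + (1 - q t) * (q t * h t - a * q t)"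
      by (simp add: flux_balance_def algebra_simps)
    also have "\<dots> = ((u + (1 - q t))\<^sup>2 - ((1 - q t)\<^sup>2 + (a * q t)\<^sup>2)) / 2"
      unfolding qh by (simp add: algebra_simps power2_eq_square)
    also have "\<dots> = 0" by (simp add: u_def r2)
    finally show ?thesis using q01(1)[of t] by simp
  qed
  show "a < h t" "h t < 2 * a" "flux_balance a (q t) (h t) = 0" using lo hi bal by auto
  \<comment> \<open>Both sides are nonnegative for heights between \<open>a\<close> and
    \<open>2 * a\<close>. Bounding one factor on each side controls \<open>2 * a - h\<close> by
    \<open>(1 - q) / q\<close> and \<open>h - a\<close> by \<open>q / (1 - q)\<close>.\<close>
  have e1: "(1 - q t) * (h t - a) = q t * (h t * (a - h t / 2))" for t
    using bal[of t] by (simp add: flux_balance_def algebra_simps)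
  show "(h \<longlongrightarrow> 2 * a) at_bot"
  proof (rule tendsto_sandwich[OF _ _ _ tendsto_const])
    show "eventually (\<lambda>t. 2 * a - 2 * (1 - q t) / q t \<le> h t) at_bot"
    proof (intro always_eventually allI)
      fix t
      have "q t * (a * (a - h t / 2)) \<le> q t * (h t * (a - h t / 2))"
        using q01[of t] lo[of t] hi[of t] a by (intro mult_left_mono mult_right_mono) auto
      also have "\<dots> = (1 - q t) * (h t - a)" by (rule e1[symmetric])
      also have "\<dots> \<le> (1 - q t) * a" using q01[of t] hi[of t] by (intro mult_left_mono) auto
      finally have "a * (q t * (a - h t / 2)) \<le> a * (1 - q t)" by (simp add: algebra_simps)
      then have "q t * (a - h t / 2) \<le> 1 - q t" using a by simp
      then show "2 * a - 2 * (1 - q t) / q t \<le> h t" using q01[of t] by (simp add: field_simps)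
    qed
    show "eventually (\<lambda>t. h t \<le> 2 * a) at_bot" using hi by (auto simp: less_imp_le)
    have "((\<lambda>t. 2 * a - 2 * (1 - q t) / q t) \<longlongrightarrow> 2 * a - 2 * (1 - 1) / 1) at_bot"
      by (intro tendsto_intros q_bot) auto
    then show "((\<lambda>t. 2 * a - 2 * (1 - q t) / q t) \<longlongrightarrow> 2 * a) at_bot" by simp
  qed
  show "(h \<longlongrightarrow> a) at_top"
  proof (rule tendsto_sandwich[OF _ _ tendsto_const])
    show "eventually (\<lambda>t. h t \<le> a + q t * a\<^sup>2 / (1 - q t)) at_top"
    proof (intro always_eventually allI)
      fix t
      have "(1 - q t) * (h t - a) = q t * (h t * (a - h t / 2))" by (rule e1)
      also have "\<dots> \<le> q t * (2 * a * (a / 2))"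
        using q01[of t] lo[of t] hi[of t] a by (intro mult_left_mono mult_mono) auto
      finally show "h t \<le> a + q t * a\<^sup>2 / (1 - q t)"
        using q01[of t] by (simp add: field_simps power2_eq_square)
    qed
    show "eventually (\<lambda>t. a \<le> h t) at_top" using lo by (auto simp: less_imp_le)
    have "((\<lambda>t. a + q t * a\<^sup>2 / (1 - q t)) \<longlongrightarrow> a + 0 * a\<^sup>2 / (1 - 0)) at_top"
      by (intro tendsto_intros q_top) auto
    then show "((\<lambda>t. a + q t * a\<^sup>2 / (1 - q t)) \<longlongrightarrow> a) at_top" by simp
  qed
qed

end

section \<open>Profiles with diffusion\<close>

text \<open>Here \<open>1 / \<kappa>\<close> is the rate of tau and
  \<open>- 6 * flux_balance a q y / (y\<^sup>2 * (3 * a - y))\<close> is \<open>G\<close> times the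
  tau-derivative of the height. The last two identities say that these solve the two first
  integrals, with \<open>g\<close> in place of the concentration. The closed form of
  \<open>\<kappa>\<close> shows its sign, which the sum in the first identity hides.\<close>

lemma flux_identities:
  fixes a q y g \<kappa> :: real
  assumes "0 < a" "a < y" "y < 2 * a" "\<kappa> \<noteq> 0"
    and \<kappa>: "\<kappa> = y * (y * q + 4 * (1 - q)) / (2 * (3 * a - y))"
  shows "y * q + (1 - q) + 3 * flux_balance a q y / (3 * a - y) = \<kappa>"
    and "y\<^sup>2 / 2 * (q / \<kappa>) - y ^ 3 / 3 * ((- 6 * flux_balance a q y / (y\<^sup>2 * (3 * a - y))) / \<kappa>) = y - a"
    and "y * g * (q / \<kappa>) + (1 - q) * g / \<kappa>
      - g * y\<^sup>2 / 2 * ((- 6 * flux_balance a q y / (y\<^sup>2 * (3 * a - y))) / \<kappa>) = g"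
proof -
  have d: "3 * a - y \<noteq> 0" "y \<noteq> 0" using assms by auto
  show *: "y * q + (1 - q) + 3 * flux_balance a q y / (3 * a - y) = \<kappa>"
    unfolding \<kappa> flux_balance_def using d by (simp add: divide_simps) (simp add: algebra_simps)
  have "y\<^sup>2 / 2 * q + 2 * y * flux_balance a q y / (3 * a - y) = (y - a) * \<kappa>"
    unfolding \<kappa> flux_balance_def using d
    by (simp add: divide_simps) (simp add: algebra_simps power2_eq_square)
  moreover have "y\<^sup>2 / 2 * (q / \<kappa>) - y ^ 3 / 3 * ((- 6 * flux_balance a q y / (y\<^sup>2 * (3 * a - y))) / \<kappa>)
      = (y\<^sup>2 / 2 * q + 2 * y * flux_balance a q y / (3 * a - y)) / \<kappa>"
    using d assms(4) by (simp add: divide_simps) (simp add: algebra_simps power2_eq_square power3_eq_cube)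
  ultimately show "y\<^sup>2 / 2 * (q / \<kappa>) - y ^ 3 / 3 * ((- 6 * flux_balance a q y / (y\<^sup>2 * (3 * a - y))) / \<kappa>) = y - a"
    using assms(4) by simp
  have "y * g * (q / \<kappa>) + (1 - q) * g / \<kappa>
      - g * y\<^sup>2 / 2 * ((- 6 * flux_balance a q y / (y\<^sup>2 * (3 * a - y))) / \<kappa>)
     = g * ((y * q + (1 - q) + 3 * flux_balance a q y / (3 * a - y)) / \<kappa>)"
    using d assms(4) by (simp add: divide_simps) (simp add: algebra_simps power2_eq_square)
  then show "y * g * (q / \<kappa>) + (1 - q) * g / \<kappa>
      - g * y\<^sup>2 / 2 * ((- 6 * flux_balance a q y / (y\<^sup>2 * (3 * a - y))) / \<kappa>) = g"
    using assms(4) by (simp add: *)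
qed

lemma pw_primitive_C1:
  assumes "\<And>x. (U has_real_derivative V x) (at x)" "continuous_on UNIV V"
  shows "pw_primitive U V"
  unfolding pw_primitive_def
proof (intro conjI allI impI assms borel_measurable_continuous_onI)
  show "continuous_on UNIV U"
    by (intro continuous_at_imp_continuous_on ballI DERIV_isCont[OF assms(1)])
  show "\<exists>C. \<forall>x. \<bar>x\<bar> \<le> R \<longrightarrow> \<bar>V x\<bar> \<le> C" for R
  proof -
    obtain C where C: "\<And>x. x \<in> {-R..R} \<Longrightarrow> \<bar>V x\<bar> \<le> C"
      using continuous_on_compact_abs_bound[OF assms(2) compact_Icc] by blast
    have "\<bar>V x\<bar> \<le> C" if "\<bar>x\<bar> \<le> R" for x using that by (intro C) auto
    then show ?thesis by blast
  qed
qed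

lemma continuous_antiderivative_real_line:
  fixes f :: "real \<Rightarrow> real"
  assumes "continuous_on UNIV f"
  obtains F where "\<And>x. (F has_real_derivative f x) (at x)"
proof -
  have "\<exists>F. \<forall>x::real. -\<infinity> < ereal x \<longrightarrow> ereal x < \<infinity> \<longrightarrow> (F has_vector_derivative f x) (at x)"
    using assms by (intro einterval_antiderivative) (auto simp: continuous_on_eq_continuous_at)
  then obtain F where "\<And>x. (F has_vector_derivative f x) (at x)" by auto
  then show ?thesis by (intro that[of F]) (simp add: has_real_derivative_iff_has_vector_derivative)
qed

text \<open>The uniform lower bound on the derivative gives linear growth in both directions and
  thereby surjectivity; mere positivity could leave a bounded range.\<close>

lemma C1_diffeomorphism_of_real_line:
  fixes X \<kappa> :: "real \<Rightarrow> real"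
  assumes X: "\<And>x. (X has_real_derivative \<kappa> x) (at x)" and c: "c > 0" "\<And>x. c \<le> \<kappa> x"
  obtains \<theta> where "\<And>x. X (\<theta> x) = x" "\<And>t. \<theta> (X t) = t"
    "\<And>x. (\<theta> has_real_derivative inverse (\<kappa> (\<theta> x))) (at x)" "strict_mono \<theta>"
    "filterlim \<theta> at_top at_top" "filterlim \<theta> at_bot at_bot"
proof -
  have pos: "\<kappa> x > 0" for x using c by (meson less_le_trans)
  have grow: "c * (y - x) \<le> X y - X x" if "x < y" for x y
  proof -
    obtain z where "X y - X x = (y - x) * \<kappa> z" using MVT2[OF \<open>x < y\<close>, of X \<kappa>] X by blast
    then show ?thesis using c(2)[of z] that by (simp add: mult.commute mult_left_mono)
  qed
  have range: "range X = UNIV"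
  proof (rule unbounded_connected_real_UNIV)
    show "connected (range X)"
      by (intro connected_continuous_image continuous_at_imp_continuous_on ballI DERIV_isCont[OF X]) auto
    fix y
    define n where "n = (\<bar>y - X 0\<bar> + 1) / c"
    have n: "n > 0" "c * n = \<bar>y - X 0\<bar> + 1" using c by (auto simp: n_def)
    have "y < X n" using grow[of 0 n] n by auto
    then show "\<exists>x\<in>range X. y < x" by blast
    have "X (- n) < y" using grow[of "-n" 0] n by auto
    then show "\<exists>x\<in>range X. x < y" by blast
  qed
  obtain \<theta> where \<theta>: "\<And>x. X (\<theta> x) = x" "\<And>t. \<theta> (X t) = t"
    "\<And>x. (\<theta> has_real_derivative inverse (\<kappa> (\<theta> x))) (at x)"
    by (rule inverse_C1_diffeomorphism[where S=UNIV and T=UNIV and f=X and f'=\<kappa>]) (use range X pos in auto)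
  have Xm: "X x < X y" if "x < y" for x y
  proof -
    have "0 < c * (y - x)" using c(1) that by simp
    with grow[OF that] show ?thesis by linarith
  qed
  have mono: "\<theta> x < \<theta> y" if "x < y" for x y
  proof (rule ccontr)
    assume "\<not> \<theta> x < \<theta> y"
    then have "X (\<theta> y) \<le> X (\<theta> x)" using Xm[of "\<theta> y" "\<theta> x"] by (cases "\<theta> x = \<theta> y") auto
    then show False using that \<theta>(1) by simp
  qed
  have "filterlim \<theta> at_top at_top"
    unfolding filterlim_at_top
  proof
    fix Z
    have "Z \<le> \<theta> x" if "x \<ge> X Z" for x using mono[of "X Z" x] \<theta>(2) that by (cases "x = X Z") auto
    then show "eventually (\<lambda>x. Z \<le> \<theta> x) at_top" by (auto simp: eventually_at_top_linorder)
  qed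
  moreover have "filterlim \<theta> at_bot at_bot"
    unfolding filterlim_at_bot
  proof
    fix Z
    have "\<theta> x \<le> Z" if "x \<le> X Z" for x using mono[of x "X Z"] \<theta>(2) that by (cases "x = X Z") auto
    then show "eventually (\<lambda>x. \<theta> x \<le> Z) at_bot" by (auto simp: eventually_at_bot_linorder)
  qed
  moreover have "strict_mono \<theta>" using mono by (auto simp: strict_mono_def)
  ultimately show ?thesis using \<theta> by (intro that[of \<theta>]) auto
qed

text \<open>Each level \<open>b'\<close> in the unit interval is attained by \<open>g\<close> at
  \<open>f b'\<close>; monotonicity then keeps \<open>g\<close> on the right side of
  \<open>b'\<close> from there on.\<close>

lemma decreasing_inverse_limits:
  fixes g f :: "real \<Rightarrow> real"
  assumes "\<And>x. x \<in> {0<..<1} \<Longrightarrow> g (f x) = x" "\<And>t. g t \<in> {0<..<1}" "\<And>s t. s < t \<Longrightarrow> g t < g s"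
  shows "(g \<longlongrightarrow> 1) at_bot" "(g \<longlongrightarrow> 0) at_top"
proof -
  show "(g \<longlongrightarrow> 1) at_bot"
  proof (rule order_tendstoI)
    fix b :: real assume "b < 1"
    define b' where "b' = max b (1/2)"
    have b': "b' \<in> {0<..<1}" "b \<le> b'" using \<open>b < 1\<close> by (auto simp: b'_def)
    have "b < g t" if "t < f b'" for t using assms(3)[OF that] assms(1)[OF b'(1)] b'(2) by simp
    then show "eventually (\<lambda>t. b < g t) at_bot" by (auto simp: eventually_at_bot_dense)
  next
    fix b :: real assume "1 < b"
    then show "eventually (\<lambda>t. g t < b) at_bot"
      using assms(2) by (intro always_eventually allI) (meson greaterThanLessThan_iff less_trans)
  qed
  show "(g \<longlongrightarrow> 0) at_top"
  proof (rule order_tendstoI)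
    fix b :: real assume "0 < b"
    define b' where "b' = min b (1/2)"
    have b': "b' \<in> {0<..<1}" "b' \<le> b" using \<open>0 < b\<close> by (auto simp: b'_def)
    have "g t < b" if "f b' < t" for t using assms(3)[OF that] assms(1)[OF b'(1)] b'(2) by simp
    then show "eventually (\<lambda>t. g t < b) at_top" by (auto simp: eventually_at_top_dense)
  next
    fix b :: real assume "b < 0"
    then show "eventually (\<lambda>t. b < g t) at_top"
      using assms(2) by (intro always_eventually allI) (meson greaterThanLessThan_iff less_trans)
  qed
qed

section \<open>The range of the surface tension and of tau\<close>

locale surface_tension =
  fixes \<sigma> \<sigma>' :: "real \<Rightarrow> real" and a :: real
  assumes a: "a > 0"
    and \<sigma>_within: "\<And>z. z \<in> {0..<1} \<Longrightarrow> (\<sigma> has_real_derivative \<sigma>' z) (at z within {0..<1})"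
    and continuous_\<sigma>': "continuous_on {0..<1} \<sigma>'"
    and neg: "\<And>z. z \<in> {0..<1} \<Longrightarrow> \<sigma>' z < 0"
    and not_int: "\<not> \<sigma>' absolutely_integrable_on {0<..<1}"
    and \<sigma>'_bot: "filterlim \<sigma>' at_bot (at_left 1)"
begin

lemma continuous_\<sigma>: "continuous_on {0..<1} \<sigma>"
  by (rule DERIV_continuous_on[where D=\<sigma>']) (rule \<sigma>_within)

lemma \<sigma>_der: "(\<sigma> has_real_derivative \<sigma>' z) (at z)" if "z \<in> {0<..<1}" for z
proof -
  have "(\<sigma> has_real_derivative \<sigma>' z) (at z within {0<..<1})"
    by (rule DERIV_subset[OF \<sigma>_within]) (use that in auto)
  moreover have "at z within {0<..<1} = at z" using that by (intro at_within_open) auto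
  ultimately show ?thesis by (simp only:)
qed

lemma isCont_\<sigma>': "isCont \<sigma>' z" if "z \<in> {0<..<1}" for z
  using that by (intro continuous_on_interior[OF continuous_\<sigma>']) simp

lemma \<sigma>_decreasing: "\<sigma> y < \<sigma> x" if "0 \<le> x" "x < y" "y < 1" for x y
proof (rule DERIV_neg_imp_decreasing_open[OF that(2)])
  show "\<exists>d. (\<sigma> has_real_derivative d) (at z) \<and> d < 0" if z: "x < z" "z < y" for z
    using \<sigma>_der[of z] neg[of z] z \<open>0 \<le> x\<close> \<open>y < 1\<close> by (intro exI[of _ "\<sigma>' z"]) auto
  show "continuous_on {x..y} \<sigma>" using continuous_\<sigma> that by (auto elim: continuous_on_subset)
qed

text \<open>Here the non-integrability of \<open>\<sigma>'\<close> is turned into a statement on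
  \<open>\<sigma>\<close>: if the increasing function \<open>- \<sigma>\<close> were bounded, it
  would have a limit at 1, and the fundamental theorem for nonnegative integrands would make
  \<open>\<sigma>'\<close> integrable.\<close>

lemma \<sigma>_unbounded: "\<exists>z. x < z \<and> z < 1 \<and> \<sigma> z < y" if "x < 1" for x y
proof (rule ccontr)
  assume "\<not> (\<exists>z. x < z \<and> z < 1 \<and> \<sigma> z < y)"
  then have ge: "\<And>z. x < z \<Longrightarrow> z < 1 \<Longrightarrow> y \<le> \<sigma> z" by force
  have ge': "y \<le> \<sigma> z" if "z \<in> {0<..<1}" for z
  proof -
    \<comment> \<open>The assumed bound holds only to the right of \<open>x\<close>; a point beyond
      both \<open>x\<close> and \<open>z\<close> carries it back to \<open>z\<close> by
      monotonicity.\<close>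
    define u where "u = (max x z + 1) / 2"
    have "x < u" "z < u" "u < 1" using \<open>x < 1\<close> that by (auto simp: u_def max_def)
    then show ?thesis using ge[of u] \<sigma>_decreasing[of z u] that by auto
  qed
  define l where "l = Sup ((\<lambda>z. - \<sigma> z) ` {0<..<1})"
  have bdd: "bdd_above ((\<lambda>z. - \<sigma> z) ` {0<..<1})" using ge' by (intro bdd_aboveI[of _ "- y"]) auto
  have lim1: "((\<lambda>z. - \<sigma> z) \<longlongrightarrow> l) (at_left 1)"
  proof (rule increasing_tendsto)
    have "eventually (\<lambda>z. z \<in> {0<..<1}) (at_left (1::real))"
      by (auto simp: eventually_at_left_field intro: exI[of _ 0])
    then show "eventually (\<lambda>z. - \<sigma> z \<le> l) (at_left 1)"
      by eventually_elim (use bdd in \<open>auto simp: l_def intro!: cSUP_upper\<close>)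
    fix v assume "v < l"
    then obtain u where u: "u \<in> {0<..<1}" "v < - \<sigma> u"
      using less_cSUP_iff[OF _ bdd, of v] by (auto simp: l_def)
    then have "v < - \<sigma> z" if "u < z" "z < 1" for z using \<sigma>_decreasing[of u z] that by auto
    then show "eventually (\<lambda>z. v < - \<sigma> z) (at_left 1)"
      using u(1) by (auto simp: eventually_at_left_field)
  qed
  have "continuous_on {0..1/2} \<sigma>" by (rule continuous_on_subset[OF continuous_\<sigma>]) auto
  then have "(\<sigma> \<longlongrightarrow> \<sigma> 0) (at 0 within {0..1/2})" by (auto simp: continuous_on_def)
  then have "(\<sigma> \<longlongrightarrow> \<sigma> 0) (at_right 0)"
    by (simp add: at_within_Icc_at_right)
  then have lim0: "((\<lambda>z. - \<sigma> z) \<longlongrightarrow> - \<sigma> 0) (at_right 0)" by (intro tendsto_minus)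
  have "set_integrable lborel (einterval (ereal 0) (ereal 1)) (\<lambda>z. - \<sigma>' z)"
  proof (rule interval_integral_FTC_nonneg(1))
    show "DERIV (\<lambda>z. - \<sigma> z) z :> - \<sigma>' z" if "ereal 0 < ereal z" "ereal z < ereal 1" for z
      using that by (intro DERIV_minus \<sigma>_der) auto
    show "isCont (\<lambda>z. - \<sigma>' z) z" if "ereal 0 < ereal z" "ereal z < ereal 1" for z
      using that by (intro continuous_minus isCont_\<sigma>') auto
    show "AE x in lborel. ereal 0 < ereal x \<longrightarrow> ereal x < ereal 1 \<longrightarrow> 0 \<le> - \<sigma>' x"
      using neg by (intro AE_I2) (auto simp: less_imp_le)
  qed (use lim0 lim1 in \<open>auto simp: ereal_tendsto_simps\<close>)
  then have "set_integrable lborel {0<..<1} (\<lambda>z. - \<sigma>' z)" by simp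
  then have *: "set_integrable lborel {0<..<1} \<sigma>'"
    using set_integrable_mult_right[of "-1" lborel "{0<..<1}" "\<lambda>z. - \<sigma>' z"] by simp
  then have "\<sigma>' absolutely_integrable_on {0<..<1}"
    unfolding set_integrable_def by (subst integrable_completion) (auto dest: borel_measurable_integrable)
  then show False using not_int by simp
qed

text \<open>Concentration and height are built as functions \<open>g\<close> and \<open>h\<close> of
  tau and composed with the inverse \<open>\<theta>\<close> of the quadrature. For
  \<open>G > 0\<close> the differential equation for \<open>h\<close> supplies a continuous
  derivative, whereas for \<open>G = 0\<close> the height is an algebraic function of the continuous
  \<open>q\<close>; so \<open>H'\<close> is provided for \<open>G > 0\<close> only.\<close>

lemma diffusive_profile:
  assumes G: "G \<ge> 0" and D: "D > 0"
  obtains H \<Gamma> H' \<Gamma>' where "traveling_wave_profile G D \<sigma> 1 H \<Gamma>" "antimono \<Gamma>"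
    "(H \<longlongrightarrow> 2 * a) at_bot" "(\<Gamma> \<longlongrightarrow> 1) at_bot" "(H \<longlongrightarrow> a) at_top" "(\<Gamma> \<longlongrightarrow> 0) at_top"
    "\<And>x. a < H x" "\<And>x. H x < 2 * a" "\<And>x. 0 < \<Gamma> x" "\<And>x. \<Gamma> x < 1"
    "continuous_on UNIV H" "\<And>x. (\<Gamma> has_real_derivative \<Gamma>' x) (at x)" "continuous_on UNIV \<Gamma>'"
    "\<And>x. G > 0 \<Longrightarrow> (H has_real_derivative H' x) (at x)" "G > 0 \<Longrightarrow> continuous_on UNIV H'"
    "\<And>x. G = 0 \<Longrightarrow> H x = (D + \<Gamma> x * \<sigma>' (\<Gamma> x) * a - sqrt (D\<^sup>2 + (\<Gamma> x * \<sigma>' (\<Gamma> x) * a)\<^sup>2))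
                    / (\<Gamma> x * \<sigma>' (\<Gamma> x))"
    "\<And>x. G = 0 \<Longrightarrow> (LBINT z=ereal (\<Gamma> 0)..ereal (\<Gamma> x).
               (z * \<sigma>' z * a - sqrt (D\<^sup>2 + (z * \<sigma>' z * a)\<^sup>2)) / z) = x"
proof -
  define \<tau> where "\<tau> = (\<lambda>z. \<sigma> z - D * ln z)"
  define \<tau>' where "\<tau>' = (\<lambda>z. \<sigma>' z - D / z)"
  have d\<tau>: "(\<tau> has_real_derivative \<tau>' z) (at z)" if "z \<in> {0<..<1}" for z
    unfolding \<tau>_def \<tau>'_def using that \<sigma>_der[OF that] by (auto intro!: derivative_eq_intros)
  have \<tau>'_neg: "\<tau>' z < 0" if "z \<in> {0<..<1}" for z
  proof -
    have "\<sigma>' z < 0" using neg[of z] that by auto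
    moreover have "D / z > 0" using that D by simp
    ultimately show ?thesis by (simp add: \<tau>'_def)
  qed
  have range_\<tau>: "\<tau> ` {0<..<1} = UNIV"
  proof (rule unbounded_connected_real_UNIV)
    show "connected (\<tau> ` {0<..<1})"
      by (intro connected_continuous_image continuous_at_imp_continuous_on ballI DERIV_isCont[OF d\<tau>]) auto
    fix y
    \<comment> \<open>For \<open>z > 1/2\<close> the logarithmic term is below
      \<open>D * ln 2\<close>, so it suffices to push \<open>\<sigma> z\<close> below
      \<open>y\<close> by that amount.\<close>
    obtain z where z: "1/2 < z" "z < 1" "\<sigma> z < y - D * ln 2"
      using \<sigma>_unbounded[of "1/2" "y - D * ln 2"] by auto
    have "ln (1/2) < ln z" using z by (subst ln_less_cancel_iff) auto
    then have "- ln z < ln 2" by (simp add: ln_div)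
    then have "D * (- ln z) < D * ln 2" using D by (rule mult_strict_left_mono)
    then have "\<tau> z < y" using z by (simp add: \<tau>_def)
    then show "\<exists>x\<in>\<tau> ` {0<..<1}. x < y" using z by auto
    \<comment> \<open>The exponential makes \<open>- D * ln u\<close> at least
      \<open>\<bar>y - \<sigma> (1/2)\<bar> + 1\<close>, and \<open>u \<le> 1/4\<close> gives
      \<open>\<sigma> u > \<sigma> (1/2)\<close>.\<close>
    define u where "u = min (1/4) (exp (- (\<bar>y - \<sigma> (1/2)\<bar> + 1) / D))"
    have u: "0 < u" "u \<le> 1/4" by (auto simp: u_def)
    have "ln u \<le> ln (exp (- (\<bar>y - \<sigma> (1/2)\<bar> + 1) / D))"
      using u(1) by (subst ln_le_cancel_iff) (auto simp: u_def)
    then have "D * ln u \<le> D * (- (\<bar>y - \<sigma> (1/2)\<bar> + 1) / D)" using D by (intro mult_left_mono) auto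
    then have "D * ln u \<le> - (\<bar>y - \<sigma> (1/2)\<bar> + 1)" using D by simp
    moreover have "\<sigma> (1/2) < \<sigma> u" using \<sigma>_decreasing[of u "1/2"] u by auto
    ultimately have "y < \<tau> u" by (simp add: \<tau>_def)
    then show "\<exists>x\<in>\<tau> ` {0<..<1}. y < x" using u by auto
  qed
  obtain g where g: "\<And>t. g t \<in> {0<..<1}" "\<And>t. \<tau> (g t) = t" "\<And>z. z \<in> {0<..<1} \<Longrightarrow> g (\<tau> z) = z"
    "\<And>t. (g has_real_derivative inverse (\<tau>' (g t))) (at t)"
    and \<tau>_less: "\<And>x y. x \<in> {0<..<1} \<Longrightarrow> y \<in> {0<..<1} \<Longrightarrow> x < y \<Longrightarrow>
      if \<forall>x\<in>{0<..<1}. \<tau>' x > 0 then \<tau> x < \<tau> y else \<tau> y < \<tau> x"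
  proof (rule inverse_C1_diffeomorphism[of "{0<..<1}" \<tau> UNIV \<tau>'])
    show "is_interval {0<..<1::real}" by (simp add: is_interval_1)
  qed (use range_\<tau> d\<tau> \<tau>'_neg in auto)
  have \<tau>_decreasing: "\<tau> y < \<tau> x" if "x \<in> {0<..<1}" "y \<in> {0<..<1}" "x < y" for x y
  proof -
    have "\<not> (\<forall>x\<in>{0<..<1}. \<tau>' x > 0)" using \<tau>'_neg[of x] that by (auto intro!: bexI[of _ x])
    then show ?thesis using \<tau>_less[OF that] by simp
  qed
  have g_dec: "g t < g s" if "s < t" for s t
  proof (rule ccontr)
    assume "\<not> g t < g s"
    then have "\<tau> (g t) \<le> \<tau> (g s)"
      using \<tau>_decreasing[OF g(1)[of s] g(1)[of t]] by (cases "g s = g t") auto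
    then show False using that g(2) by simp
  qed
  note g_lim = decreasing_inverse_limits[of g \<tau>, OF g(3) g(1) g_dec]
  have cg: "continuous_on UNIV g"
    by (intro continuous_at_imp_continuous_on ballI DERIV_isCont[OF g(4)])
  have g': "0 < g t" "g t < 1" for t using g(1)[of t] by auto

  \<comment> \<open>\<open>A\<close> is continuous up to 0 with \<open>A 0 = 0\<close>, which is
    what makes \<open>q\<close> vanish in the limit of small concentration.\<close>
  define A where "A = (\<lambda>z. z * \<sigma>' z)"
  have A_neg: "A z < 0" if "z \<in> {0<..<1}" for z
    using neg[of z] that by (auto simp: A_def mult_less_0_iff)
  define q where "q = (\<lambda>t. A (g t) / (A (g t) - D))"
  have cA: "continuous_on {0..<1} A" unfolding A_def by (intro continuous_intros continuous_\<sigma>')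
  have cAg: "continuous_on UNIV (\<lambda>t. A (g t))"
    by (rule continuous_on_compose2[OF cA cg]) (use g' in \<open>auto simp: less_imp_le\<close>)
  have AD: "A (g t) - D < 0" for t using A_neg[OF g(1)[of t]] D by simp
  have cq: "continuous_on UNIV q"
    unfolding q_def using AD by (intro continuous_intros cAg) (auto simp: less_imp_neq)
  have q1: "1 - q t = - D / (A (g t) - D)" for t using AD[of t] by (simp add: q_def field_simps)
  have q01: "0 < q t" "q t < 1" for t
  proof -
    show "0 < q t" unfolding q_def using AD[of t] A_neg[OF g(1)[of t]] by (simp add: divide_neg_neg)
    have "0 < 1 - q t" unfolding q1 using divide_pos_neg[OF D AD[of t]] by simp
    then show "q t < 1" by simp
  qed
  \<comment> \<open>Writing \<open>q = 1 + D / (A - D)\<close> reduces the limit to the divergence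
    of \<open>A\<close> to minus infinity at full concentration, that is, to that of
    \<open>\<sigma>'\<close>.\<close>
  have q_bot: "(q \<longlongrightarrow> 1) at_bot"
  proof -
    have "filterlim g (at_left 1) at_bot"
      unfolding at_within_def using g_lim(1) g'
      by (auto simp: filterlim_inf filterlim_principal less_imp_neq)
    then have "filterlim (\<lambda>t. \<sigma>' (g t)) at_bot at_bot" by (rule filterlim_compose[OF \<sigma>'_bot])
    then have "filterlim (\<lambda>t. A (g t)) at_bot at_bot"
      unfolding A_def using g_lim(1) by (intro filterlim_tendsto_pos_mult_at_bot[where c=1]) auto
    then have "filterlim (\<lambda>t. - D + A (g t)) at_bot at_bot"
      by (simp only: filterlim_tendsto_add_at_bot_iff[OF tendsto_const])
    then have "((\<lambda>t. D / (- D + A (g t))) \<longlongrightarrow> 0) at_bot"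
      by (intro tendsto_divide_0[OF tendsto_const] filterlim_mono[OF _ at_bot_le_at_infinity order_refl])
    then have "((\<lambda>t. 1 + D / (- D + A (g t))) \<longlongrightarrow> 1 + 0) at_bot" by (intro tendsto_intros)
    moreover have "1 + D / (- D + A (g t)) = q t" for t using AD[of t] by (simp add: q_def field_simps)
    ultimately show ?thesis by simp
  qed
  have q_top: "(q \<longlongrightarrow> 0) at_top"
  proof -
    have "((\<lambda>t. A (g t)) \<longlongrightarrow> A 0) at_top"
      by (rule continuous_on_tendsto_compose[OF cA g_lim(2)]) (use g' in \<open>auto simp: less_imp_le\<close>)
    then have "(q \<longlongrightarrow> A 0 / (A 0 - D)) at_top"
      unfolding q_def using D by (intro tendsto_intros) (auto simp: A_def)
    then show ?thesis by (simp add: A_def)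
  qed

  \<comment> \<open>\<open>V h\<close> represents \<open>G\<close> times the derivative of
    \<open>h\<close> without dividing by \<open>G\<close>. It is zero for \<open>G = 0\<close>,
    where the balance vanishes, so later identities need no separate treatment of that case.\<close>
  define V where "V = (\<lambda>h t. - 6 * flux_balance a (q t) (h t) / ((h t)\<^sup>2 * (3 * a - h t)))"
  obtain h where ch: "continuous_on UNIV h" and h: "\<And>t. a < h t" "\<And>t. h t < 2 * a"
    and h_lim: "(h \<longlongrightarrow> 2 * a) at_bot" "(h \<longlongrightarrow> a) at_top"
    and dh: "\<And>t. G > 0 \<Longrightarrow> (h has_real_derivative V h t / G) (at t)"
    and h_bal: "\<And>t. G = 0 \<Longrightarrow> flux_balance a (q t) (h t) = 0"
    and h_eq: "\<And>t. G = 0 \<Longrightarrow> h t = a + (sqrt ((1 - q t)\<^sup>2 + (a * q t)\<^sup>2) - (1 - q t)) / q t"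
  proof (cases "G = 0")
    case True
    note * = height_profile_no_gravity[OF a cq q01 q_bot q_top]
    show ?thesis
      using * True by (intro that[of "\<lambda>t. a + (sqrt ((1 - q t)\<^sup>2 + (a * q t)\<^sup>2) - (1 - q t)) / q t"]) auto
  next
    case False
    then have "G > 0" using G by simp
    then obtain h where h: "\<And>t. a < h t" "\<And>t. h t < 2 * a"
      "\<And>t. (h has_real_derivative - 6 * flux_balance a (q t) (h t) / (G * (h t)\<^sup>2 * (3 * a - h t))) (at t)"
      "(h \<longlongrightarrow> 2 * a) at_bot" "(h \<longlongrightarrow> a) at_top"
      using height_profile_gravity[OF a cq q01 q_bot q_top] by metis
    moreover have "continuous_on UNIV h"
      by (intro continuous_at_imp_continuous_on ballI DERIV_isCont[OF h(3)])
    moreover have "- 6 * flux_balance a (q t) (h t) / (G * (h t)\<^sup>2 * (3 * a - h t)) = V h t / G" for t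
      by (simp add: V_def mult_ac)
    ultimately show ?thesis using False by (intro that[of h]) auto
  qed

  \<comment> \<open>\<open>\<kappa>\<close> is the derivative of the travelling coordinate \<open>X\<close> with respect to \<open>\<tau>\<close>.\<close>
  define \<kappa> where "\<kappa> = (\<lambda>t. h t * (h t * q t + 4 * (1 - q t)) / (2 * (3 * a - h t)))"
  \<comment> \<open>For heights between \<open>a\<close> and \<open>2 * a\<close> the numerator of
    \<open>\<kappa>\<close> is at least \<open>a * min a 4\<close> and its denominator at most
    \<open>4 * a\<close>.\<close>
  define m where "m = min a 4 / 4"
  have m: "m > 0" using a by (simp add: m_def)
  have \<kappa>_ge: "m \<le> \<kappa> t" for t
  proof -
    have "a * q t \<le> h t * q t" using h[of t] q01[of t] by (intro mult_right_mono) auto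
    moreover have "min a 4 * q t \<le> a * q t" "min a 4 * (1 - q t) \<le> 4 * (1 - q t)"
      using q01[of t] by (intro mult_right_mono; simp)+
    moreover have "min a 4 = min a 4 * q t + min a 4 * (1 - q t)" by (simp add: algebra_simps)
    ultimately have "min a 4 \<le> h t * q t + 4 * (1 - q t)" by linarith
    then have "a * min a 4 \<le> h t * (h t * q t + 4 * (1 - q t))"
      using h[of t] a by (intro mult_mono) auto
    moreover have "0 < a * min a 4" using a by simp
    moreover have d: "0 < 2 * (3 * a - h t)" "2 * (3 * a - h t) \<le> 4 * a" using h[of t] a by auto
    ultimately have "a * min a 4 / (4 * a) \<le> h t * (h t * q t + 4 * (1 - q t)) / (2 * (3 * a - h t))"
      by (intro frac_le d) linarith+
    then show ?thesis using a by (simp add: m_def \<kappa>_def)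
  qed
  have \<kappa>_pos: "\<kappa> t > 0" for t using \<kappa>_ge[of t] m by linarith
  have h_nz: "h t \<noteq> 0" "3 * a - h t \<noteq> 0" "3 * a \<noteq> h t" for t using h[of t] a by auto
  have c\<kappa>: "continuous_on UNIV \<kappa>"
    unfolding \<kappa>_def by (intro continuous_intros ch cq) (auto simp: h_nz)
  obtain X where X: "\<And>t. (X has_real_derivative \<kappa> t) (at t)"
    using continuous_antiderivative_real_line[OF c\<kappa>] by blast
  obtain \<theta> where \<theta>: "\<And>x. X (\<theta> x) = x" "\<And>t. \<theta> (X t) = t"
    and d\<theta>: "\<And>x. (\<theta> has_real_derivative inverse (\<kappa> (\<theta> x))) (at x)" and \<theta>_mono: "strict_mono \<theta>"
    and \<theta>_lim: "filterlim \<theta> at_top at_top" "filterlim \<theta> at_bot at_bot"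
    by (rule C1_diffeomorphism_of_real_line[OF X m \<kappa>_ge]) blast
  have c\<theta>: "continuous_on UNIV \<theta>"
    by (intro continuous_at_imp_continuous_on ballI DERIV_isCont[OF d\<theta>])
  note identities = flux_identities[OF a h(1) h(2) less_imp_neq[OF \<kappa>_pos, symmetric] fun_cong[OF \<kappa>_def]]

  define H where "H = (\<lambda>x. h (\<theta> x))"
  define \<Gamma> where "\<Gamma> = (\<lambda>x. g (\<theta> x))"
  define \<Gamma>' where "\<Gamma>' = (\<lambda>x. inverse (\<tau>' (g (\<theta> x))) * inverse (\<kappa> (\<theta> x)))"
  define H' where "H' = (\<lambda>x. V h (\<theta> x) / G * inverse (\<kappa> (\<theta> x)))"
  have d\<Gamma>: "(\<Gamma> has_real_derivative \<Gamma>' x) (at x)" for x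
    unfolding \<Gamma>_def \<Gamma>'_def by (rule DERIV_chain2[OF g(4) d\<theta>])
  have dH: "(H has_real_derivative H' x) (at x)" if "G > 0" for x
    unfolding H_def H'_def by (rule DERIV_chain2[OF dh[OF that] d\<theta>])
  have \<tau>'_A: "\<tau>' (g t) = (A (g t) - D) / g t" for t
    using g'[of t] by (simp add: \<tau>'_def A_def field_simps)
  have c\<sigma>'g: "continuous_on UNIV (\<lambda>t. \<sigma>' (g t))"
    by (rule continuous_on_compose2[OF continuous_\<sigma>' cg]) (use g' in \<open>auto simp: less_imp_le\<close>)
  have "continuous_on UNIV (\<lambda>t. inverse (\<tau>' (g t)) * inverse (\<kappa> t))"
    unfolding \<tau>'_def using \<tau>'_neg[OF g(1)] \<kappa>_pos g'
    by (intro continuous_intros c\<sigma>'g cg c\<kappa>) (auto simp: \<tau>'_def less_imp_neq less_imp_neq[symmetric])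
  then have c\<Gamma>': "continuous_on UNIV \<Gamma>'"
    unfolding \<Gamma>'_def by (rule continuous_on_compose2[OF _ c\<theta>]) auto
  have cV: "continuous_on UNIV (V h)"
    unfolding V_def flux_balance_def by (intro continuous_intros ch cq) (auto simp: h_nz)
  have cV\<kappa>: "continuous_on UNIV (\<lambda>t. V h t / G * inverse (\<kappa> t))" if "G > 0"
    using \<kappa>_pos that by (intro continuous_intros cV c\<kappa>) (auto simp: less_imp_neq[symmetric])
  have cH': "continuous_on UNIV H'" if "G > 0"
    unfolding H'_def by (rule continuous_on_compose2[OF cV\<kappa>[OF that] c\<theta>]) simp
  have cH: "continuous_on UNIV H" unfolding H_def by (rule continuous_on_compose2[OF ch c\<theta>]) auto
  \<comment> \<open>\<open>H\<close> may fail to be differentiable for \<open>G = 0\<close>, but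
    only the product \<open>G * H'\<close> enters the conservation laws, and there both sides are
    zero by the balance.\<close>
  have GH': "G * H' x = V h (\<theta> x) / \<kappa> (\<theta> x)" for x
  proof (cases "G = 0")
    case True then show ?thesis by (simp add: V_def h_bal)
  qed (simp add: H'_def divide_inverse)
  define W where "W = (\<lambda>x. \<sigma>' (\<Gamma> x) * \<Gamma>' x)"
  have W: "W x = q (\<theta> x) / \<kappa> (\<theta> x)" for x
    using g'[of "\<theta> x"] AD[of "\<theta> x"]
    by (simp add: W_def \<Gamma>_def \<Gamma>'_def \<tau>'_A q_def divide_inverse) (simp add: A_def)
  have D\<Gamma>': "D * \<Gamma>' x = - ((1 - q (\<theta> x)) * \<Gamma> x / \<kappa> (\<theta> x))" for x
    using g'[of "\<theta> x"] AD[of "\<theta> x"]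
    by (simp add: \<Gamma>_def \<Gamma>'_def \<tau>'_A q1 divide_inverse)
  have prof: "traveling_wave_profile G D \<sigma> 1 H \<Gamma>"
  proof (rule traveling_wave_profileI[where B="2 * a" and W=W and H'=H' and \<Gamma>'=\<Gamma>' and c=a])
    show "H \<in> borel_measurable borel" using cH by (rule borel_measurable_continuous_onI)
    show "\<Gamma> \<in> borel_measurable borel"
      by (intro borel_measurable_continuous_onI continuous_at_imp_continuous_on ballI DERIV_isCont[OF d\<Gamma>])
    show "0 < H x" "H x \<le> 2 * a" for x using h[of "\<theta> x"] a by (auto simp: H_def)
    show "0 \<le> \<Gamma> x" "\<Gamma> x < 1" for x using g'[of "\<theta> x"] by (auto simp: \<Gamma>_def)
    show "pw_primitive (\<lambda>x. \<sigma> (\<Gamma> x)) W"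
    proof (rule pw_primitive_C1)
      show "((\<lambda>x. \<sigma> (\<Gamma> x)) has_real_derivative W x) (at x)" for x
        unfolding W_def by (rule DERIV_chain2[OF \<sigma>_der d\<Gamma>]) (use g in \<open>simp add: \<Gamma>_def\<close>)
      show "continuous_on UNIV W"
        unfolding W_def \<Gamma>_def by (intro continuous_intros c\<Gamma>' continuous_on_compose2[OF c\<sigma>'g c\<theta>]) auto
    qed
    show "pw_primitive H H'" if "G \<noteq> 0" using that G dH cH' by (intro pw_primitive_C1) auto
    show "pw_primitive \<Gamma> \<Gamma>'" by (rule pw_primitive_C1[OF d\<Gamma> c\<Gamma>'])
    show "(H x)\<^sup>2 / 2 * W x - G / 3 * H x ^ 3 * H' x = H x - a" for x
    proof -
      have "G / 3 * H x ^ 3 * H' x = H x ^ 3 / 3 * (G * H' x)" by simp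
      then show ?thesis unfolding GH' W V_def H_def by (simp only: identities(2))
    qed
    show "H x * \<Gamma> x * W x - D * \<Gamma>' x - G / 2 * \<Gamma> x * (H x)\<^sup>2 * H' x = \<Gamma> x" for x
    proof -
      have "G / 2 * \<Gamma> x * (H x)\<^sup>2 * H' x = \<Gamma> x * (H x)\<^sup>2 / 2 * (G * H' x)" by simp
      then show ?thesis unfolding GH' W V_def H_def D\<Gamma>'
        using identities(3)[of "\<theta> x" "\<Gamma> x"] by simp
    qed
  qed
  have lims: "(H \<longlongrightarrow> 2 * a) at_bot" "(\<Gamma> \<longlongrightarrow> 1) at_bot" "(H \<longlongrightarrow> a) at_top" "(\<Gamma> \<longlongrightarrow> 0) at_top"
    unfolding H_def \<Gamma>_def using h_lim g_lim \<theta>_lim by (auto intro: filterlim_compose)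
  have anti: "antimono \<Gamma>"
  proof (rule antimonoI)
    fix x y :: real assume "x \<le> y"
    then have "\<theta> x \<le> \<theta> y" using \<theta>_mono by (simp add: strict_mono_less_eq)
    then show "\<Gamma> y \<le> \<Gamma> x" using g_dec[of "\<theta> x" "\<theta> y"] by (cases "\<theta> x = \<theta> y") (auto simp: \<Gamma>_def)
  qed
  \<comment> \<open>Multiplying through by the positive \<open>B = D - A (g t)\<close> replaces
    \<open>q\<close> by \<open>D\<close> and \<open>A\<close>. The product form is kept because the
    integrand of the quadrature is \<open>(h * A - D) / z\<close>.\<close>
  have formula: "h t * A (g t) = D + A (g t) * a - sqrt (D\<^sup>2 + (A (g t) * a)\<^sup>2)" if "G = 0" for t
  proof -
    have "(1 - q t)\<^sup>2 + (a * q t)\<^sup>2 = (D\<^sup>2 + (A (g t) * a)\<^sup>2) / (A (g t) - D)\<^sup>2"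
      unfolding q1 by (simp add: q_def power_divide power_mult_distrib add_divide_distrib mult.commute)
    then have "sqrt ((1 - q t)\<^sup>2 + (a * q t)\<^sup>2) = sqrt (D\<^sup>2 + (A (g t) * a)\<^sup>2) / - (A (g t) - D)"
      using AD[of t] by (simp add: real_sqrt_divide)
    moreover have "q t = - A (g t) / - (A (g t) - D)" by (simp only: q_def minus_divide_divide)
    moreover have "1 - q t = D / - (A (g t) - D)"
      unfolding q1 using minus_divide_divide[of D "- (A (g t) - D)"] by (simp only: minus_minus)
    moreover define B where "B = - (A (g t) - D)"
    ultimately have "h t = a + (sqrt (D\<^sup>2 + (A (g t) * a)\<^sup>2) / B - D / B) / (- A (g t) / B)"
      using h_eq[OF that, of t] by simp
    moreover have "B > 0" using AD[of t] by (simp add: B_def)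
    ultimately have "h t = a + (sqrt (D\<^sup>2 + (A (g t) * a)\<^sup>2) - D) / (- A (g t))"
      by (simp flip: diff_divide_distrib)
    then show ?thesis using A_neg[OF g(1)[of t]] by (simp add: field_simps)
  qed
  have H_formula: "H x = (D + \<Gamma> x * \<sigma>' (\<Gamma> x) * a - sqrt (D\<^sup>2 + (\<Gamma> x * \<sigma>' (\<Gamma> x) * a)\<^sup>2))
                    / (\<Gamma> x * \<sigma>' (\<Gamma> x))" if "G = 0" for x
    using formula[OF that, of "\<theta> x"] A_neg[OF g(1)[of "\<theta> x"]]
    by (auto simp: H_def \<Gamma>_def A_def eq_divide_eq)
  \<comment> \<open>With zero balance \<open>\<kappa>\<close> is \<open>h * q + (1 - q)\<close>, and
    its product with \<open>\<tau>'\<close> is the integrand. Thus \<open>X\<close> composed with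
    \<open>\<tau>\<close> is an antiderivative, and along the profile it equals the coordinate
    itself.\<close>
  have "(LBINT z=ereal (\<Gamma> 0)..ereal (\<Gamma> x).
       (z * \<sigma>' z * a - sqrt (D\<^sup>2 + (z * \<sigma>' z * a)\<^sup>2)) / z) = X (\<tau> (\<Gamma> x)) - X (\<tau> (\<Gamma> 0))" if "G = 0" for x
  proof (rule interval_integral_FTC_finite)
    have sub: "{min (\<Gamma> 0) (\<Gamma> x)..max (\<Gamma> 0) (\<Gamma> x)} \<subseteq> {0<..<1}"
      using g'[of "\<theta> 0"] g'[of "\<theta> x"] by (auto simp: \<Gamma>_def)
    have "continuous_on {0<..<1} \<sigma>'" by (rule continuous_on_subset[OF continuous_\<sigma>']) auto
    then have "continuous_on {0<..<1} (\<lambda>z. (z * \<sigma>' z * a - sqrt (D\<^sup>2 + (z * \<sigma>' z * a)\<^sup>2)) / z)"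
      by (intro continuous_intros) auto
    then show "continuous_on {min (\<Gamma> 0) (\<Gamma> x)..max (\<Gamma> 0) (\<Gamma> x)}
        (\<lambda>z. (z * \<sigma>' z * a - sqrt (D\<^sup>2 + (z * \<sigma>' z * a)\<^sup>2)) / z)"
      using sub by (rule continuous_on_subset)
    fix z assume "min (\<Gamma> 0) (\<Gamma> x) \<le> z" "z \<le> max (\<Gamma> 0) (\<Gamma> x)"
    then have z: "z \<in> {0<..<1}" using sub by auto
    define t where "t = \<tau> z"
    have gt: "g t = z" using g(3)[OF z] by (simp add: t_def)
    have "\<kappa> t * \<tau>' z = (h t * q t + (1 - q t)) * \<tau>' z"
      using identities(1)[of t] by (simp add: h_bal[OF that])
    also have "h t * q t + (1 - q t) = (h t * A z - D) / (A z - D)"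
      unfolding q1 by (simp add: q_def gt diff_divide_distrib)
    also have "\<dots> * \<tau>' z = (h t * A z - D) / z"
      using \<tau>'_A[of t] AD[of t] by (simp add: gt)
    also have "\<dots> = (z * \<sigma>' z * a - sqrt (D\<^sup>2 + (z * \<sigma>' z * a)\<^sup>2)) / z"
      using formula[OF that, of t] by (simp add: gt) (simp add: A_def)
    finally have "\<kappa> (\<tau> z) * \<tau>' z = (z * \<sigma>' z * a - sqrt (D\<^sup>2 + (z * \<sigma>' z * a)\<^sup>2)) / z"
      by (simp add: t_def)
    moreover have "((\<lambda>z. X (\<tau> z)) has_real_derivative \<kappa> (\<tau> z) * \<tau>' z) (at z)"
      by (rule DERIV_chain2[OF X d\<tau>[OF z]])
    ultimately show "((\<lambda>z. X (\<tau> z)) has_vector_derivative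
        (z * \<sigma>' z * a - sqrt (D\<^sup>2 + (z * \<sigma>' z * a)\<^sup>2)) / z) (at z within {min (\<Gamma> 0) (\<Gamma> x)..max (\<Gamma> 0) (\<Gamma> x)})"
      by (simp add: has_real_derivative_iff_has_vector_derivative[symmetric] has_field_derivative_at_within)
  qed
  then have integral: "(LBINT z=ereal (\<Gamma> 0)..ereal (\<Gamma> x).
       (z * \<sigma>' z * a - sqrt (D\<^sup>2 + (z * \<sigma>' z * a)\<^sup>2)) / z) = x" if "G = 0" for x
    using that by (simp add: \<Gamma>_def g(2) \<theta>(1))
  show ?thesis
  proof (rule that[OF prof anti lims _ _ _ _ cH d\<Gamma> c\<Gamma>' dH cH' H_formula integral])
    show "a < H x" "H x < 2 * a" "0 < \<Gamma> x" "\<Gamma> x < 1" for x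
      using h[of "\<theta> x"] g'[of "\<theta> x"] by (auto simp: H_def \<Gamma>_def)
  qed
qed

end

section \<open>Profiles without diffusion\<close>

text \<open>Where the concentration vanishes, the mass balance separates to
  \<open>y ^ 3 / (y - a) dy = - (3 / G) dx\<close>. Division with remainder,
  \<open>y ^ 3 = (y - a) * (y\<^sup>2 + a * y + a\<^sup>2) + a ^ 3\<close>, gives the primitive
  \<open>A\<close>; its logarithm is why the height \<open>a\<close> is reached only at
  infinity.\<close>

lemma height_profile_no_surfactant:
  fixes a G :: real
  assumes a: "a > 0" and G: "G > 0"
  obtains H where "\<And>x. a < H x" "\<And>x. H x \<le> 2 * a" "\<And>x. x \<le> 0 \<Longrightarrow> H x = 2 * a"
    "continuous_on UNIV H" "\<And>x y. 0 \<le> x \<Longrightarrow> x < y \<Longrightarrow> H y < H x" "(H \<longlongrightarrow> a) at_top"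
    "\<And>x. 0 < x \<Longrightarrow> (H has_real_derivative - 3 * (H x - a) / (G * H x ^ 3)) (at x)"
proof -
  define A where "A = (\<lambda>y. y ^ 3 / 3 + a * y\<^sup>2 / 2 + a\<^sup>2 * y + a ^ 3 * ln (y - a))"
  define A' where "A' = (\<lambda>y. y ^ 3 / (y - a))"
  have dA: "(A has_real_derivative A' y) (at y)" if "y \<in> {a<..}" for y
  proof -
    have "(A has_real_derivative (y\<^sup>2 + a * y + a\<^sup>2 + a ^ 3 * (1 / (y - a)))) (at y)"
      unfolding A_def using that by (auto intro!: derivative_eq_intros)
    moreover have "y\<^sup>2 + a * y + a\<^sup>2 + a ^ 3 * (1 / (y - a)) = A' y"
      using that by (simp add: A'_def field_simps power2_eq_square power3_eq_cube)
    ultimately show ?thesis by simp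
  qed
  have A'_pos: "A' y > 0" if "y \<in> {a<..}" for y using that a by (auto simp: A'_def)
  have range: "A ` {a<..} = UNIV"
  proof (rule unbounded_connected_real_UNIV)
    show "connected (A ` {a<..})"
      by (intro connected_continuous_image continuous_at_imp_continuous_on ballI DERIV_isCont[OF dA]) auto
    fix v
    \<comment> \<open>The term \<open>a\<^sup>2 * y\<close> alone exceeds
      \<open>\<bar>v\<bar>\<close>, and \<open>y \<ge> a + 1\<close> makes the logarithm
      nonnegative.\<close>
    define y where "y = a + 1 + (\<bar>v\<bar> + 1) / a\<^sup>2"
    have y: "a + 1 \<le> y" using a by (simp add: y_def)
    have "a\<^sup>2 * y = a\<^sup>2 * (a + 1) + \<bar>v\<bar> + 1" using a by (simp add: y_def field_simps)
    moreover have "0 \<le> a\<^sup>2 * (a + 1)" "0 \<le> y ^ 3 / 3" "0 \<le> a * y\<^sup>2 / 2" "0 \<le> a ^ 3 * ln (y - a)"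
      using y a by auto
    ultimately have "v < A y" unfolding A_def by linarith
    then show "\<exists>x\<in>A ` {a<..}. v < x" using y by auto
    \<comment> \<open>\<open>C\<close> bounds the polynomial part for heights up to
      \<open>a + 1\<close>; \<open>u\<close> is then chosen so that the logarithmic part is at most
      \<open>v - C - 1\<close>.\<close>
    define C where "C = (a + 1) ^ 3 / 3 + a * (a + 1)\<^sup>2 / 2 + a\<^sup>2 * (a + 1)"
    define u where "u = min 1 (exp ((v - C - 1) / a ^ 3))"
    have u: "0 < u" "u \<le> 1" by (auto simp: u_def)
    have "ln u \<le> ln (exp ((v - C - 1) / a ^ 3))" using u(1) by (subst ln_le_cancel_iff) (auto simp: u_def)
    then have "a ^ 3 * ln u \<le> a ^ 3 * ((v - C - 1) / a ^ 3)" using a by (intro mult_left_mono) auto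
    then have "a ^ 3 * ln u \<le> v - C - 1" using a by simp
    moreover have "(a + u) ^ 3 / 3 \<le> (a + 1) ^ 3 / 3" using u a by (intro divide_right_mono power_mono) auto
    moreover have "a * (a + u)\<^sup>2 / 2 \<le> a * (a + 1)\<^sup>2 / 2"
      using u a by (intro divide_right_mono mult_left_mono power_mono) auto
    moreover have "a\<^sup>2 * (a + u) \<le> a\<^sup>2 * (a + 1)" using u by (intro mult_left_mono) auto
    moreover have "A (a + u) = (a + u) ^ 3 / 3 + a * (a + u)\<^sup>2 / 2 + a\<^sup>2 * (a + u) + a ^ 3 * ln u"
      by (simp add: A_def)
    ultimately have "A (a + u) < v" using C_def by linarith
    then show "\<exists>x\<in>A ` {a<..}. x < v" using u by auto
  qed
  obtain Y where Y: "\<And>t. Y t \<in> {a<..}" "\<And>t. A (Y t) = t" "\<And>y. y \<in> {a<..} \<Longrightarrow> Y (A y) = y"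
    "\<And>t. (Y has_real_derivative inverse (A' (Y t))) (at t)"
    and A_less: "\<And>x y. x \<in> {a<..} \<Longrightarrow> y \<in> {a<..} \<Longrightarrow> x < y \<Longrightarrow>
      if \<forall>x\<in>{a<..}. A' x > 0 then A x < A y else A y < A x"
  proof (rule inverse_C1_diffeomorphism[of "{a<..}" A UNIV A'])
    show "is_interval {a<..}" by (simp add: is_interval_1)
  qed (use range dA A'_pos in auto)
  have Y_mono: "Y s < Y t" if "s < t" for s t
  proof (rule ccontr)
    assume "\<not> Y s < Y t"
    then have "A (Y t) \<le> A (Y s)"
      using A_less[OF Y(1)[of t] Y(1)[of s]] A'_pos by (cases "Y s = Y t") auto
    then show False using that Y(2) by simp
  qed
  \<comment> \<open>Replacing \<open>x\<close> by \<open>max x 0\<close> freezes the height at its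
    value \<open>2 * a\<close> behind the front.\<close>
  define H where "H = (\<lambda>x. Y (A (2 * a) - 3 * max x 0 / G))"
  have H0: "Y (A (2 * a)) = 2 * a" using Y(3) a by simp
  have cY: "continuous_on UNIV Y"
    by (intro continuous_at_imp_continuous_on ballI DERIV_isCont[OF Y(4)])
  have dec: "H y < H x" if "0 \<le> x" "x < y" for x y
    unfolding H_def using that G by (intro Y_mono) (auto simp: divide_strict_right_mono)
  show ?thesis
  proof (rule that[of H])
    show "a < H x" for x using Y(1) by (simp add: H_def)
    then have aH: "a < H x" for x .
    show H_neg: "H x = 2 * a" if "x \<le> 0" for x using that H0 by (simp add: H_def max_def)
    show "H x \<le> 2 * a" for x
      using dec[of 0 x] H_neg[of x] H_neg[of 0] by (cases "x \<le> 0") auto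
    show "continuous_on UNIV H"
      unfolding H_def using G by (intro continuous_on_compose2[OF cY] continuous_intros) auto
    show "H y < H x" if "0 \<le> x" "x < y" for x y using dec[OF that] .
    show "(H \<longlongrightarrow> a) at_top"
    proof (rule order_tendstoI)
      fix b assume "a < b"
      have "H x < b" if "max 0 (G / 3 * (A (2 * a) - A b)) < x" for x
      proof -
        have "A (2 * a) - 3 * max x 0 / G < A b" using that G by (simp add: field_simps)
        then show ?thesis using Y_mono Y(3)[of b] \<open>a < b\<close> by (fastforce simp: H_def)
      qed
      then show "eventually (\<lambda>x. H x < b) at_top" unfolding eventually_at_top_dense by blast
    next
      fix b assume "b < a"
      then show "eventually (\<lambda>x. b < H x) at_top"
        using aH by (intro always_eventually allI) (blast intro: less_trans)
    qed
    show "(H has_real_derivative - 3 * (H x - a) / (G * H x ^ 3)) (at x)" if "0 < x" for x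
    proof -
      have "((\<lambda>x. Y (A (2 * a) - 3 * x / G)) has_real_derivative
          inverse (A' (Y (A (2 * a) - 3 * x / G))) * (- 3 / G)) (at x)"
        by (rule DERIV_chain2[OF Y(4)]) (use G in \<open>auto intro!: derivative_eq_intros\<close>)
      moreover have "Y (A (2 * a) - 3 * x / G) = H x" using that by (simp add: H_def)
      moreover have "inverse (A' (H x)) * (- 3 / G) = - 3 * (H x - a) / (G * H x ^ 3)"
        by (simp only: A'_def inverse_divide times_divide_times_eq mult.commute)
      ultimately have "((\<lambda>x. Y (A (2 * a) - 3 * x / G)) has_real_derivative - 3 * (H x - a) / (G * H x ^ 3)) (at x)"
        by simp
      then show ?thesis
        by (rule has_field_derivative_transform_within_open[where S="{0<..}"]) (use that in \<open>auto simp: H_def\<close>)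
    qed
  qed
qed

lemma continuous_on_punctured_If:
  fixes f g :: "real \<Rightarrow> 'a::topological_space"
  assumes "continuous_on {..<0} f" "continuous_on {0<..} g"
  shows "continuous_on (- {0}) (\<lambda>x. if x < 0 then f x else g x)"
proof -
  have "continuous_on ({..<0} \<union> {0<..}) (\<lambda>x. if x < 0 then f x else g x)"
  proof (rule continuous_on_open_Un)
    show "continuous_on {..<0} (\<lambda>x. if x < 0 then f x else g x)"
      by (rule continuous_on_eq[OF assms(1)]) auto
    show "continuous_on {0<..} (\<lambda>x. if x < 0 then f x else g x)"
      by (rule continuous_on_eq[OF assms(2)]) auto
  qed auto
  moreover have "{..<0} \<union> {0<..} = - {0::real}" by auto
  ultimately show ?thesis by simp
qed

context surface_tension
begin

lemma \<sigma>_image: "\<sigma> ` {0<..<1} = {..<\<sigma> 0}"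
proof
  show "\<sigma> ` {0<..<1} \<subseteq> {..<\<sigma> 0}" using \<sigma>_decreasing[of 0] by auto
  show "{..<\<sigma> 0} \<subseteq> \<sigma> ` {0<..<1}"
  proof
    fix y assume "y \<in> {..<\<sigma> 0}"
    then have y: "y < \<sigma> 0" by simp
    obtain z where z: "0 < z" "z < 1" "\<sigma> z < y" using \<sigma>_unbounded[of 0 y] by auto
    have "continuous_on {0..z} \<sigma>" by (rule continuous_on_subset[OF continuous_\<sigma>]) (use z in auto)
    then obtain x where x: "0 \<le> x" "x \<le> z" "\<sigma> x = y"
      using IVT2'[of \<sigma> z y 0] z y by auto
    then have "x \<noteq> 0" using y by auto
    then show "y \<in> \<sigma> ` {0<..<1}" using x z by auto
  qed
qed

lemma inj_\<sigma>: "inj_on \<sigma> {0..<1}"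
proof (rule linorder_inj_onI)
  fix x y :: real assume "x < y" "x \<in> {0..<1}" "y \<in> {0..<1}"
  then show "\<sigma> x \<noteq> \<sigma> y" using \<sigma>_decreasing[of x y] by auto
qed auto

text \<open>Behind the front the height is \<open>2 * a\<close>, and the surfactant balance with
  positive concentration forces \<open>\<sigma> (\<Gamma> x)\<close> to have slope
  \<open>1 / (2 * a)\<close>. It is therefore linear until it reaches \<open>\<sigma> 0\<close>,
  where the concentration becomes zero and stays so.\<close>

lemma surfactant_profile_no_diffusion:
  obtains \<Gamma> \<Gamma>' where "\<And>x. 0 \<le> \<Gamma> x" "\<And>x. \<Gamma> x < 1" "\<And>x. 0 \<le> x \<Longrightarrow> \<Gamma> x = 0"
    "\<And>x. x \<le> 0 \<Longrightarrow> \<Gamma> x = the_inv_into {0..<1} \<sigma> (\<sigma> 0 + x / (2 * a))"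
    "continuous_on UNIV \<Gamma>" "antimono \<Gamma>" "(\<Gamma> \<longlongrightarrow> 1) at_bot" "(\<Gamma> \<longlongrightarrow> 0) at_top"
    "\<And>x. x \<noteq> 0 \<Longrightarrow> (\<Gamma> has_real_derivative \<Gamma>' x) (at x)" "continuous_on (- {0}) \<Gamma>'"
    "pw_primitive (\<lambda>x. \<sigma> (\<Gamma> x)) (\<lambda>x. if x \<le> 0 then 1 / (2 * a) else 0)"
proof -
  obtain s where s: "\<And>t. t \<in> {..<\<sigma> 0} \<Longrightarrow> s t \<in> {0<..<1}" "\<And>t. t \<in> {..<\<sigma> 0} \<Longrightarrow> \<sigma> (s t) = t"
    "\<And>z. z \<in> {0<..<1} \<Longrightarrow> s (\<sigma> z) = z"
    "\<And>t. t \<in> {..<\<sigma> 0} \<Longrightarrow> (s has_real_derivative inverse (\<sigma>' (s t))) (at t)"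
  proof (rule inverse_C1_diffeomorphism[of "{0<..<1}" \<sigma> "{..<\<sigma> 0}" \<sigma>'])
    show "is_interval {0<..<1::real}" by (simp add: is_interval_1)
  qed (use \<sigma>_image \<sigma>_der neg in auto)
  define \<Gamma> where "\<Gamma> = (\<lambda>x. if x < 0 then s (\<sigma> 0 + x / (2 * a)) else 0)"
  define \<Gamma>' where "\<Gamma>' = (\<lambda>x. if x < 0 then inverse (\<sigma>' (\<Gamma> x)) * (1 / (2 * a)) else 0)"
  have arg: "\<sigma> 0 + x / (2 * a) \<in> {..<\<sigma> 0}" if "x < 0" for x
    using that a by (simp add: divide_neg_pos)
  have \<Gamma>_neg: "0 < \<Gamma> x" "\<Gamma> x < 1" "\<sigma> (\<Gamma> x) = \<sigma> 0 + x / (2 * a)" if "x < 0" for x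
    using s(1,2)[OF arg[OF that]] that by (auto simp: \<Gamma>_def)
  have \<Gamma>_pos: "\<Gamma> x = 0" if "0 \<le> x" for x using that by (simp add: \<Gamma>_def)
  have \<Gamma>01: "0 \<le> \<Gamma> x" "\<Gamma> x < 1" for x
    using \<Gamma>_neg(1,2)[of x] \<Gamma>_pos[of x] by (cases "x < 0"; simp)+
  \<comment> \<open>Order relations for \<open>\<Gamma>\<close> are proved by applying the
    decreasing function \<open>\<sigma>\<close>, since \<open>\<sigma> (\<Gamma> x)\<close> is
    piecewise linear.\<close>
  have \<sigma>\<Gamma>: "\<sigma> (\<Gamma> x) = \<sigma> 0 + min x 0 / (2 * a)" for x
    using \<Gamma>_neg(3)[of x] \<Gamma>_pos[of x] by (cases "x < 0") auto
  have dec: "\<Gamma> y \<le> \<Gamma> x" if "x \<le> y" for x y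
  proof (rule ccontr)
    assume "\<not> \<Gamma> y \<le> \<Gamma> x"
    then have "\<sigma> (\<Gamma> y) < \<sigma> (\<Gamma> x)" using \<Gamma>01 by (intro \<sigma>_decreasing) auto
    then have "min y 0 / (2 * a) < min x 0 / (2 * a)" by (simp add: \<sigma>\<Gamma>)
    then have "min y 0 < min x 0" using a by (simp add: divide_less_cancel)
    then show False using that by (simp split: if_splits add: min_def)
  qed
  \<comment> \<open>The threshold \<open>2 * a * (\<sigma> b - \<sigma> 0)\<close> is the point at
    which \<open>\<Gamma>\<close> takes the value \<open>b\<close>.\<close>
  have gt: "b < \<Gamma> x" if "x < 2 * a * (\<sigma> b - \<sigma> 0)" "0 < b" "b < 1" for x b
  proof (rule ccontr)
    assume "\<not> b < \<Gamma> x"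
    then have "\<sigma> b \<le> \<sigma> (\<Gamma> x)" using \<sigma>_decreasing[of "\<Gamma> x" b] \<Gamma>01[of x] that by (cases "\<Gamma> x = b") auto
    moreover have "x < 0"
      using that(1) mult_pos_neg[of "2 * a" "\<sigma> b - \<sigma> 0"] \<sigma>_decreasing[of 0 b] that(2,3) a by simp
    ultimately have "\<sigma> b - \<sigma> 0 \<le> x / (2 * a)" by (simp add: \<sigma>\<Gamma>)
    then have "(\<sigma> b - \<sigma> 0) * (2 * a) \<le> x" using a by (simp add: pos_le_divide_eq)
    then show False using that(1) by (simp add: mult.commute)
  qed
  have lt: "\<Gamma> x < b" if "2 * a * (\<sigma> b - \<sigma> 0) < x" "0 < b" "b < 1" for x b
  proof (rule ccontr)
    assume "\<not> \<Gamma> x < b"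
    then have le: "\<sigma> (\<Gamma> x) \<le> \<sigma> b" using \<sigma>_decreasing[of b "\<Gamma> x"] \<Gamma>01[of x] that by (cases "\<Gamma> x = b") auto
    have "x < 0" using \<Gamma>_pos[of x] \<open>\<not> \<Gamma> x < b\<close> that(2) by force
    then have "x / (2 * a) \<le> \<sigma> b - \<sigma> 0" using le by (simp add: \<sigma>\<Gamma>)
    then have "x \<le> (\<sigma> b - \<sigma> 0) * (2 * a)" using a by (simp add: pos_divide_le_eq)
    then show False using that(1) by (simp add: mult.commute)
  qed
  have d\<Gamma>: "(\<Gamma> has_real_derivative \<Gamma>' x) (at x)" if "x \<noteq> 0" for x
  proof (cases "x < 0")
    case True
    have "((\<lambda>x. s (\<sigma> 0 + x / (2 * a))) has_real_derivative inverse (\<sigma>' (s (\<sigma> 0 + x / (2 * a)))) * (1 / (2 * a))) (at x)"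
      by (rule DERIV_chain2[where f=s and g="\<lambda>x. \<sigma> 0 + x / (2 * a)", OF s(4)[OF arg[OF True]]]) (use a in \<open>auto intro!: derivative_eq_intros\<close>)
    then have "((\<lambda>x. s (\<sigma> 0 + x / (2 * a))) has_real_derivative \<Gamma>' x) (at x)"
      using True by (simp add: \<Gamma>'_def \<Gamma>_def)
    then show ?thesis
      by (rule has_field_derivative_transform_within_open[where S="{..<0}"]) (use True in \<open>auto simp: \<Gamma>_def\<close>)
  next
    case False
    have "((\<lambda>x. 0) has_real_derivative \<Gamma>' x) (at x)" using False by (simp add: \<Gamma>'_def)
    then show ?thesis
      by (rule has_field_derivative_transform_within_open[where S="{0<..}"]) (use False that in \<open>auto simp: \<Gamma>_def\<close>)
  qed
  \<comment> \<open>Derivatives from the two sides do not reach the front. Continuity there is a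
    bound from above only, as \<open>\<Gamma>\<close> is nonnegative and vanishes at 0.\<close>
  have cont0: "isCont \<Gamma> 0"
    unfolding isCont_def
  proof (rule order_tendstoI)
    fix b assume b: "\<Gamma> 0 < b"
    define b' where "b' = min b (1/2)"
    have b': "0 < b'" "b' < 1" "b' \<le> b" using b \<Gamma>_pos[of 0] by (auto simp: b'_def)
    have "2 * a * (\<sigma> b' - \<sigma> 0) < 0" using \<sigma>_decreasing[of 0 b'] b' a by (simp add: mult_pos_neg)
    then have "eventually (\<lambda>x. x \<in> {2 * a * (\<sigma> b' - \<sigma> 0)<..}) (at 0)"
      by (intro eventually_at_in_open') auto
    then show "eventually (\<lambda>x. \<Gamma> x < b) (at 0)"
      by (rule eventually_mono) (use lt[OF _ b'(1,2)] b'(3) in force)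
  next
    fix b assume "b < \<Gamma> 0"
    then have "b < \<Gamma> x" for x using \<Gamma>_pos[of 0] \<Gamma>01(1)[of x] by simp
    then show "eventually (\<lambda>x. b < \<Gamma> x) (at 0)" by simp
  qed
  have c\<Gamma>: "continuous_on UNIV \<Gamma>"
    using cont0 DERIV_isCont[OF d\<Gamma>] by (intro continuous_at_imp_continuous_on) metis
  show ?thesis
  proof (rule that[of \<Gamma> \<Gamma>'])
    show "0 \<le> \<Gamma> x" "\<Gamma> x < 1" for x by (rule \<Gamma>01)+
    show "\<Gamma> x = 0" if "0 \<le> x" for x using that by (rule \<Gamma>_pos)
    show "\<Gamma> x = the_inv_into {0..<1} \<sigma> (\<sigma> 0 + x / (2 * a))" if "x \<le> 0" for x
      by (rule the_inv_into_f_eq[OF inj_\<sigma>, symmetric]) (use that \<Gamma>01[of x] \<sigma>\<Gamma>[of x] in auto)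
    show "continuous_on UNIV \<Gamma>" by (rule c\<Gamma>)
    show "antimono \<Gamma>" using dec by (rule antimonoI)
    show "(\<Gamma> \<longlongrightarrow> 1) at_bot"
    proof (rule order_tendstoI)
      fix b :: real assume "b < 1"
      define b' where "b' = max b (1/2)"
      have b': "0 < b'" "b' < 1" "b \<le> b'" using \<open>b < 1\<close> by (auto simp: b'_def)
      then have "b < \<Gamma> x" if "x < 2 * a * (\<sigma> b' - \<sigma> 0)" for x using gt[OF that] by auto
      then show "eventually (\<lambda>x. b < \<Gamma> x) at_bot" unfolding eventually_at_bot_dense by blast
    next
      fix b :: real assume "1 < b"
      then show "eventually (\<lambda>x. \<Gamma> x < b) at_bot"
        using \<Gamma>01(2) by (intro always_eventually allI) (blast intro: less_trans)
    qed
    have "eventually (\<lambda>x. \<Gamma> x = 0) at_top"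
      using \<Gamma>_pos by (auto simp: eventually_at_top_linorder intro!: exI[of _ 0])
    then show "(\<Gamma> \<longlongrightarrow> 0) at_top" by (rule tendsto_eventually)
    show "(\<Gamma> has_real_derivative \<Gamma>' x) (at x)" if "x \<noteq> 0" for x using that by (rule d\<Gamma>)
    show "continuous_on (- {0}) \<Gamma>'"
      unfolding \<Gamma>'_def
    proof (rule continuous_on_punctured_If)
      have "continuous_on {..<0} (\<lambda>x. \<sigma>' (\<Gamma> x))"
        by (rule continuous_on_compose2[OF continuous_\<sigma>' continuous_on_subset[OF c\<Gamma>]]) (use \<Gamma>01 in auto)
      then show "continuous_on {..<0} (\<lambda>x. inverse (\<sigma>' (\<Gamma> x)) * (1 / (2 * a)))"
        using neg \<Gamma>01 a by (intro continuous_intros) (auto simp: less_imp_neq)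
    qed auto
    show "pw_primitive (\<lambda>x. \<sigma> (\<Gamma> x)) (\<lambda>x. if x \<le> 0 then 1 / (2 * a) else 0)"
      unfolding pw_primitive_def \<sigma>\<Gamma>
    proof (intro conjI allI impI)
      show "continuous_on UNIV (\<lambda>x. \<sigma> 0 + min x 0 / (2 * a))"
        using a by (intro continuous_intros) auto
      show "\<exists>C. \<forall>x. \<bar>x\<bar> \<le> R \<longrightarrow> \<bar>if x \<le> 0 then 1 / (2 * a) else 0\<bar> \<le> C" for R
        using a by (intro exI[of _ "1 / (2 * a)"]) auto
      fix x :: real assume x: "x \<noteq> 0"
      show "((\<lambda>x. \<sigma> 0 + min x 0 / (2 * a)) has_real_derivative (if x \<le> 0 then 1 / (2 * a) else 0)) (at x)"
      proof (cases "x < 0")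
        case True
        have "((\<lambda>x. \<sigma> 0 + x / (2 * a)) has_real_derivative 1 / (2 * a)) (at x)"
          using a by (auto intro!: derivative_eq_intros)
        then have "((\<lambda>x. \<sigma> 0 + min x 0 / (2 * a)) has_real_derivative 1 / (2 * a)) (at x)"
          by (rule has_field_derivative_transform_within_open[where S="{..<0}"]) (use True in auto)
        then show ?thesis using True by simp
      next
        case False
        have "((\<lambda>x. \<sigma> 0) has_real_derivative 0) (at x)" by simp
        then have "((\<lambda>x. \<sigma> 0 + min x 0 / (2 * a)) has_real_derivative 0) (at x)"
          by (rule has_field_derivative_transform_within_open[where S="{0<..}"]) (use False x in auto)
        then show ?thesis using False x by simp
      qed
    qed measurable
  qed
qed

end

section \<open>Existence of travelling waves\<close>

lemma C1_differentiable_onI_real: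
  assumes "\<And>x. (f has_real_derivative f' x) (at x)" "continuous_on S f'"
  shows "f C1_differentiable_on S"
  using assms unfolding C1_differentiable_on_def
  by (auto simp: has_real_derivative_iff_has_vector_derivative)

lemma C1_differentiable_on_PairI:
  assumes "\<And>x. x \<in> S \<Longrightarrow> (f has_real_derivative f' x) (at x)" "continuous_on S f'"
    and "\<And>x. x \<in> S \<Longrightarrow> (g has_real_derivative g' x) (at x)" "continuous_on S g'"
  shows "(\<lambda>x. (f x, g x)) C1_differentiable_on S"
  using assms unfolding C1_differentiable_on_def has_real_derivative_iff_has_vector_derivative
  by (intro exI[of _ "\<lambda>x. (f' x, g' x)"]) (auto intro!: has_vector_derivative_Pair continuous_on_Pair)

theorem proposition1p2:
  fixes D G Hs :: real and \<sigma> \<sigma>' \<rho> :: "real \<Rightarrow> real"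
  assumes "D \<ge> 0" and "G \<ge> 0" and "Hs > 0"
    and "\<And>z. z \<in> {0..<1} \<Longrightarrow> (\<sigma> has_real_derivative \<sigma>' z) (at z within {0..<1})"
    and "continuous_on {0..<1} \<sigma>'"
    and "\<And>z. z \<in> {0..<1} \<Longrightarrow> \<sigma>' z < 0"
    and "\<not> \<sigma>' absolutely_integrable_on {0<..<1}"
    and "\<sigma> 0 > 0"
    and "filterlim \<sigma>' at_bot (at_left 1)"
    and "\<And>z. z \<in> {0..<1} \<Longrightarrow> \<rho> z = - 1 / \<sigma>' z" and "\<rho> 1 = 0"
    and "G > 0 \<Longrightarrow> \<forall>z\<in>{0<..<1}. \<exists>L. L-lipschitz_on {0..z} \<rho>"
  shows "\<exists>H \<Gamma> :: real \<Rightarrow> real.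
    traveling_wave_profile G D \<sigma> 1 H \<Gamma> \<and>
    antimono \<Gamma> \<and>
    (H \<longlongrightarrow> 2 * Hs) at_bot \<and> (\<Gamma> \<longlongrightarrow> 1) at_bot \<and>
    (H \<longlongrightarrow> Hs) at_top \<and> (\<Gamma> \<longlongrightarrow> 0) at_top \<and>
    (G = 0 \<and> D = 0 \<longrightarrow>
       continuous_on UNIV \<Gamma> \<and>
       (\<lambda>\<xi>. (H \<xi>, \<Gamma> \<xi>)) C1_differentiable_on (- {0}) \<and>
       (\<forall>\<xi><0. H \<xi> = 2 * Hs) \<and> (\<forall>\<xi>>0. H \<xi> = Hs) \<and>
       (\<forall>\<xi>\<le>0. \<Gamma> \<xi> = the_inv_into {0..<1} \<sigma> (\<sigma> 0 + \<xi> / (2 * Hs))) \<and> (\<forall>\<xi>\<ge>0. \<Gamma> \<xi> = 0)) \<and>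
    (G = 0 \<and> D > 0 \<longrightarrow>
       continuous_on UNIV H \<and> \<Gamma> C1_differentiable_on UNIV \<and>
       (\<forall>\<xi>. Hs < H \<xi> \<and> H \<xi> < 2 * Hs \<and> 0 < \<Gamma> \<xi> \<and> \<Gamma> \<xi> < 1) \<and>
       (\<forall>\<xi>. H \<xi> = (D + \<Gamma> \<xi> * \<sigma>' (\<Gamma> \<xi>) * Hs - sqrt (D\<^sup>2 + (\<Gamma> \<xi> * \<sigma>' (\<Gamma> \<xi>) * Hs)\<^sup>2))
                    / (\<Gamma> \<xi> * \<sigma>' (\<Gamma> \<xi>))) \<and>
       (\<forall>\<xi>. (LBINT z=ereal (\<Gamma> 0)..ereal (\<Gamma> \<xi>).
               (z * \<sigma>' z * Hs - sqrt (D\<^sup>2 + (z * \<sigma>' z * Hs)\<^sup>2)) / z) = \<xi>)) \<and>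
    (G > 0 \<and> D = 0 \<longrightarrow>
       continuous_on UNIV (\<lambda>\<xi>. (H \<xi>, \<Gamma> \<xi>)) \<and>
       (\<lambda>\<xi>. (H \<xi>, \<Gamma> \<xi>)) C1_differentiable_on (- {0}) \<and>
       strict_antimono_on {0..} H \<and> (\<forall>\<xi>\<le>0. H \<xi> = 2 * Hs) \<and> (\<forall>\<xi>\<ge>0. \<Gamma> \<xi> = 0)) \<and>
    (G > 0 \<and> D > 0 \<longrightarrow>
       (\<lambda>\<xi>. (H \<xi>, \<Gamma> \<xi>)) C1_differentiable_on UNIV \<and>
       (\<forall>\<xi>. Hs < H \<xi> \<and> H \<xi> < 2 * Hs \<and> 0 < \<Gamma> \<xi> \<and> \<Gamma> \<xi> < 1))"
proof -
  interpret surface_tension \<sigma> \<sigma>' Hs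
    using assms(3-7,9) by unfold_locales auto
  show ?thesis
  proof (cases "D > 0")
    case True
    obtain H \<Gamma> H' \<Gamma>' where profile: "traveling_wave_profile G D \<sigma> 1 H \<Gamma>" "antimono \<Gamma>"
      "(H \<longlongrightarrow> 2 * Hs) at_bot" "(\<Gamma> \<longlongrightarrow> 1) at_bot" "(H \<longlongrightarrow> Hs) at_top" "(\<Gamma> \<longlongrightarrow> 0) at_top"
      "\<And>x. Hs < H x" "\<And>x. H x < 2 * Hs" "\<And>x. 0 < \<Gamma> x" "\<And>x. \<Gamma> x < 1" "continuous_on UNIV H"
      and d\<Gamma>: "\<And>x. (\<Gamma> has_real_derivative \<Gamma>' x) (at x)" "continuous_on UNIV \<Gamma>'"
      and dH: "\<And>x. G > 0 \<Longrightarrow> (H has_real_derivative H' x) (at x)" "G > 0 \<Longrightarrow> continuous_on UNIV H'"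
      and formulas: "\<And>x. G = 0 \<Longrightarrow> H x = (D + \<Gamma> x * \<sigma>' (\<Gamma> x) * Hs - sqrt (D\<^sup>2 + (\<Gamma> x * \<sigma>' (\<Gamma> x) * Hs)\<^sup>2))
                    / (\<Gamma> x * \<sigma>' (\<Gamma> x))"
        "\<And>x. G = 0 \<Longrightarrow> (LBINT z=ereal (\<Gamma> 0)..ereal (\<Gamma> x).
               (z * \<sigma>' z * Hs - sqrt (D\<^sup>2 + (z * \<sigma>' z * Hs)\<^sup>2)) / z) = x"
      by (rule diffusive_profile[OF \<open>G \<ge> 0\<close> True]) (rule that, assumption+)
    have "\<Gamma> C1_differentiable_on UNIV"
      using d\<Gamma> by (rule C1_differentiable_onI_real)
    moreover have "(\<lambda>\<xi>. (H \<xi>, \<Gamma> \<xi>)) C1_differentiable_on UNIV" if "G > 0"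
      using dH[OF that] d\<Gamma> by (intro C1_differentiable_on_PairI[of _ H H' \<Gamma> \<Gamma>']) auto
    moreover have "D \<noteq> 0" using True by simp
    ultimately show ?thesis
      using profile formulas by - (rule exI[of _ H], rule exI[of _ \<Gamma>], intro conjI, blast+)
  next
    case False
    then have D: "D = 0" using \<open>D \<ge> 0\<close> by simp
    \<comment> \<open>At the front \<open>W\<close> takes its value from the left, as the height
      does in both cases below: the balances are required at every point, and there
      \<open>mass\<close> reads
      \<open>(2 * Hs)\<^sup>2 / 2 * (1 / (2 * Hs)) = 2 * Hs - Hs\<close>.\<close>
    define W where "W = (\<lambda>x::real. if x \<le> 0 then 1 / (2 * Hs) else 0)"
    obtain \<Gamma> \<Gamma>' where \<Gamma>: "\<And>x. 0 \<le> \<Gamma> x" "\<And>x. \<Gamma> x < 1" "\<And>x. 0 \<le> x \<Longrightarrow> \<Gamma> x = 0"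
      "\<And>x. x \<le> 0 \<Longrightarrow> \<Gamma> x = the_inv_into {0..<1} \<sigma> (\<sigma> 0 + x / (2 * Hs))"
      "continuous_on UNIV \<Gamma>" "antimono \<Gamma>" "(\<Gamma> \<longlongrightarrow> 1) at_bot" "(\<Gamma> \<longlongrightarrow> 0) at_top"
      and d\<Gamma>: "\<And>x. x \<noteq> 0 \<Longrightarrow> (\<Gamma> has_real_derivative \<Gamma>' x) (at x)" "continuous_on (- {0}) \<Gamma>'"
      and W: "pw_primitive (\<lambda>x. \<sigma> (\<Gamma> x)) W"
      by (rule surfactant_profile_no_diffusion) (rule that, assumption+, simp only: W_def)
    have \<Gamma>m: "\<Gamma> \<in> borel_measurable borel" using \<Gamma>(5) by (rule borel_measurable_continuous_onI)
    show ?thesis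
    proof (cases "G = 0")
      case True
      \<comment> \<open>With \<open>G = 0\<close> no derivative of the height enters, so the jump
        only has to balance the mass flux: \<open>W = 1 / (2 * Hs)\<close> on the left requires
        \<open>2 * Hs\<close>, and \<open>W = 0\<close> on the right requires
        \<open>Hs\<close>.\<close>
      define H where "H = (\<lambda>x::real. if x \<le> 0 then 2 * Hs else Hs)"
      have "traveling_wave_profile G D \<sigma> 1 H \<Gamma>"
      proof (rule traveling_wave_profileI[where B="2 * Hs" and W=W and H'="\<lambda>x. 0" and \<Gamma>'="\<lambda>x. 0" and c=Hs])
        show "H \<in> borel_measurable borel" unfolding H_def by measurable
        show "(H x)\<^sup>2 / 2 * W x - G / 3 * H x ^ 3 * 0 = H x - Hs" for x
          using \<open>Hs > 0\<close> by (simp add: H_def W_def power2_eq_square)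
        show "H x * \<Gamma> x * W x - D * 0 - G / 2 * \<Gamma> x * (H x)\<^sup>2 * 0 = \<Gamma> x" for x
          using \<open>Hs > 0\<close> \<Gamma>(3)[of x] by (simp add: H_def W_def)
      qed (use True D \<open>Hs > 0\<close> \<Gamma> \<Gamma>m W in \<open>auto simp: H_def\<close>)
      moreover have "(H has_real_derivative 0) (at x)" if "x \<noteq> 0" for x
      proof (cases "x < 0")
        case True
        show ?thesis
          by (rule has_field_derivative_transform_within_open[where S="{..<0}" and f="\<lambda>x. 2 * Hs"])
            (use True in \<open>auto simp: H_def\<close>)
      next
        case False
        show ?thesis
          by (rule has_field_derivative_transform_within_open[where S="{0<..}" and f="\<lambda>x. Hs"])
            (use False that in \<open>auto simp: H_def\<close>)
      qed
      then have "(\<lambda>\<xi>. (H \<xi>, \<Gamma> \<xi>)) C1_differentiable_on (- {0})"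
        using d\<Gamma> by (intro C1_differentiable_on_PairI[of _ H "\<lambda>x. 0" \<Gamma> \<Gamma>']) auto
      moreover have "(H \<longlongrightarrow> 2 * Hs) at_bot"
        by (rule tendsto_eventually) (auto simp: H_def eventually_at_bot_linorder intro!: exI[of _ 0])
      moreover have "(H \<longlongrightarrow> Hs) at_top"
        by (rule tendsto_eventually) (auto simp: H_def eventually_at_top_dense intro!: exI[of _ 0])
      moreover have "\<forall>\<xi><0. H \<xi> = 2 * Hs" "\<forall>\<xi>>0. H \<xi> = Hs" by (auto simp: H_def)
      ultimately show ?thesis
        using True D \<Gamma> by - (rule exI[of _ H], rule exI[of _ \<Gamma>], simp)
    next
      case False
      then have G: "G > 0" using \<open>G \<ge> 0\<close> by simp
      obtain H where H: "\<And>x. Hs < H x" "\<And>x. H x \<le> 2 * Hs" "\<And>x. x \<le> 0 \<Longrightarrow> H x = 2 * Hs"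
        "continuous_on UNIV H" "\<And>x y. 0 \<le> x \<Longrightarrow> x < y \<Longrightarrow> H y < H x" "(H \<longlongrightarrow> Hs) at_top"
        and dH_pos: "\<And>x. 0 < x \<Longrightarrow> (H has_real_derivative - 3 * (H x - Hs) / (G * H x ^ 3)) (at x)"
        by (rule height_profile_no_surfactant[OF \<open>Hs > 0\<close> G]) (rule that, assumption+)
      \<comment> \<open>The value 0 at the front matches \<open>H 0 = 2 * Hs\<close> and
        \<open>W 0 = 1 / (2 * Hs)\<close> in the mass balance; the one-sided slope from the right
        would not.\<close>
      define H' where "H' = (\<lambda>x. if x \<le> 0 then 0 else - 3 * (H x - Hs) / (G * H x ^ 3))"
      have H_pos: "0 < H x" for x using H(1)[of x] \<open>Hs > 0\<close> by linarith
      have Hm[measurable]: "H \<in> borel_measurable borel" using H(4) by (rule borel_measurable_continuous_onI)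
      have dH: "(H has_real_derivative H' x) (at x)" if "x \<noteq> 0" for x
      proof (cases "x < 0")
        case True
        have "(H has_real_derivative 0) (at x)"
          by (rule has_field_derivative_transform_within_open[where S="{..<0}" and f="\<lambda>x. 2 * Hs"])
            (use True H(3) in auto)
        then show ?thesis using True by (simp add: H'_def)
      qed (use that dH_pos[of x] in \<open>auto simp: H'_def\<close>)
      have cH: "continuous_on UNIV (\<lambda>x. - 3 * (H x - Hs) / (G * H x ^ 3))"
        using H_pos G by (intro continuous_intros H(4)) (auto simp: less_imp_neq[symmetric])
      have "continuous_on (- {0}) (\<lambda>x. if x < 0 then 0 else - 3 * (H x - Hs) / (G * H x ^ 3))"
        by (intro continuous_on_punctured_If continuous_on_const continuous_on_subset[OF cH]) auto
      then have cH': "continuous_on (- {0}) H'"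
        by (rule continuous_on_eq) (auto simp: H'_def)
      have bound: "\<exists>C. \<forall>x. \<bar>x\<bar> \<le> R \<longrightarrow> \<bar>H' x\<bar> \<le> C" for R
      proof -
        obtain C where C: "\<And>x. x \<in> {-R..R} \<Longrightarrow> \<bar>- 3 * (H x - Hs) / (G * H x ^ 3)\<bar> \<le> C"
          using continuous_on_compact_abs_bound[OF cH compact_Icc] by blast
        have "\<bar>H' x\<bar> \<le> max 0 C" if "\<bar>x\<bar> \<le> R" for x
        proof (cases "x \<le> 0")
          case False
          have "\<bar>- 3 * (H x - Hs) / (G * H x ^ 3)\<bar> \<le> C" using that False by (intro C) auto
          then have "\<bar>H' x\<bar> \<le> C" using False by (simp only: H'_def if_False)
          then show ?thesis by simp
        qed (simp add: H'_def)
        then show ?thesis by blast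
      qed
      have "pw_primitive H H'"
        unfolding pw_primitive_def using H(4) dH bound by (auto simp: H'_def)
      then have "traveling_wave_profile G D \<sigma> 1 H \<Gamma>"
      proof (intro traveling_wave_profileI[where B="2 * Hs" and W=W and H'=H' and \<Gamma>'="\<lambda>x. 0" and c=Hs])
        show "(H x)\<^sup>2 / 2 * W x - G / 3 * H x ^ 3 * H' x = H x - Hs" for x
          using \<open>Hs > 0\<close> H(3)[of x] H_pos[of x] G by (simp add: H'_def W_def power2_eq_square field_simps)
        show "H x * \<Gamma> x * W x - D * 0 - G / 2 * \<Gamma> x * (H x)\<^sup>2 * H' x = \<Gamma> x" for x
          using \<open>Hs > 0\<close> \<Gamma>(3)[of x] H(3)[of x] by (simp add: H'_def W_def)
      qed (use D H H_pos \<Gamma> \<Gamma>m Hm W in auto)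
      moreover have "(\<lambda>\<xi>. (H \<xi>, \<Gamma> \<xi>)) C1_differentiable_on (- {0})"
        using d\<Gamma> dH cH' by (intro C1_differentiable_on_PairI[of _ H H' \<Gamma> \<Gamma>']) auto
      moreover have "(H \<longlongrightarrow> 2 * Hs) at_bot"
        by (rule tendsto_eventually) (auto simp: H(3) eventually_at_bot_linorder intro!: exI[of _ 0])
      moreover have "strict_antimono_on {0..} H"
        using H(5) by (auto simp: monotone_on_def)
      moreover have "continuous_on UNIV (\<lambda>\<xi>. (H \<xi>, \<Gamma> \<xi>))"
        using H(4) \<Gamma>(5) by (rule continuous_on_Pair)
      ultimately show ?thesis
        using G D \<Gamma> H by - (rule exI[of _ H], rule exI[of _ \<Gamma>], simp)
    qed
  qed
qed

end
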